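(* Let $R$ be an étale $A$-algebra. Then $R\otimes_A T^1(A)\subseteq\{X\in T^0(R): \varphi_{0,R}(X)\in\psi_{0,R}(T^0(R))\text{ and }\varphi_{0,R}(X^{ad})\in\psi_{0,R}(T^0(R))\}$ as $R$-submodules of $T^0(R)$, and in fact these two submodules are equal.
   Context: $F$ is a non-Archimedean local field with ring of integers $A$ and residue characteristic $p$. $(K,\sigma)$ is one of: $K=F$ with $\mathrm{char}\,F\neq2$, $\sigma=\mathrm{id}$; $K=E$ a separable quadratic extension with nontrivial automorphism $\sigma$; $K=F\oplus F$, $\sigma(x,y)=(y,x)$; $K=D$ the quaternion division algebra with standard involution. $B$ is the maximal $A$-order of $K$; $\epsilon\in\{\pm1\}$. If $(K,\epsilon,p)\ne(F,1,2)$, $L$ is a free right $B$-module of rank $n$ with a $(\sigma,\epsilon)$-hermitian form $h:L\times L\to B$ and "hermitian form" means such a form; if $(K,\epsilon,p)=(F,1,2)$, $L$ is a free $A$-module of rank $n$ with quadratic form $h$, $h(v,w)=\frac12(h(v+w)-h(v)-h(w))$, and "hermitian form" means quadratic form (conditions/formulas via the associated bilinear form). $V=L\otimes_AF$ is nondegenerate; $L^{\#}=\{x\in V:h(x,L)\subset B\}$ and $(L^{\#})^{\#}=L$ is assumed. Adjoint $X^{ad}$: $h(X(v),w)=h(v,X^{ad}(w))$. For a flat $A$-algebra $R$: $T^0(R)=\{X\in\mathrm{End}_{B\otimes R}(L\otimes R):X(L^{\#}\otimes R)\subset L^{\#}\otimes R\}$; $H^0(R)$ = hermitian forms $f$ on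 $L\otimes R$ with $f(L\otimes R,L^{\#}\otimes R)\subset B\otimes R$; $\varphi_{0,R}(X)=h\circ X$ with $(h\circ X)(v,w)=h(X(v),X(w))$; $\psi_{0,R}(X)(v,w)=h(v,X(w))+h(X(v),w)$. Define $T^1(A)=\{X\in T^0(A):\varphi_{0,A}(X),\varphi_{0,A}(X^{ad})\in\psi_{0,A}(T^0(A))\}$, an $A$-submodule of $T^0(A)$. *)

theory Defs
  imports
    "HOL-Library.Function_Algebras"
    "HOL-Library.Poly_Mapping"
    "HOL-Computational_Algebra.Computational_Algebra"
begin

text \<open>
  Conventions. \<open>F\<close> is the type \<open>'f\<close>, \<open>A\<close> is a subset of \<open>'f\<close>, \<open>K\<close> is the type \<open>'k\<close> with structure map
  \<open>\<iota> :: 'f \<Rightarrow> 'k\<close>, and \<open>V\<close> is the type \<open>'v\<close> with right \<open>K\<close>-action \<open>act\<close>; \<open>B\<close>, \<open>L\<close> and \<open>L\<^sup>#\<close> are subsets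
  of \<open>'k\<close> and \<open>'v\<close>. An \<open>A\<close>-algebra \<open>R\<close> is a type \<open>'r\<close> with a map \<open>\<alpha> :: 'f \<Rightarrow> 'r\<close> of which only the values
  on \<open>A\<close> matter. The sorts of \<open>'r\<close> and of \<open>K \<otimes> R\<close> do not include \<open>0 \<noteq> 1\<close>, so \<open>R = 0\<close> is allowed.
\<close>

section \<open>Local fields, the algebras K, orders\<close>

definition nonarch_local_field :: "('f::field \<Rightarrow> real) \<Rightarrow> bool" where
  "nonarch_local_field nrm \<longleftrightarrow>
     (\<forall>x. 0 \<le> nrm x) \<and> (\<forall>x. nrm x = 0 \<longleftrightarrow> x = 0) \<and>
     (\<forall>x y. nrm (x * y) = nrm x * nrm y) \<and>
     (\<forall>x y. nrm (x + y) \<le> max (nrm x) (nrm y)) \<and>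
     \<comment> \<open>the value group is discrete and non-trivial\<close>
     (\<exists>u. 0 < nrm u \<and> nrm u < 1 \<and> (\<forall>x. nrm x < 1 \<longrightarrow> nrm x \<le> nrm u)) \<and>
     \<comment> \<open>completeness\<close>
     (\<forall>s :: nat \<Rightarrow> 'f. (\<forall>e>0. \<exists>N. \<forall>i\<ge>N. \<forall>j\<ge>N. nrm (s i - s j) < e) \<longrightarrow>
        (\<exists>l. \<forall>e>0. \<exists>N. \<forall>i\<ge>N. nrm (s i - l) < e)) \<and>
     \<comment> \<open>the residue field is finite\<close>
     finite ((\<lambda>x. {y. nrm (y - x) < 1}) ` {x. nrm x \<le> 1})"

definition ring_of_integers :: "('f::field \<Rightarrow> real) \<Rightarrow> 'f set" where
  "ring_of_integers nrm = {x. nrm x \<le> 1}"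

definition residue_characteristic :: "('f::field \<Rightarrow> real) \<Rightarrow> nat \<Rightarrow> bool" where
  "residue_characteristic nrm p \<longleftrightarrow> prime p \<and> nrm (of_nat p) < 1"

definition central_embedding :: "('f::field \<Rightarrow> 'k::ring_1) \<Rightarrow> bool" where
  "central_embedding \<iota> \<longleftrightarrow> \<iota> 1 = 1 \<and> (\<forall>a b. \<iota> (a + b) = \<iota> a + \<iota> b) \<and> (\<forall>a b. \<iota> (a * b) = \<iota> a * \<iota> b) \<and>
     (\<forall>a x. \<iota> a * x = x * \<iota> a)"

definition division_ring_type :: "'k::ring_1 itself \<Rightarrow> bool" where
  "division_ring_type _ \<longleftrightarrow> (\<forall>x::'k. x \<noteq> 0 \<longrightarrow> (\<exists>y. x * y = 1 \<and> y * x = 1))"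

definition K_base_field :: "('f::field \<Rightarrow> 'k::ring_1) \<Rightarrow> ('k \<Rightarrow> 'k) \<Rightarrow> bool" where
  "K_base_field \<iota> \<sigma> \<longleftrightarrow> CHAR('f) \<noteq> 2 \<and> bij \<iota> \<and> \<sigma> = id"

definition K_quadratic_extension :: "('f::field \<Rightarrow> 'k::ring_1) \<Rightarrow> ('k \<Rightarrow> 'k) \<Rightarrow> bool" where
  "K_quadratic_extension \<iota> \<sigma> \<longleftrightarrow>
     (\<forall>x y :: 'k. x * y = y * x) \<and> division_ring_type TYPE('k) \<and>
     vector_space.dim (\<lambda>a x. \<iota> a * x) (UNIV :: 'k set) = 2 \<and>
     \<comment> \<open>every element is a root of a separable polynomial over \<open>F\<close>\<close>
     (\<forall>x. \<exists>f :: 'f poly. f \<noteq> 0 \<and> coprime f (pderiv f) \<and> (\<Sum>i\<le>degree f. \<iota> (coeff f i) * x ^ i) = 0) \<and>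
     \<comment> \<open>\<open>\<sigma>\<close> is the non-trivial automorphism over \<open>F\<close>\<close>
     bij \<sigma> \<and> (\<forall>x y. \<sigma> (x + y) = \<sigma> x + \<sigma> y) \<and> (\<forall>x y. \<sigma> (x * y) = \<sigma> x * \<sigma> y) \<and>
     (\<forall>a. \<sigma> (\<iota> a) = \<iota> a) \<and> \<sigma> \<noteq> id"

definition K_split :: "('f::field \<Rightarrow> 'k::ring_1) \<Rightarrow> ('k \<Rightarrow> 'k) \<Rightarrow> bool" where
  "K_split \<iota> \<sigma> \<longleftrightarrow> (\<exists>\<theta> :: 'k \<Rightarrow> 'f \<times> 'f. bij \<theta> \<and>
     (\<forall>x y. \<theta> (x + y) = (fst (\<theta> x) + fst (\<theta> y), snd (\<theta> x) + snd (\<theta> y))) \<and>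
     (\<forall>x y. \<theta> (x * y) = (fst (\<theta> x) * fst (\<theta> y), snd (\<theta> x) * snd (\<theta> y))) \<and>
     (\<forall>a. \<theta> (\<iota> a) = (a, a)) \<and>
     (\<forall>x. \<theta> (\<sigma> x) = (snd (\<theta> x), fst (\<theta> x))))"

text \<open>
  A quaternion division algebra is a division algebra of dimension 4 with centre \<open>F\<close>. Its standard
  involution is the \<open>F\<close>-linear anti-automorphism of order two with \<open>x + \<sigma> x\<close> (reduced trace) and
  \<open>x * \<sigma> x\<close> (reduced norm) in \<open>F\<close>.
\<close>

definition K_quaternion :: "('f::field \<Rightarrow> 'k::ring_1) \<Rightarrow> ('k \<Rightarrow> 'k) \<Rightarrow> bool" where
  "K_quaternion \<iota> \<sigma> \<longleftrightarrow>
     division_ring_type TYPE('k) \<and> {z :: 'k. \<forall>x. z * x = x * z} = range \<iota> \<and>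
     vector_space.dim (\<lambda>a x. \<iota> a * x) (UNIV :: 'k set) = 4 \<and>
     (\<forall>x y. \<sigma> (x + y) = \<sigma> x + \<sigma> y) \<and> (\<forall>x y. \<sigma> (x * y) = \<sigma> y * \<sigma> x) \<and>
     (\<forall>a. \<sigma> (\<iota> a) = \<iota> a) \<and> (\<forall>x. \<sigma> (\<sigma> x) = x) \<and>
     (\<forall>x. x + \<sigma> x \<in> range \<iota>) \<and> (\<forall>x. x * \<sigma> x \<in> range \<iota>)"

definition is_order :: "'f::field set \<Rightarrow> ('f \<Rightarrow> 'k::ring_1) \<Rightarrow> 'k set \<Rightarrow> bool" where
  "is_order A \<iota> B \<longleftrightarrow>
     1 \<in> B \<and> (\<forall>x\<in>B. \<forall>y\<in>B. x - y \<in> B) \<and> (\<forall>x\<in>B. \<forall>y\<in>B. x * y \<in> B) \<and>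
     (\<exists>S. finite S \<and> B = {\<Sum>s\<in>S. \<iota> (c s) * s | c. \<forall>s\<in>S. c s \<in> A}) \<and>
     module.span (\<lambda>a x. \<iota> a * x) B = UNIV"

definition is_maximal_order :: "'f::field set \<Rightarrow> ('f \<Rightarrow> 'k::ring_1) \<Rightarrow> 'k set \<Rightarrow> bool" where
  "is_maximal_order A \<iota> B \<longleftrightarrow> is_order A \<iota> B \<and> (\<forall>B'. is_order A \<iota> B' \<and> B \<subseteq> B' \<longrightarrow> B' = B)"

section \<open>Lattices and hermitian forms\<close>

definition additive_map :: "('x::ab_group_add \<Rightarrow> 'y::ab_group_add) \<Rightarrow> bool" where
  "additive_map f \<longleftrightarrow> (\<forall>x y. f (x + y) = f x + f y)"

definition biadditive_map :: "('x::ab_group_add \<Rightarrow> 'y::ab_group_add \<Rightarrow> 'z::ab_group_add) \<Rightarrow> bool" where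
  "biadditive_map f \<longleftrightarrow> (\<forall>x. additive_map (f x)) \<and> (\<forall>y. additive_map (\<lambda>x. f x y))"

definition right_module :: "('v::ab_group_add \<Rightarrow> 'k::ring_1 \<Rightarrow> 'v) \<Rightarrow> bool" where
  "right_module act \<longleftrightarrow> biadditive_map act \<and> (\<forall>v. act v 1 = v) \<and>
     (\<forall>v x y. act v (x * y) = act (act v x) y)"

text \<open>
  \<open>L\<close> is a free right \<open>B\<close>-module of rank \<open>n\<close> and \<open>V = L \<otimes>\<^sub>A F\<close>: the elements \<open>e 0, \<dots>, e (n - 1)\<close> form
  a \<open>K\<close>-basis of \<open>V\<close> and a \<open>B\<close>-basis of \<open>L\<close>.
\<close>

definition free_lattice ::
  "('v::ab_group_add \<Rightarrow> 'k::ring_1 \<Rightarrow> 'v) \<Rightarrow> 'k set \<Rightarrow> nat \<Rightarrow> 'v set \<Rightarrow> bool" where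
  "free_lattice act B n L \<longleftrightarrow> (\<exists>e :: nat \<Rightarrow> 'v.
     (\<forall>v. \<exists>!c :: nat \<Rightarrow> 'k. (\<forall>i\<ge>n. c i = 0) \<and> v = (\<Sum>i<n. act (e i) (c i))) \<and>
     L = {\<Sum>i<n. act (e i) (c i) | c. \<forall>i<n. c i \<in> B})"

definition hermitian_form ::
  "('v::ab_group_add \<Rightarrow> 'k::ring_1 \<Rightarrow> 'v) \<Rightarrow> ('k \<Rightarrow> 'k) \<Rightarrow> int \<Rightarrow> ('v \<Rightarrow> 'v \<Rightarrow> 'k) \<Rightarrow> bool" where
  "hermitian_form act \<sigma> \<epsilon> h \<longleftrightarrow> biadditive_map h \<and>
     (\<forall>v w x y. h (act v x) (act w y) = \<sigma> x * h v w * y) \<and>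
     (\<forall>v w. h w v = of_int \<epsilon> * \<sigma> (h v w))"

definition nondegenerate :: "('v::ab_group_add \<Rightarrow> 'v \<Rightarrow> 'k::ring_1) \<Rightarrow> bool" where
  "nondegenerate h \<longleftrightarrow> (\<forall>v. (\<forall>w. h v w = 0) \<longrightarrow> v = 0)"

definition polar :: "('v::ab_group_add \<Rightarrow> 'k::ring_1) \<Rightarrow> 'v \<Rightarrow> 'v \<Rightarrow> 'k" where
  "polar q v w = q (v + w) - q v - q w"

definition quadratic_form_on ::
  "('v::ab_group_add \<Rightarrow> 'k::ring_1 \<Rightarrow> 'v) \<Rightarrow> 'k set \<Rightarrow> 'v set \<Rightarrow> ('v \<Rightarrow> 'k) \<Rightarrow> bool" where
  "quadratic_form_on act B L q \<longleftrightarrow>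
     (\<forall>v\<in>L. q v \<in> B) \<and> (\<forall>v\<in>L. \<forall>b\<in>B. q (act v b) = b * b * q v) \<and>
     (\<forall>u\<in>L. \<forall>v\<in>L. \<forall>w\<in>L. polar q (u + v) w = polar q u w + polar q v w) \<and>
     (\<forall>v\<in>L. \<forall>w\<in>L. \<forall>b\<in>B. polar q (act v b) w = b * polar q v w)"

text \<open>
  The form \<open>h\<close> lives on \<open>V\<close>. In the case \<open>(K, \<epsilon>, p) = (F, 1, 2)\<close> it is the bilinear form
  \<open>h(v,w) = (q(v+w) - q(v) - q(w))/2\<close> of a quadratic form \<open>q\<close> on \<open>L\<close> with values in \<open>A\<close> (so that
  \<open>h\<close> itself may take values in \<open>A/2\<close> on \<open>L\<close>); otherwise \<open>h\<close> has values in \<open>B\<close> on \<open>L\<close>.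
\<close>

definition integral_on_lattice ::
  "('v::ab_group_add \<Rightarrow> 'k::ring_1 \<Rightarrow> 'v) \<Rightarrow> 'k set \<Rightarrow> 'v set \<Rightarrow> bool \<Rightarrow> ('v \<Rightarrow> 'v \<Rightarrow> 'k) \<Rightarrow> bool" where
  "integral_on_lattice act B L quadratic h \<longleftrightarrow>
     (if quadratic
      then \<exists>q. quadratic_form_on act B L q \<and> (\<forall>v\<in>L. \<forall>w\<in>L. 2 * h v w = polar q v w)
      else \<forall>v\<in>L. \<forall>w\<in>L. h v w \<in> B)"

definition dual_lattice :: "('v \<Rightarrow> 'v \<Rightarrow> 'k) \<Rightarrow> 'k set \<Rightarrow> 'v set \<Rightarrow> 'v set" where
  "dual_lattice h B L = {x. \<forall>y\<in>L. h x y \<in> B}"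

section \<open>Tensor products over A\<close>

definition submodule_of :: "'s set \<Rightarrow> ('s \<Rightarrow> 'm::ab_group_add \<Rightarrow> 'm) \<Rightarrow> 'm set \<Rightarrow> 'm set \<Rightarrow> bool" where
  "submodule_of S sc M N \<longleftrightarrow> N \<subseteq> M \<and> 0 \<in> N \<and> (\<forall>x\<in>N. \<forall>y\<in>N. x - y \<in> N) \<and> (\<forall>s\<in>S. \<forall>x\<in>N. sc s x \<in> N)"

text \<open>
  The relations defining \<open>M \<otimes>\<^sub>A R\<close> as a quotient of the free abelian group on \<open>M \<times> R\<close>.
\<close>

definition tensor_relations ::
  "'f set \<Rightarrow> ('f \<Rightarrow> 'm::ab_group_add \<Rightarrow> 'm) \<Rightarrow> ('f \<Rightarrow> 'r::{comm_ring,comm_monoid_mult}) \<Rightarrow> 'm set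
     \<Rightarrow> (('m \<times> 'r) \<Rightarrow>\<^sub>0 int) set" where
  "tensor_relations A sc \<alpha> M = group_closure
     ({frag_of (x + y, r) - frag_of (x, r) - frag_of (y, r) | x y r. x \<in> M \<and> y \<in> M} \<union>
      {frag_of (x, r + s) - frag_of (x, r) - frag_of (x, s) | x r s. x \<in> M} \<union>
      {frag_of (sc a x, r) - frag_of (x, \<alpha> a * r) | a x r. a \<in> A \<and> x \<in> M})"

definition tensor_sum :: "('m \<Rightarrow> 'r \<Rightarrow> 't::ab_group_add) \<Rightarrow> ('m \<times> 'r) list \<Rightarrow> 't" where
  "tensor_sum \<tau> xs = (\<Sum>(m, r)\<leftarrow>xs. \<tau> m r)"

text \<open>The map \<open>M \<otimes>\<^sub>A R \<rightarrow> T\<close> given by \<open>m \<otimes> r \<mapsto> \<tau> m r\<close> is injective.\<close>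

definition tensor_injective ::
  "'f set \<Rightarrow> ('f \<Rightarrow> 'm::ab_group_add \<Rightarrow> 'm) \<Rightarrow> ('f \<Rightarrow> 'r::{comm_ring,comm_monoid_mult}) \<Rightarrow> 'm set
     \<Rightarrow> ('m \<Rightarrow> 'r \<Rightarrow> 't::ab_group_add) \<Rightarrow> bool" where
  "tensor_injective A sc \<alpha> M \<tau> \<longleftrightarrow>
     (\<forall>xs. fst ` set xs \<subseteq> M \<and> tensor_sum \<tau> xs = 0 \<longrightarrow>
        (\<Sum>z\<leftarrow>xs. frag_of z) \<in> tensor_relations A sc \<alpha> M)"

text \<open>The image of this map; for \<open>M = L\<close> inside \<open>V \<otimes>\<^sub>A R\<close> and \<open>R\<close> flat this is \<open>L \<otimes>\<^sub>A R\<close>.\<close>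

definition tensor_image :: "('m \<Rightarrow> 'r \<Rightarrow> 't::ab_group_add) \<Rightarrow> 'm set \<Rightarrow> 't set" where
  "tensor_image \<tau> M = {tensor_sum \<tau> xs | xs. fst ` set xs \<subseteq> M}"

text \<open>\<open>(N, \<tau>)\<close> is a tensor product \<open>M \<otimes>\<^sub>A R\<close>, i.e. \<open>\<tau>\<close> induces an isomorphism from it onto \<open>N\<close>.\<close>

definition tensor_product ::
  "'f set \<Rightarrow> ('f \<Rightarrow> 'm::ab_group_add \<Rightarrow> 'm) \<Rightarrow> ('f \<Rightarrow> 'r::{comm_ring,comm_monoid_mult}) \<Rightarrow> 'm set
     \<Rightarrow> ('m \<Rightarrow> 'r \<Rightarrow> 't::ab_group_add) \<Rightarrow> 't set \<Rightarrow> bool" where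
  "tensor_product A sc \<alpha> M \<tau> N \<longleftrightarrow>
     submodule_of A sc UNIV M \<and>
     (\<forall>x\<in>M. \<forall>y\<in>M. \<forall>r. \<tau> (x + y) r = \<tau> x r + \<tau> y r) \<and>
     (\<forall>x\<in>M. \<forall>r s. \<tau> x (r + s) = \<tau> x r + \<tau> x s) \<and>
     (\<forall>a\<in>A. \<forall>x\<in>M. \<forall>r. \<tau> (sc a x) r = \<tau> x (\<alpha> a * r)) \<and>
     tensor_image \<tau> M = N \<and> tensor_injective A sc \<alpha> M \<tau>"

section \<open>Etale algebras\<close>

definition algebra_map :: "'f::field set \<Rightarrow> ('f \<Rightarrow> 'r::{comm_ring,comm_monoid_mult}) \<Rightarrow> bool" where
  "algebra_map A \<alpha> \<longleftrightarrow> \<alpha> 1 = 1 \<and>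
     (\<forall>a\<in>A. \<forall>b\<in>A. \<alpha> (a + b) = \<alpha> a + \<alpha> b \<and> \<alpha> (a * b) = \<alpha> a * \<alpha> b)"

text \<open>Flatness: \<open>I \<otimes>\<^sub>A R \<rightarrow> R\<close> is injective for every ideal \<open>I\<close> of \<open>A\<close>.\<close>

definition flat_algebra :: "'f::field set \<Rightarrow> ('f \<Rightarrow> 'r::{comm_ring,comm_monoid_mult}) \<Rightarrow> bool" where
  "flat_algebra A \<alpha> \<longleftrightarrow>
     (\<forall>I. submodule_of A (*) A I \<longrightarrow> tensor_injective A (*) \<alpha> I (\<lambda>a r. \<alpha> a * r))"

text \<open>Polynomials over \<open>A\<close> in the variables \<open>X\<^sub>0, \<dots>, X\<^sub>n\<^sub>-\<^sub>1\<close> and their evaluation in \<open>R\<close>.\<close>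

definition mpolys :: "'f::field set \<Rightarrow> nat \<Rightarrow> ((nat \<Rightarrow>\<^sub>0 nat) \<Rightarrow>\<^sub>0 'f) set" where
  "mpolys A n = {P. (\<forall>m. Poly_Mapping.lookup P m \<in> A) \<and>
     (\<forall>m\<in>Poly_Mapping.keys P. Poly_Mapping.keys m \<subseteq> {..<n})}"

definition mpoly_eval ::
  "('f::field \<Rightarrow> 'r::{comm_ring,comm_monoid_mult}) \<Rightarrow> (nat \<Rightarrow> 'r) \<Rightarrow> ((nat \<Rightarrow>\<^sub>0 nat) \<Rightarrow>\<^sub>0 'f) \<Rightarrow> 'r" where
  "mpoly_eval \<alpha> x P = (\<Sum>m\<in>Poly_Mapping.keys P.
     \<alpha> (Poly_Mapping.lookup P m) * (\<Prod>i\<in>Poly_Mapping.keys m. x i ^ Poly_Mapping.lookup m i))"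

definition finitely_presented ::
  "'f::field set \<Rightarrow> ('f \<Rightarrow> 'r::{comm_ring,comm_monoid_mult}) \<Rightarrow> bool" where
  "finitely_presented A \<alpha> \<longleftrightarrow> (\<exists>n x.
     (\<forall>r. \<exists>P\<in>mpolys A n. mpoly_eval \<alpha> x P = r) \<and>
     (\<exists>G. finite G \<and> G \<subseteq> {P \<in> mpolys A n. mpoly_eval \<alpha> x P = 0} \<and>
        (\<forall>P\<in>mpolys A n. mpoly_eval \<alpha> x P = 0 \<longrightarrow>
           (\<exists>c. (\<forall>g\<in>G. c g \<in> mpolys A n) \<and> P = (\<Sum>g\<in>G. c g * g)))))"

text \<open>
  The module of differentials \<open>\<Omega>\<^bsub>R/A\<^esub>\<close> is the free \<open>R\<close>-module on symbols \<open>d x\<close>, \<open>x \<in> R\<close>, modulo these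
  relations; \<open>Poly_Mapping.single x c\<close> stands for \<open>c \<cdot> d x\<close>. The generators are closed under
  multiplication by \<open>R\<close>, so the subgroup they generate is a submodule.
\<close>

definition kaehler_relations ::
  "'f::field set \<Rightarrow> ('f \<Rightarrow> 'r::{comm_ring,comm_monoid_mult}) \<Rightarrow> ('r \<Rightarrow>\<^sub>0 'r) set" where
  "kaehler_relations A \<alpha> = group_closure
     ({Poly_Mapping.single (\<alpha> a) c | a c. a \<in> A} \<union>
      {Poly_Mapping.single (x + y) c - Poly_Mapping.single x c - Poly_Mapping.single y c | x y c. True} \<union>
      {Poly_Mapping.single (x * y) c - Poly_Mapping.single y (c * x) - Poly_Mapping.single x (c * y)
         | x y c. True})"

text \<open>Unramified: \<open>\<Omega>\<^bsub>R/A\<^esub> = 0\<close>.\<close>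

definition unramified_algebra ::
  "'f::field set \<Rightarrow> ('f \<Rightarrow> 'r::{comm_ring,comm_monoid_mult}) \<Rightarrow> bool" where
  "unramified_algebra A \<alpha> \<longleftrightarrow> (\<forall>x. Poly_Mapping.single x 1 \<in> kaehler_relations A \<alpha>)"

definition etale_algebra ::
  "'f::field set \<Rightarrow> ('f \<Rightarrow> 'r::{comm_ring,comm_monoid_mult}) \<Rightarrow> bool" where
  "etale_algebra A \<alpha> \<longleftrightarrow> algebra_map A \<alpha> \<and> finitely_presented A \<alpha> \<and> flat_algebra A \<alpha> \<and>
     unramified_algebra A \<alpha>"

section \<open>Base change of K, V and h\<close>

text \<open>
  \<open>K \<otimes>\<^sub>A R\<close> and \<open>V \<otimes>\<^sub>A R\<close> are types \<open>'kr\<close> and \<open>'vr\<close> together with maps \<open>\<tau>K\<close>, \<open>\<tau>V\<close> sending \<open>(x, r)\<close> to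
  the pure tensor \<open>x \<otimes> r\<close>. The ring structure, the right action and the form are determined by
  their values on pure tensors.
\<close>

definition tensor_ring ::
  "'f::field set \<Rightarrow> ('f \<Rightarrow> 'k::ring_1) \<Rightarrow> ('f \<Rightarrow> 'r::{comm_ring,comm_monoid_mult})
     \<Rightarrow> ('k \<Rightarrow> 'r \<Rightarrow> 'kr::{ring,monoid_mult}) \<Rightarrow> bool" where
  "tensor_ring A \<iota> \<alpha> \<tau>K \<longleftrightarrow> tensor_product A (\<lambda>a x. \<iota> a * x) \<alpha> UNIV \<tau>K UNIV \<and>
     \<tau>K 1 1 = 1 \<and> (\<forall>x y r s. \<tau>K x r * \<tau>K y s = \<tau>K (x * y) (r * s))"

definition tensor_space ::
  "'f::field set \<Rightarrow> ('f \<Rightarrow> 'k::ring_1) \<Rightarrow> ('f \<Rightarrow> 'r::{comm_ring,comm_monoid_mult})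
     \<Rightarrow> ('k \<Rightarrow> 'r \<Rightarrow> 'kr::{ring,monoid_mult}) \<Rightarrow> ('v::ab_group_add \<Rightarrow> 'k \<Rightarrow> 'v)
     \<Rightarrow> ('v \<Rightarrow> 'r \<Rightarrow> 'vr::ab_group_add) \<Rightarrow> ('vr \<Rightarrow> 'kr \<Rightarrow> 'vr) \<Rightarrow> bool" where
  "tensor_space A \<iota> \<alpha> \<tau>K act \<tau>V actR \<longleftrightarrow>
     tensor_product A (\<lambda>a v. act v (\<iota> a)) \<alpha> UNIV \<tau>V UNIV \<and> biadditive_map actR \<and>
     (\<forall>v r x s. actR (\<tau>V v r) (\<tau>K x s) = \<tau>V (act v x) (r * s))"

definition tensor_form ::
  "('k::ring_1 \<Rightarrow> 'r::{comm_ring,comm_monoid_mult} \<Rightarrow> 'kr::{ring,monoid_mult})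
     \<Rightarrow> ('v::ab_group_add \<Rightarrow> 'r \<Rightarrow> 'vr::ab_group_add) \<Rightarrow> ('v \<Rightarrow> 'v \<Rightarrow> 'k) \<Rightarrow> ('vr \<Rightarrow> 'vr \<Rightarrow> 'kr) \<Rightarrow> bool" where
  "tensor_form \<tau>K \<tau>V h hR \<longleftrightarrow> biadditive_map hR \<and>
     (\<forall>v w r s. hR (\<tau>V v r) (\<tau>V w s) = \<tau>K (h v w) (r * s))"

definition base_change_map ::
  "('v::ab_group_add \<Rightarrow> 'r \<Rightarrow> 'vr::ab_group_add) \<Rightarrow> ('v \<Rightarrow> 'v) \<Rightarrow> 'vr \<Rightarrow> 'vr" where
  "base_change_map \<tau>V X = (THE Y. additive_map Y \<and> (\<forall>v r. Y (\<tau>V v r) = \<tau>V (X v) r))"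

section \<open>Endomorphisms and the maps between them and forms\<close>

text \<open>
  Endomorphisms of \<open>L \<otimes> R\<close> and forms on \<open>L \<otimes> R\<close> are represented by their unique extensions to
  \<open>V \<otimes> R\<close> (which is \<open>L \<otimes> R\<close> with a uniformizer inverted, \<open>R\<close> being flat); quadratic forms are
  represented by their associated bilinear forms. The definitions below are used for
  \<open>(V, K, h, L, L\<^sup>#)\<close> and for the base change of these data to \<open>R\<close>.
\<close>

definition linear_end :: "('v::ab_group_add \<Rightarrow> 'k \<Rightarrow> 'v) \<Rightarrow> ('v \<Rightarrow> 'v) \<Rightarrow> bool" where
  "linear_end act X \<longleftrightarrow> additive_map X \<and> (\<forall>v x. X (act v x) = act (X v) x)"

definition T0 :: "('v::ab_group_add \<Rightarrow> 'k \<Rightarrow> 'v) \<Rightarrow> 'v set \<Rightarrow> 'v set \<Rightarrow> ('v \<Rightarrow> 'v) set" where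
  "T0 act L Ls = {X. linear_end act X \<and> X ` L \<subseteq> L \<and> X ` Ls \<subseteq> Ls}"

definition phi0 :: "('v \<Rightarrow> 'v \<Rightarrow> 'k) \<Rightarrow> ('v \<Rightarrow> 'v) \<Rightarrow> 'v \<Rightarrow> 'v \<Rightarrow> 'k" where
  "phi0 h X = (\<lambda>v w. h (X v) (X w))"

definition psi0 :: "('v \<Rightarrow> 'v \<Rightarrow> 'k::plus) \<Rightarrow> ('v \<Rightarrow> 'v) \<Rightarrow> 'v \<Rightarrow> 'v \<Rightarrow> 'k" where
  "psi0 h X = (\<lambda>v w. h v (X w) + h (X v) w)"

definition adjoint_end ::
  "('v::ab_group_add \<Rightarrow> 'k \<Rightarrow> 'v) \<Rightarrow> ('v \<Rightarrow> 'v \<Rightarrow> 'k) \<Rightarrow> ('v \<Rightarrow> 'v) \<Rightarrow> 'v \<Rightarrow> 'v" where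
  "adjoint_end act h X = (THE Y. linear_end act Y \<and> (\<forall>v w. h (X v) w = h v (Y w)))"

definition T1 ::
  "('v::ab_group_add \<Rightarrow> 'k::plus \<Rightarrow> 'v) \<Rightarrow> ('v \<Rightarrow> 'v \<Rightarrow> 'k) \<Rightarrow> 'v set \<Rightarrow> 'v set \<Rightarrow> ('v \<Rightarrow> 'v) set" where
  "T1 act h L Ls = {X \<in> T0 act L Ls.
     phi0 h X \<in> psi0 h ` T0 act L Ls \<and> phi0 h (adjoint_end act h X) \<in> psi0 h ` T0 act L Ls}"

end

theory Submission
  imports Defs "HOL-Library.Product_Plus"
begin

text \<open>
  Let \<open>N\<close> be the set of all \<open>Y + Y\<^sup>a\<^sup>d\<close> with \<open>Y\<close> in \<open>T\<^sup>0\<close>. By nondegeneracy, membership of \<open>X\<close> in \<open>T\<^sup>1\<close> means that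
  \<open>X\<^sup>a\<^sup>dX\<close> and \<open>XX\<^sup>a\<^sup>d\<close> lie in \<open>N\<close>. Modulo \<open>N\<close> these maps are additive in \<open>X\<close>, so in coordinates \<open>X = \<Sum> x\<^sub>i T\<^sub>i\<close> the
  conditions read \<open>\<Sum> a\<^sub>i x\<^sub>i\<^sup>2 \<in> R\<close> or \<open>\<Sum> a\<^sub>i x\<^sub>i\<^sup>2 = 0\<close> with \<open>a\<^sub>i\<close> in \<open>F\<close>, where \<open>2 a\<^sub>i\<close> lies in \<open>A\<close>, respectively vanishes.
  Since the residue field is perfect and \<open>F\<close> is complete, such \<open>a\<^sub>i\<close> have the form \<open>u\<^sub>i\<^sup>2 + \<pi> v\<^sub>i\<^sup>2\<close> modulo \<open>A\<close>, respectively exactly.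
  Because \<open>R/\<pi>R\<close> is reduced and, in characteristic 2, so is \<open>R\<^sub>F[\<surd>\<pi>]\<close>, the quadratic conditions are
  equivalent to the linear ones that \<open>\<Sum> u\<^sub>i x\<^sub>i\<close> and \<open>\<Sum> v\<^sub>i x\<^sub>i\<close> lie in \<open>R\<close>, respectively vanish. Linear conditions
  with coefficients in \<open>F\<close> commute with base change to \<open>R\<close>. No case distinction on \<open>K\<close> is needed.

  Reducedness comes from a separability element of \<open>R \<otimes> R\<close>, obtained from the vanishing of the Kaehler
  differentials: averaging over it, as in Maschke's theorem, turns \<open>A\<close>-linear projections into
  \<open>R\<close>-linear ones, so that every \<open>z\<close> is a multiple of \<open>z\<^sup>2\<close> in the rings in question.
\<close>

section \<open>Linear functionals and lattices over a valuation ring\<close>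

text \<open>The obstacle is that the conditions defining \<open>T\<^sup>1(A)\<close> are quadratic
  in \<open>X\<close> and existential in \<open>Y\<close>. Over a larger ring they may acquire
  solutions that do not come from \<open>A\<close>, as \<open>x^2 = 0\<close> does over a ring that
  is not reduced. If 2 is a unit of \<open>A\<close> nothing can go wrong, because
  \<open>2 a_i\<close> in \<open>A\<close> makes \<open>a_i\<close> integral and
  \<open>2 a_i = 0\<close> makes it zero; the whole weight lies on residue characteristic 2, where
  cross terms in squares can be controlled. Two kinds of conditions occur because \<open>N\<close>
  is a lattice only in its own span: lying in the span is a vanishing condition, lying in the
  lattice an integrality condition.

  Etaleness enters twice. Flatness makes \<open>R\<close> torsion-free, so that it embeds in
  \<open>K \<otimes> R\<close>, an \<open>F\<close>-vector space whose functionals turn one equation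
  over \<open>R\<close> into a family of equations over \<open>F\<close>. Unramifiedness provides
  the separability element. The inclusion from \<open>R \<otimes> T\<^sup>1(A)\<close> into the
  right-hand side is direct, since scalars from \<open>R\<close> are central and self-adjoint; the
  square roots serve the other one.\<close>

definition functional :: "('f::field \<Rightarrow> 'm::ab_group_add \<Rightarrow> 'm) \<Rightarrow> ('m \<Rightarrow> 'f) \<Rightarrow> bool" where
  "functional sc f \<longleftrightarrow> (\<forall>x y. f (x + y) = f x + f y) \<and> (\<forall>a x. f (sc a x) = a * f x)"

lemma functional_add: "functional sc f \<Longrightarrow> f (x + y) = f x + f y"
  and functional_scale: "functional sc f \<Longrightarrow> f (sc a x) = a * f x"
  by (auto simp: functional_def)

lemma functional_zero: "functional sc f \<Longrightarrow> f 0 = 0"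
  using functional_add[of sc f 0 0] by (metis add_cancel_right_right)

lemma functional_minus: "functional sc f \<Longrightarrow> f (- x) = - f x"
  using functional_add[of sc f x "- x"] functional_zero[of sc f]
  by (simp add: eq_neg_iff_add_eq_0 add.commute)

lemma functional_diff: "functional sc f \<Longrightarrow> f (x - y) = f x - f y"
  using functional_add[of sc f x "- y"] functional_minus[of sc f y] by simp

lemma functional_sum: "functional sc f \<Longrightarrow> f (\<Sum>i\<in>I. x i) = (\<Sum>i\<in>I. f (x i))"
  by (induction I rule: infinite_finite_induct) (auto simp: functional_zero functional_add)

lemma functional_combination:
  "(\<And>i. i \<in> I \<Longrightarrow> functional sc (f i)) \<Longrightarrow> functional sc (\<lambda>x. \<Sum>i\<in>I. c i * f i x)"
  by (auto simp: functional_def sum.distrib sum_distrib_left algebra_simps)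

lemma (in vector_space) functional_representation:
  assumes "independent S"
  shows "functional scale (\<lambda>x. representation (extend_basis S) x b)"
  using independent_extend_basis[OF assms] span_extend_basis[OF assms]
  by (auto simp: functional_def representation_add representation_scale)

text \<open>Functionals separate points; applied to \<open>1\<close> in \<open>K\<close> and to
  nonzero elements of \<open>K \<otimes> R\<close>.\<close>

lemma (in vector_space) functional_with_value_one:
  assumes "x \<noteq> 0"
  obtains f where "functional scale f" "f x = 1"
proof -
  have i: "independent {x}" using assms by simp
  have "x \<in> extend_basis {x}" using extend_basis_superset[OF i] by simp
  then have "representation (extend_basis {x}) x x = 1"
    using independent_extend_basis[OF i] by (simp add: representation_basis)
  then show thesis using functional_representation[OF i] that by blast
qed

definition additively_closed :: "'m::ab_group_add set \<Rightarrow> bool" where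
  "additively_closed S \<longleftrightarrow> 0 \<in> S \<and> (\<forall>x\<in>S. \<forall>y\<in>S. x - y \<in> S)"

lemma additively_closedD:
  assumes "additively_closed S"
  shows "0 \<in> S" and "x \<in> S \<Longrightarrow> y \<in> S \<Longrightarrow> x - y \<in> S" and "x \<in> S \<Longrightarrow> - x \<in> S"
    and "x \<in> S \<Longrightarrow> y \<in> S \<Longrightarrow> x + y \<in> S"
proof -
  show z: "0 \<in> S" and d: "x \<in> S \<Longrightarrow> y \<in> S \<Longrightarrow> x - y \<in> S" for x y
    using assms by (auto simp: additively_closed_def)
  show n: "x \<in> S \<Longrightarrow> - x \<in> S" for x using d[OF z, of x] by simp
  show "x \<in> S \<Longrightarrow> y \<in> S \<Longrightarrow> x + y \<in> S" using d[of x "- y"] n by simp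
qed

lemma additively_closed_sum:
  "additively_closed S \<Longrightarrow> (\<And>i. i \<in> I \<Longrightarrow> f i \<in> S) \<Longrightarrow> sum f I \<in> S"
  by (induction I rule: infinite_finite_induct) (auto intro: additively_closedD)

section \<open>The non-archimedean norm and the valuation ring A\<close>

locale local_field =
  fixes nrm :: "'f::field \<Rightarrow> real" and A :: "'f set"
  assumes nonarch: "nonarch_local_field nrm"
    and A_eq: "A = ring_of_integers nrm"
begin

lemma A_def: "A = {x. nrm x \<le> 1}"
  by (simp add: A_eq ring_of_integers_def)

lemma nrm_ge_0: "0 \<le> nrm x" and nrm_eq_0: "nrm x = 0 \<longleftrightarrow> x = 0"
  and nrm_mult: "nrm (x * y) = nrm x * nrm y" and nrm_add: "nrm (x + y) \<le> max (nrm x) (nrm y)"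
  using nonarch by (auto simp: nonarch_local_field_def)

lemma nrm_0: "nrm 0 = 0" by (simp add: nrm_eq_0)

lemma nrm_1: "nrm 1 = 1"
  using nrm_mult[of 1 1] nrm_eq_0[of 1] by simp

lemma nrm_minus: "nrm (- x) = nrm x"
proof -
  have "nrm (-1) * nrm (-1) = 1" using nrm_mult[of "-1" "-1"] nrm_1 by simp
  then have "nrm (-1) = 1" using nrm_ge_0[of "-1"]
    by (metis abs_of_nonneg abs_square_eq_1 power2_eq_square)
  then show ?thesis using nrm_mult[of "-1" x] by simp
qed

lemma nrm_diff: "nrm (x - y) \<le> max (nrm x) (nrm y)"
  using nrm_add[of x "- y"] nrm_minus by simp

lemma nrm_power: "nrm (x ^ n) = nrm x ^ n"
  by (induction n) (auto simp: nrm_1 nrm_mult)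

lemma nrm_inverse: "nrm (inverse x) = inverse (nrm x)"
proof (cases "x = 0")
  case False
  then have "nrm x * nrm (inverse x) = 1" using nrm_mult[of x "inverse x"] nrm_1 by simp
  then show ?thesis by (metis inverse_unique)
qed (simp add: nrm_0)

lemma nrm_divide: "nrm (x / y) = nrm x / nrm y"
  by (simp add: divide_inverse nrm_mult nrm_inverse)

lemma A_0 [simp]: "0 \<in> A" and A_1 [simp]: "1 \<in> A"
  by (auto simp: A_def nrm_0 nrm_1)

lemma A_mult: "x \<in> A \<Longrightarrow> y \<in> A \<Longrightarrow> x * y \<in> A"
  by (auto simp: A_def nrm_mult mult_le_one nrm_ge_0)

lemma A_add: "x \<in> A \<Longrightarrow> y \<in> A \<Longrightarrow> x + y \<in> A"
  using nrm_add[of x y] by (auto simp: A_def)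

lemma A_diff: "x \<in> A \<Longrightarrow> y \<in> A \<Longrightarrow> x - y \<in> A"
  using nrm_diff[of x y] by (auto simp: A_def)

lemma A_minus: "x \<in> A \<Longrightarrow> - x \<in> A"
  by (auto simp: A_def nrm_minus)

lemma A_closed: "additively_closed A"
  by (auto simp: additively_closed_def A_diff)

lemma A_sum: "(\<And>i. i \<in> I \<Longrightarrow> f i \<in> A) \<Longrightarrow> sum f I \<in> A"
  by (rule additively_closed_sum[OF A_closed])

lemma A_power: "x \<in> A \<Longrightarrow> x ^ n \<in> A"
  by (induction n) (auto intro: A_mult)

lemma A_2: "2 \<in> A"
  using A_add[OF A_1 A_1] by simp

lemma A_divide: "nrm x \<le> nrm y \<Longrightarrow> x / y \<in> A"
  using nrm_ge_0[of y] by (cases "y = 0") (auto simp: A_def nrm_divide nrm_0 divide_le_eq_1 nrm_eq_0 less_le)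

text \<open>Induction on \<open>J\<close>. A nonzero \<open>z\<close> in \<open>E\<close>, divided
  by its value \<open>\<phi> t0 z\<close> of largest norm, is a lattice vector \<open>x0\<close>
  with \<open>\<phi> t0 x0 = 1\<close>; it splits off and leaves the kernel of
  \<open>\<phi> t0\<close> with one functional fewer. The point of the statement is the matrix
  \<open>g\<close>: since the coefficients are \<open>A\<close>-combinations of the
  \<open>\<phi> t\<close>, the same expansion makes sense over \<open>R\<close> as soon as the
  \<open>\<phi> t\<close> extend to \<open>R\<close>.\<close>

lemma lattice_generators:
  fixes sc :: "'f \<Rightarrow> 'm::ab_group_add \<Rightarrow> 'm" and \<phi> :: "'t \<Rightarrow> 'm \<Rightarrow> 'f"
  assumes vs: "vector_space sc" and "finite J" and fct: "\<And>t. t \<in> J \<Longrightarrow> functional sc (\<phi> t)"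
    and "module.subspace sc E" and "\<And>x. x \<in> E \<Longrightarrow> (\<And>t. t \<in> J \<Longrightarrow> \<phi> t x = 0) \<Longrightarrow> x = 0"
  shows "\<exists>(d::nat) w g. (\<forall>k<d. w k \<in> E \<and> (\<forall>t\<in>J. \<phi> t (w k) \<in> A)) \<and> (\<forall>k<d. \<forall>t\<in>J. g k t \<in> A) \<and>
    (\<forall>x\<in>E. x = (\<Sum>k<d. sc (\<Sum>t\<in>J. g k t * \<phi> t x) (w k)))"
  using assms(2-5)
proof (induction J arbitrary: E rule: finite_psubset_induct)
  case (psubset J)
  interpret vector_space sc by (rule vs)
  show ?case
  proof (cases "E = {0}")
    case True
    have "\<forall>x\<in>E. x = (\<Sum>k<(0::nat). sc (\<Sum>t\<in>J. 0 * \<phi> t x) 0)" using True by simp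
    then show ?thesis by (intro exI[of _ 0]) auto
  next
    case False
    then obtain z where z: "z \<in> E" "z \<noteq> 0" using subspace_0[OF psubset.prems(2)] by blast
    then obtain t1 where t1: "t1 \<in> J" "\<phi> t1 z \<noteq> 0" using psubset.prems(3) by blast
    define t0 where "t0 = arg_max_on (\<lambda>t. nrm (\<phi> t z)) J"
    have t0: "t0 \<in> J" and mx: "\<And>t. t \<in> J \<Longrightarrow> nrm (\<phi> t z) \<le> nrm (\<phi> t0 z)"
    proof -
      have "Max ((\<lambda>t. nrm (\<phi> t z)) ` J) \<in> (\<lambda>t. nrm (\<phi> t z)) ` J"
        using t1(1) psubset.hyps by (intro Max_in) auto
      then obtain t where "t \<in> J" "Max ((\<lambda>t. nrm (\<phi> t z)) ` J) = nrm (\<phi> t z)" by blast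
      then have "is_arg_max (\<lambda>t. nrm (\<phi> t z)) (\<lambda>t. t \<in> J) t"
        unfolding is_arg_max_linorder using psubset.hyps by (metis Max_ge finite_imageI imageI)
      then have "is_arg_max (\<lambda>t. nrm (\<phi> t z)) (\<lambda>t. t \<in> J) t0"
        unfolding t0_def arg_max_on_def arg_max_def by (rule someI)
      then show "t0 \<in> J" "\<And>t. t \<in> J \<Longrightarrow> nrm (\<phi> t z) \<le> nrm (\<phi> t0 z)"
        by (auto simp: is_arg_max_linorder)
    qed
    have nz: "\<phi> t0 z \<noteq> 0" using mx[OF t1(1)] t1(2) nrm_ge_0[of "\<phi> t1 z"] nrm_eq_0
      by (metis order_antisym)
    define x0 where "x0 = sc (inverse (\<phi> t0 z)) z"
    have x0: "x0 \<in> E" unfolding x0_def by (rule subspace_scale[OF psubset.prems(2) z(1)])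
    have phx0: "t \<in> J \<Longrightarrow> \<phi> t x0 = \<phi> t z / \<phi> t0 z" for t
      unfolding x0_def using functional_scale[OF psubset.prems(1)] by (simp add: field_simps)
    have x0A: "t \<in> J \<Longrightarrow> \<phi> t x0 \<in> A" for t using phx0 A_divide mx by simp
    have x01: "\<phi> t0 x0 = 1" using phx0[OF t0] nz by simp
    define E' where "E' = {y \<in> E. \<phi> t0 y = 0}"
    have sE': "subspace E'" unfolding E'_def
      using psubset.prems(2) functional_add[OF psubset.prems(1)[OF t0]]
        functional_scale[OF psubset.prems(1)[OF t0]] functional_zero[OF psubset.prems(1)[OF t0]]
      by (auto simp: subspace_def)
    let ?J = "J - {t0}"
    have "?J \<subset> J" using t0 by blast
    have f': "t \<in> ?J \<Longrightarrow> functional sc (\<phi> t)" for t using psubset.prems(1) by blast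
    have i': "x = 0" if "x \<in> E'" "\<And>t. t \<in> ?J \<Longrightarrow> \<phi> t x = 0" for x
      using that psubset.prems(3)[of x] unfolding E'_def by blast
    have "\<exists>d w g. (\<forall>k<(d::nat). w k \<in> E' \<and> (\<forall>t\<in>?J. \<phi> t (w k) \<in> A)) \<and> (\<forall>k<d. \<forall>t\<in>?J. g k t \<in> A) \<and>
      (\<forall>x\<in>E'. x = (\<Sum>k<d. sc (\<Sum>t\<in>?J. g k t * \<phi> t x) (w k)))"
      by (rule psubset.IH[OF \<open>?J \<subset> J\<close> _ sE']) (fact f', rule i')
    then obtain d w g where
      w: "\<forall>k<(d::nat). w k \<in> E' \<and> (\<forall>t\<in>?J. \<phi> t (w k) \<in> A)" and
      g: "\<forall>k<d. \<forall>t\<in>?J. g k t \<in> A" and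
      e: "\<forall>x\<in>E'. x = (\<Sum>k<d. sc (\<Sum>t\<in>?J. g k t * \<phi> t x) (w k))"
      by (elim exE conjE) (rule that)
    \<comment> \<open>Substituting \<open>x\<close> minus its \<open>x0\<close>-part into the old
      expansion fills in column \<open>t0\<close> of the matrix, with minus the old coefficients of
      \<open>x0\<close>. The new row \<open>d\<close> picks out \<open>\<phi> t0 x\<close> as the
      coefficient of \<open>x0\<close>.\<close>
    define w' where "w' = w(d := x0)"
    define g' where "g' = (\<lambda>k t. if k = d then (if t = t0 then 1 else 0)
       else if t = t0 then - (\<Sum>t\<in>?J. g k t * \<phi> t x0) else g k t)"
    have "w' k \<in> E \<and> (\<forall>t\<in>J. \<phi> t (w' k) \<in> A)" if "k < Suc d" for k
    proof (cases "k = d")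
      case False
      then have k: "k < d" using that by simp
      have "\<phi> t (w k) \<in> A" if "t \<in> J" for t
        using w k that unfolding E'_def by (cases "t = t0") auto
      then show ?thesis using w k False unfolding w'_def E'_def by simp
    qed (simp add: w'_def x0 x0A)
    moreover have "g' k t \<in> A" if "k < Suc d" "t \<in> J" for k t
    proof (cases "k = d")
      case False
      then have k: "k < d" using that by simp
      have "(\<Sum>t\<in>?J. g k t * \<phi> t x0) \<in> A" by (rule A_sum) (simp add: A_mult g k x0A)
      then show ?thesis using g k that False unfolding g'_def by (simp add: A_minus)
    qed (simp add: g'_def)
    moreover have "x = (\<Sum>k<Suc d. sc (\<Sum>t\<in>J. g' k t * \<phi> t x) (w' k))" if x: "x \<in> E" for x
    proof -
      define y where "y = x - sc (\<phi> t0 x) x0"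
      have fy: "\<phi> t y = \<phi> t x - \<phi> t0 x * \<phi> t x0" if "t \<in> J" for t
        unfolding y_def using psubset.prems(1)[OF that] by (simp add: functional_diff functional_scale)
      have "y \<in> E'" unfolding E'_def using fy[OF t0] x01 x x0
        by (auto simp: y_def intro!: subspace_diff subspace_scale psubset.prems(2))
      then have "y = (\<Sum>k<d. sc (\<Sum>t\<in>?J. g k t * \<phi> t y) (w k))" using e by blast
      also have "\<dots> = (\<Sum>k<d. sc (\<Sum>t\<in>J. g' k t * \<phi> t x) (w' k))"
      proof (rule sum.cong[OF refl])
        fix k assume "k \<in> {..<d}"
        then have k: "k < d" by simp
        have "(\<Sum>t\<in>?J. g k t * \<phi> t y) = (\<Sum>t\<in>?J. g k t * \<phi> t x) - (\<Sum>t\<in>?J. g k t * \<phi> t x0) * \<phi> t0 x"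
          by (simp add: fy right_diff_distrib sum_subtractf sum_distrib_right mult.assoc mult.commute[of "\<phi> t0 x"])
        also have "\<dots> = (\<Sum>t\<in>J. g' k t * \<phi> t x)"
          using k by (simp add: sum.remove[OF psubset.hyps t0] g'_def)
        finally show "sc (\<Sum>t\<in>?J. g k t * \<phi> t y) (w k) = sc (\<Sum>t\<in>J. g' k t * \<phi> t x) (w' k)"
          using k by (simp add: w'_def)
      qed
      finally have "y = (\<Sum>k<d. sc (\<Sum>t\<in>J. g' k t * \<phi> t x) (w' k))" .
      moreover have "(\<Sum>t\<in>J. g' d t * \<phi> t x) = \<phi> t0 x"
        by (simp add: sum.remove[OF psubset.hyps t0] g'_def)
      ultimately show ?thesis unfolding y_def by (simp add: w'_def algebra_simps)
    qed
    ultimately show ?thesis by (intro exI[of _ "Suc d"] exI[of _ w'] exI[of _ g'] conjI allI impI ballI) simp_all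
  qed
qed

text \<open>A generating set which is minimal under inclusion is linearly independent: in a relation, divide
  by a coefficient of maximal norm.\<close>

lemma independent_generators:
  fixes sc :: "'f \<Rightarrow> 'm::ab_group_add \<Rightarrow> 'm"
  assumes vs: "vector_space sc" and fin: "finite S"
  shows "\<exists>G\<subseteq>S. \<not> module.dependent sc G \<and>
    {\<Sum>s\<in>G. sc (c s) s | c. \<forall>s\<in>G. c s \<in> A} = {\<Sum>s\<in>S. sc (c s) s | c. \<forall>s\<in>S. c s \<in> A}"
proof -
  interpret vector_space sc by (rule vs)
  define sp where "sp = (\<lambda>G. {\<Sum>s\<in>G. sc (c s) s | c. \<forall>s\<in>G. c s \<in> A})"
  obtain G where G: "G \<subseteq> S" "sp G = sp S"
    and min: "\<And>G'. G' \<subseteq> S \<Longrightarrow> sp G' = sp S \<Longrightarrow> card G \<le> card G'"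
  proof -
    obtain G where *: "G \<subseteq> S \<and> sp G = sp S" "\<And>G'. G' \<subseteq> S \<and> sp G' = sp S \<Longrightarrow> card G \<le> card G'"
      using exists_least_iff[of "\<lambda>n. \<exists>G. (G \<subseteq> S \<and> sp G = sp S) \<and> n = card G"]
      by (metis linorder_not_less subset_refl)
    show thesis by (rule that[of G]) (use * in auto)
  qed
  have finG: "finite G" using G(1) fin finite_subset by blast
  have "independent G"
  proof
    assume "dependent G"
    then obtain u where u: "(\<Sum>v\<in>G. sc (u v) v) = 0" "\<exists>v\<in>G. u v \<noteq> 0"
      using dependent_finite[OF finG] by blast
    have "Max ((\<lambda>v. nrm (u v)) ` G) \<in> (\<lambda>v. nrm (u v)) ` G" using u(2) finG by (intro Max_in) auto
    then obtain s where s: "s \<in> G" "nrm (u s) = Max ((\<lambda>v. nrm (u v)) ` G)" by auto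
    have mx: "v \<in> G \<Longrightarrow> nrm (u v) \<le> nrm (u s)" for v using s(2) finG by simp
    have nz: "u s \<noteq> 0" using mx u(2) nrm_ge_0 nrm_eq_0 by (metis order_antisym)
    have seq: "s = (\<Sum>v\<in>G - {s}. sc (- (u v / u s)) v)"
    proof -
      have "0 = sc (inverse (u s)) (\<Sum>v\<in>G. sc (u v) v)" by (simp add: u(1))
      also have "\<dots> = (\<Sum>v\<in>G. sc (u v / u s) v)" by (simp add: scale_sum_right field_simps)
      also have "\<dots> = s + (\<Sum>v\<in>G - {s}. sc (u v / u s) v)"
        using nz by (simp add: sum.remove[OF finG s(1)])
      finally show ?thesis by (simp add: sum_negf eq_neg_iff_add_eq_0)
    qed
    have "sp (G - {s}) = sp G"
    proof
      show "sp (G - {s}) \<subseteq> sp G"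
      proof
        fix x assume "x \<in> sp (G - {s})"
        then obtain c where c: "x = (\<Sum>v\<in>G - {s}. sc (c v) v)" "\<forall>v\<in>G - {s}. c v \<in> A"
          unfolding sp_def by blast
        have "x = (\<Sum>v\<in>G. sc ((c(s := 0)) v) v)"
          unfolding c(1) by (subst sum.remove[OF finG s(1)]) (auto intro!: sum.cong)
        then show "x \<in> sp G" unfolding sp_def using c(2) by (intro CollectI exI[of _ "c(s := 0)"]) auto
      qed
      show "sp G \<subseteq> sp (G - {s})"
      proof
        fix x assume "x \<in> sp G"
        then obtain c where c: "x = (\<Sum>v\<in>G. sc (c v) v)" "\<forall>v\<in>G. c v \<in> A"
          unfolding sp_def by blast
        have "x = sc (c s) s + (\<Sum>v\<in>G - {s}. sc (c v) v)"
          unfolding c(1) by (subst sum.remove[OF finG s(1)]) auto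
        also have "\<dots> = sc (c s) (\<Sum>v\<in>G - {s}. sc (- (u v / u s)) v) + (\<Sum>v\<in>G - {s}. sc (c v) v)"
          using seq by simp
        also have "\<dots> = (\<Sum>v\<in>G - {s}. sc (c v - c s * (u v / u s)) v)"
          by (simp add: scale_sum_right sum.distrib[symmetric] scale_left_diff_distrib algebra_simps)
        finally have x: "x = (\<Sum>v\<in>G - {s}. sc (c v - c s * (u v / u s)) v)" .
        have "\<forall>v\<in>G - {s}. c v - c s * (u v / u s) \<in> A"
          by (intro ballI A_diff A_mult A_divide) (use c(2) s(1) mx in auto)
        then show "x \<in> sp (G - {s})" unfolding sp_def using x by (intro CollectI exI[of _ "\<lambda>v. c v - c s * (u v / u s)"]) simp
      qed
    qed
    then have "card G \<le> card (G - {s})" using min[of "G - {s}"] G by auto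
    moreover have "card (G - {s}) < card G" using finG s(1) by (intro psubset_card_mono) auto
    ultimately show False by simp
  qed
  then show ?thesis using G unfolding sp_def by blast
qed

end

section \<open>Sums of two squares of the form u^2 + pi v^2\<close>

text \<open>Off-diagonal terms pair up as \<open>(i, k)\<close> and \<open>(k, i)\<close>. The
  subgroup \<open>N\<close> is left open because the lemma is applied to a ring of integral
  elements, to \<open>{0}\<close>, and to the set of all \<open>Y + Y^ad\<close>.\<close>

lemma double_sum_minus_diagonal:
  fixes B :: "'i \<Rightarrow> 'i \<Rightarrow> 'b::ab_group_add"
  assumes N: "additively_closed N" and fin: "finite J"
    and B: "\<And>i k. i \<in> J \<Longrightarrow> k \<in> J \<Longrightarrow> i \<noteq> k \<Longrightarrow> B i k + B k i \<in> N"
  shows "(\<Sum>i\<in>J. \<Sum>k\<in>J. B i k) - (\<Sum>i\<in>J. B i i) \<in> N"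
  using fin B
proof (induction J)
  case empty
  then show ?case using additively_closedD(1)[OF N] by simp
next
  case (insert i J)
  have row: "(\<Sum>j\<in>J. sum (B j) (insert i J)) = (\<Sum>j\<in>J. B j i) + (\<Sum>j\<in>J. sum (B j) J)"
    using insert.hyps by (simp add: sum.distrib)
  have "(\<Sum>j\<in>insert i J. \<Sum>k\<in>insert i J. B j k) - (\<Sum>j\<in>insert i J. B j j)
    = ((\<Sum>i\<in>J. \<Sum>k\<in>J. B i k) - (\<Sum>i\<in>J. B i i)) + (\<Sum>k\<in>J. B i k + B k i)"
    using insert.hyps row by (simp add: sum.distrib algebra_simps)
  also have "\<dots> \<in> N"
  proof (rule additively_closedD(4)[OF N])
    show "(\<Sum>j\<in>J. \<Sum>k\<in>J. B j k) - (\<Sum>j\<in>J. B j j) \<in> N" using insert by auto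
    show "(\<Sum>k\<in>J. B i k + B k i) \<in> N"
      using insert.hyps by (intro additively_closed_sum[OF N] insert.prems) auto
  qed
  finally show ?case .
qed

text \<open>The descent step: if p divides r^2 + p s^2, then p divides r^2, hence r, hence s^2, hence s.\<close>

lemma square_descent:
  fixes R :: "'a::{ring,monoid_mult} set"
  assumes central: "\<And>x. p * x = x * p" and inv: "p * q = 1"
    and R: "additively_closed R" "\<And>x y. x \<in> R \<Longrightarrow> y \<in> R \<Longrightarrow> x * y \<in> R" "p \<in> R"
    and red: "\<And>z y. z \<in> R \<Longrightarrow> y \<in> R \<Longrightarrow> z * z = p * y \<Longrightarrow> \<exists>w\<in>R. z = p * w"
    and X: "r * r + p * (s * s) \<in> R"
  shows "p ^ m * r \<in> R \<Longrightarrow> p ^ m * s \<in> R \<Longrightarrow> r \<in> R \<and> s \<in> R"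
proof (induction m)
  case (Suc m)
  have qp: "q * p = 1" using central inv by metis
  have cancel: "x = y" if "p * x = p * y" for x y
  proof -
    have "q * (p * x) = q * (p * y)" using that by simp
    then show ?thesis using qp by (simp add: mult.assoc[symmetric])
  qed
  have cp: "p ^ k * x = x * p ^ k" for k x
    by (induction k) (auto simp: mult.assoc central, metis central mult.assoc)
  have pR: "x \<in> R \<Longrightarrow> p ^ k * x \<in> R" for k x
    by (induction k) (auto simp: mult.assoc intro: R)
  have sq: "(p ^ k * x) * (p ^ k * y) = p ^ k * (p ^ k * (x * y))" for k x y
    by (metis cp mult.assoc)
  \<comment> \<open>The denominator exponent is \<open>m + 1\<close>. Multiplying the given relation
    by \<open>p ^ (2 m + 2)\<close> yields \<open>r0^2 + p s0^2 = p (p Y)\<close>, and two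
    applications of \<open>red\<close> lower the exponent to \<open>m\<close>.\<close>
  define r0 where "r0 = p ^ Suc m * r"
  define s0 where "s0 = p ^ Suc m * s"
  have rs0: "r0 \<in> R" "s0 \<in> R" using Suc.prems by (auto simp: r0_def s0_def)
  define Y where "Y = p ^ m * (p ^ m * (r * r + p * (s * s)))"
  have Y: "Y \<in> R" unfolding Y_def by (intro pR X)
  have sw: "p ^ k * (p * x) = p * (p ^ k * x)" for k x
    by (simp only: mult.assoc[symmetric] power_commutes)
  have pp: "p ^ Suc m * (p ^ Suc m * x) = p * (p * (p ^ m * (p ^ m * x)))" for x
    by (simp add: mult.assoc sw)
  have "r0 * r0 = p ^ Suc m * (p ^ Suc m * (r * r))" "p * (s0 * s0) = p ^ Suc m * (p ^ Suc m * (p * (s * s)))"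
    unfolding r0_def s0_def sq by (simp_all add: sw del: power_Suc)
  then have eq: "r0 * r0 + p * (s0 * s0) = p * (p * Y)"
    unfolding Y_def pp by (simp add: distrib_left)
  have "r0 * r0 = p * (p * Y - s0 * s0)" using eq by (simp add: right_diff_distrib eq_diff_eq)
  moreover have "p * Y - s0 * s0 \<in> R" using R Y rs0 additively_closedD(2)[OF R(1)] by simp
  ultimately obtain w where w: "w \<in> R" "r0 = p * w" using red[OF rs0(1)] by blast
  have ww: "r0 * r0 = p * (p * (w * w))" using sq[of 1 w w] by (simp add: w(2))
  have "p * (s0 * s0) = p * (p * Y) - r0 * r0" unfolding eq[symmetric] by simp
  then have "p * (s0 * s0) = p * (p * (Y - w * w))" by (simp only: ww right_diff_distrib)
  then have "s0 * s0 = p * (Y - w * w)" by (rule cancel)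
  moreover have "Y - w * w \<in> R" using R Y w additively_closedD(2)[OF R(1)] by simp
  ultimately obtain w' where w': "w' \<in> R" "s0 = p * w'" using red[OF rs0(2)] by blast
  have "p ^ m * r = w" by (rule cancel) (use w(2) in \<open>simp add: r0_def mult.assoc\<close>)
  moreover have "p ^ m * s = w'" by (rule cancel) (use w'(2) in \<open>simp add: s0_def mult.assoc\<close>)
  ultimately show ?case using Suc.IH w w' by simp
qed auto

section \<open>Uniformizer, denominators and square roots modulo pi\<close>

locale uniformized_field = local_field nrm A for nrm :: "'f::field \<Rightarrow> real" and A +
  fixes pi :: 'f
  assumes pi: "0 < nrm pi" "nrm pi < 1" "\<And>x. nrm x < 1 \<Longrightarrow> nrm x \<le> nrm pi"
begin

lemma pi_nz: "pi \<noteq> 0" using pi(1) nrm_0 by auto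

lemma pi_A: "pi \<in> A" using pi(2) by (simp add: A_def)

lemma divisible_by_pi: "nrm x < 1 \<Longrightarrow> x / pi \<in> A"
  using pi(3) A_divide by blast

lemma pi_power_small:
  assumes "0 < e"
  obtains m where "nrm pi ^ m < e"
  using real_arch_pow_inv[OF assms pi(2)] by blast

lemma denominator: "\<exists>m. pi ^ m * x \<in> A"
proof -
  obtain m where m: "nrm pi ^ m < inverse (nrm x + 1)"
    using pi_power_small[of "inverse (nrm x + 1)"] nrm_ge_0[of x] by auto
  have "nrm pi ^ m * nrm x \<le> inverse (nrm x + 1) * (nrm x + 1)"
    using m nrm_ge_0[of x] pi(1) by (intro mult_mono) auto
  also have "\<dots> = 1" using nrm_ge_0[of x] by simp
  finally show ?thesis by (auto simp: A_def nrm_mult nrm_power)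
qed

lemma denominator_mono: "pi ^ m * x \<in> A \<Longrightarrow> m \<le> k \<Longrightarrow> pi ^ k * x \<in> A"
  using A_mult[OF A_power[OF pi_A, of "k - m"], of "pi ^ m * x"]
  by (simp add: mult.assoc[symmetric] power_add[symmetric])

lemma common_denominator: "finite J \<Longrightarrow> \<exists>m. \<forall>i\<in>J. pi ^ m * a i \<in> A"
proof (induction J rule: finite_induct)
  case (insert i J)
  then obtain m k where "\<forall>i\<in>J. pi ^ m * a i \<in> A" "pi ^ k * a i \<in> A" using denominator by blast
  then have "\<forall>i\<in>insert i J. pi ^ max m k * a i \<in> A" using denominator_mono by force
  then show ?case by blast
qed auto

lemma eq_0_if_small:
  assumes "\<And>m. nrm x \<le> nrm pi ^ m"
  shows "x = 0"
proof (rule ccontr)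
  assume "x \<noteq> 0"
  then have "0 < nrm x" using nrm_ge_0[of x] nrm_eq_0[of x] by linarith
  then show False using assms pi_power_small by (metis linorder_not_less)
qed

text \<open>Squaring is injective on the finite residue field, hence surjective. Injectivity comes
  from \<open>x^2 - y^2 - 2 y (x - y) = (x - y)^2\<close> together with
  \<open>nrm 2 < 1\<close>.\<close>

lemma square_root_mod_pi:
  assumes "nrm 2 < 1" "c \<in> A"
  shows "\<exists>d\<in>A. nrm (c - d\<^sup>2) < 1"
proof -
  define cls where "cls = (\<lambda>x. {y. nrm (y - x) < 1})"
  have nrm_comm: "nrm (x - y) = nrm (y - x)" for x y using nrm_minus[of "x - y"] by simp
  have tr: "nrm (x - z) < 1" if "nrm (x - y) < 1" "nrm (y - z) < 1" for x y z
    using nrm_add[of "x - y" "y - z"] that by simp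
  have cls: "cls x = cls y \<longleftrightarrow> nrm (x - y) < 1" for x y
  proof
    assume "cls x = cls y"
    moreover have "x \<in> cls x" by (simp add: cls_def nrm_0)
    ultimately show "nrm (x - y) < 1" by (simp add: cls_def)
  next
    assume "nrm (x - y) < 1"
    then show "cls x = cls y" unfolding cls_def using tr nrm_comm by (metis (no_types, lifting))
  qed
  have "finite (cls ` A)"
    using nonarch unfolding nonarch_local_field_def cls_def A_def by simp
  \<comment> \<open>One representative for each residue class, so that squaring becomes a self-map
    of a finite set.\<close>
  then obtain Q where Q: "Q \<subseteq> A" "finite Q" "cls ` A = cls ` Q" "inj_on cls Q"
    by (metis finite_subset_image subset_image_inj finite_imageD order_refl)
  define rep where "rep = (\<lambda>x. SOME y. y \<in> Q \<and> cls y = cls x)"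
  have rep: "rep x \<in> Q \<and> cls (rep x) = cls x" if "x \<in> A" for x
  proof -
    have "cls x \<in> cls ` Q" using that Q(3) by blast
    then have "\<exists>y. y \<in> Q \<and> cls y = cls x" by (metis imageE)
    then show ?thesis unfolding rep_def by (rule someI_ex)
  qed
  have Qsq: "x \<in> Q \<Longrightarrow> x\<^sup>2 \<in> A" for x using Q(1) A_power by blast
  have "inj_on (\<lambda>x. rep (x\<^sup>2)) Q"
  proof (rule inj_onI)
    fix x y assume xy: "x \<in> Q" "y \<in> Q" "rep (x\<^sup>2) = rep (y\<^sup>2)"
    then have "nrm (x\<^sup>2 - y\<^sup>2) < 1" using rep Qsq cls by metis
    moreover have "nrm (2 * y * (x - y)) < 1"
    proof -
      have "nrm (y * (x - y)) \<le> 1" using xy Q(1) A_mult A_diff unfolding A_def by blast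
      then have "nrm 2 * nrm (y * (x - y)) \<le> nrm 2 * 1"
        using nrm_ge_0[of 2] by (intro mult_left_mono) auto
      then show ?thesis using assms(1) nrm_mult[of 2 "y * (x - y)"] by (simp add: mult.assoc)
    qed
    ultimately have "nrm ((x\<^sup>2 - y\<^sup>2) - 2 * y * (x - y)) < 1"
      using nrm_diff[of "x\<^sup>2 - y\<^sup>2" "2 * y * (x - y)"] by linarith
    moreover have "(x\<^sup>2 - y\<^sup>2) - 2 * y * (x - y) = (x - y)\<^sup>2"
      by (simp add: power2_eq_square algebra_simps)
    ultimately have "nrm (x - y) < 1" using nrm_power nrm_ge_0[of "x - y"]
      by (metis linorder_not_less one_le_power)
    then show "x = y" using cls xy Q(4) by (metis inj_onD)
  qed
  moreover have "(\<lambda>x. rep (x\<^sup>2)) ` Q \<subseteq> Q" using rep Qsq by blast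
  ultimately have "(\<lambda>x. rep (x\<^sup>2)) ` Q = Q" using Q(2) endo_inj_surj by blast
  then have "rep c \<in> (\<lambda>x. rep (x\<^sup>2)) ` Q" using rep[OF assms(2)] by simp
  then obtain d where d: "rep c = rep (d\<^sup>2)" "d \<in> Q" by (rule imageE)
  then have "cls c = cls (d\<^sup>2)" using rep[OF assms(2)] rep[OF Qsq[OF d(2)]] d(1) by simp
  then show ?thesis using cls d(2) Q(1) by blast
qed

lemma nrm_square_add:
  assumes "nrm (c * x\<^sup>2) \<le> e" "nrm (c * y\<^sup>2) \<le> e"
  shows "nrm (c * (x + y)\<^sup>2) \<le> e"
proof -
  have "nrm (x + y) \<le> nrm x \<or> nrm (x + y) \<le> nrm y" using nrm_add[of x y] by linarith
  then have "nrm (x + y) ^ 2 \<le> nrm x ^ 2 \<or> nrm (x + y) ^ 2 \<le> nrm y ^ 2"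
    using nrm_ge_0 power_mono by blast
  then have "nrm c * nrm (x + y) ^ 2 \<le> nrm c * nrm x ^ 2 \<or> nrm c * nrm (x + y) ^ 2 \<le> nrm c * nrm y ^ 2"
    using nrm_ge_0 mult_left_mono by blast
  then show ?thesis using assms by (auto simp: nrm_mult nrm_power)
qed

text \<open>The square of the norm is \<open>|2|^2 |c x^2| |c y^2|\<close>. For \<open>c = 1\<close>
  and \<open>c = pi\<close> this makes \<open>c (x + y)^2\<close> and \<open>c x^2 + c y^2\<close>
  agree modulo \<open>A\<close> although \<open>x\<close> and \<open>y\<close> have
  denominators.\<close>

lemma double_product_integral:
  assumes "nrm 2 \<le> nrm pi ^ m" "nrm (c * x\<^sup>2) \<le> inverse (nrm pi ^ m)" "nrm (c * y\<^sup>2) \<le> inverse (nrm pi ^ m)"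
  shows "2 * (c * (x * y)) \<in> A"
proof -
  have p: "0 < nrm pi ^ m" using pi(1) by simp
  have "(nrm (2 * (c * (x * y))))\<^sup>2 = (nrm 2)\<^sup>2 * (nrm (c * x\<^sup>2) * nrm (c * y\<^sup>2))"
    by (simp add: nrm_mult nrm_power power2_eq_square)
  also have "\<dots> \<le> (nrm pi ^ m)\<^sup>2 * (inverse (nrm pi ^ m) * inverse (nrm pi ^ m))"
    using assms nrm_ge_0 p by (intro mult_mono power_mono) auto
  also have "\<dots> = 1" using p pi(1) by (simp add: power2_eq_square field_simps)
  finally have "nrm (2 * (c * (x * y))) \<le> 1" by (simp add: abs_square_le_1 nrm_ge_0)
  then show ?thesis by (simp add: A_def)
qed

text \<open>The polar part of \<open>a\<close> is removed one order at a time: the square root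
  modulo \<open>pi\<close> makes the leading term of order \<open>m + 1\<close> equal to
  \<open>d^2 / pi ^ (m + 1)\<close>. This is a square or \<open>pi\<close> times a square according
  to the parity of \<open>m + 1\<close>, so it is absorbed into \<open>u\<close> or into
  \<open>v\<close>. The norm bounds are carried along to keep the resulting cross term
  integral.\<close>

lemma square_decomposition:
  assumes "nrm 2 < 1"
  shows "nrm 2 \<le> nrm pi ^ m \<Longrightarrow> pi ^ m * a \<in> A \<Longrightarrow> \<exists>u v. a - (u\<^sup>2 + pi * v\<^sup>2) \<in> A \<and>
    nrm (u\<^sup>2) \<le> inverse (nrm pi ^ m) \<and> nrm (pi * v\<^sup>2) \<le> inverse (nrm pi ^ m)"
proof (induction m arbitrary: a)
  case 0
  then show ?case by (intro exI[of _ 0]) (auto simp: nrm_0)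
next
  case (Suc m)
  let ?e = "inverse (nrm pi ^ m)" and ?E = "inverse (nrm pi ^ Suc m)"
  have eE: "?e \<le> ?E"
    using pi by (intro le_imp_inverse_le power_decreasing) auto
  have n2: "nrm 2 \<le> nrm pi ^ m"
    using pi by (intro order_trans[OF Suc.prems(1)] power_decreasing) auto
  obtain d where d: "d \<in> A" "nrm (pi ^ Suc m * a - d\<^sup>2) < 1"
    using square_root_mod_pi[OF assms Suc.prems(2)] by blast
  have b: "pi ^ m * (a - d\<^sup>2 / pi ^ Suc m) \<in> A"
  proof -
    have "pi ^ m * (a - d\<^sup>2 / pi ^ Suc m) = (pi ^ Suc m * a - d\<^sup>2) / pi"
      using pi_nz by (simp add: diff_divide_distrib right_diff_distrib)
    then show ?thesis using divisible_by_pi[OF d(2)] by simp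
  qed
  obtain u v where uv: "(a - d\<^sup>2 / pi ^ Suc m) - (u\<^sup>2 + pi * v\<^sup>2) \<in> A" "nrm (u\<^sup>2) \<le> ?e" "nrm (pi * v\<^sup>2) \<le> ?e"
    using Suc.IH[OF n2 b] by blast
  have nd: "nrm (d\<^sup>2 / pi ^ Suc m) \<le> ?E"
  proof -
    have "nrm (d\<^sup>2) \<le> 1" using A_power[OF d(1)] by (simp add: A_def)
    then show ?thesis using pi(1) by (simp add: nrm_divide nrm_power nrm_mult divide_simps)
  qed
  note uvE = order_trans[OF uv(2) eE] order_trans[OF uv(3) eE]
  show ?case
  proof (cases "even (Suc m)")
    case True
    then obtain l where l: "Suc m = 2 * l" by blast
    define w where "w = d / pi ^ l"
    have w2: "w\<^sup>2 = d\<^sup>2 / pi ^ Suc m" by (simp add: w_def power_divide l power_mult[symmetric] mult.commute del: power_Suc)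
    have wE: "nrm (1 * w\<^sup>2) \<le> ?E" using nd by (simp add: w2)
    have "2 * (1 * (u * w)) \<in> A"
      by (rule double_product_integral[of "Suc m"]) (use uvE wE Suc.prems in simp_all)
    then have "(a - d\<^sup>2 / pi ^ Suc m) - (u\<^sup>2 + pi * v\<^sup>2) - 2 * (u * w) \<in> A" using A_diff uv(1) by simp
    then have "a - ((u + w)\<^sup>2 + pi * v\<^sup>2) \<in> A" by (simp add: w2 power2_sum algebra_simps del: power_Suc)
    moreover have "nrm ((u + w)\<^sup>2) \<le> ?E" using nrm_square_add[of 1 u ?E w] wE uvE by simp
    ultimately show ?thesis using uvE by blast
  next
    case False
    then obtain l where l: "Suc m = 2 * l + 1" by (metis oddE)
    define w where "w = d / pi ^ Suc l"
    have w2: "pi * w\<^sup>2 = d\<^sup>2 / pi ^ Suc m"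
      using pi_nz by (simp add: w_def power_divide l power_mult_distrib mult.commute field_simps power2_eq_square power_add mult_2_right)
    have wE: "nrm (pi * w\<^sup>2) \<le> ?E" using nd by (simp add: w2)
    have "2 * (pi * (v * w)) \<in> A"
      by (rule double_product_integral[of "Suc m"]) (use uvE wE Suc.prems in simp_all)
    then have "(a - d\<^sup>2 / pi ^ Suc m) - (u\<^sup>2 + pi * v\<^sup>2) - 2 * (pi * (v * w)) \<in> A" using A_diff uv(1) by simp
    then have "a - (u\<^sup>2 + pi * (v + w)\<^sup>2) \<in> A" by (simp add: w2[symmetric] power2_sum algebra_simps del: power_Suc)
    moreover have "nrm (pi * (v + w)\<^sup>2) \<le> ?E" using nrm_square_add[of pi v ?E w] wE uvE by simp
    ultimately show ?thesis using uvE by blast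
  qed
qed

lemma nrm_2: "nrm 2 \<le> 1" using A_2 by (simp add: A_def)

text \<open>A single exponent \<open>m\<close> has to serve all \<open>i\<close>, with
  \<open>pi ^ m * a i\<close> integral and \<open>|2| \<le> |pi|^m\<close>. If \<open>2 = 0\<close>
  in \<open>F\<close>, the second condition is automatic and \<open>m\<close> is a common
  denominator. Otherwise \<open>m\<close> is the valuation of 2, and the first condition follows
  from \<open>2 * a i\<close> being in \<open>A\<close>. If 2 is a unit, all \<open>a i\<close> lie
  in \<open>A\<close> and \<open>u = v = 0\<close> will do.\<close>

lemma square_decomposition_family:
  assumes "finite J" and a: "\<And>i. i \<in> J \<Longrightarrow> 2 * a i \<in> A"
  obtains u v where "\<And>i. i \<in> J \<Longrightarrow> a i - ((u i)\<^sup>2 + pi * (v i)\<^sup>2) \<in> A"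
    and "\<And>i k. i \<in> J \<Longrightarrow> k \<in> J \<Longrightarrow> 2 * (u i * u k) \<in> A \<and> 2 * (pi * (v i * v k)) \<in> A"
proof (cases "nrm 2 < 1")
  case False
  then have "nrm 2 = 1" using nrm_2 by simp
  then have "a i \<in> A" if "i \<in> J" for i using a[OF that] by (simp add: A_def nrm_mult)
  then show thesis using that[of "\<lambda>_. 0" "\<lambda>_. 0"] by simp
next
  case True
  have "\<exists>m. nrm 2 \<le> nrm pi ^ m \<and> (\<forall>i\<in>J. pi ^ m * a i \<in> A)"
  proof (cases "(2::'f) = 0")
    case True
    then show ?thesis using common_denominator[OF assms(1), of a] pi(1) by (auto simp: nrm_0)
  next
    case False
    then have pos: "0 < nrm 2" using nrm_ge_0[of 2] nrm_eq_0[of 2] by linarith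
    \<comment> \<open>This is the valuation of 2: minimality gives \<open>|2| \<le> |pi|^m\<close>,
      and equality follows because no norm lies strictly between \<open>|pi|\<close> and 1.\<close>
    define m where "m = (LEAST m. nrm pi ^ Suc m < nrm 2)"
    have ex: "\<exists>m. nrm pi ^ Suc m < nrm 2"
    proof -
      obtain m where "nrm pi ^ m < nrm 2" using pi_power_small[OF pos] .
      moreover have "nrm pi ^ Suc m \<le> nrm pi ^ m" using pi by (intro power_decreasing) auto
      ultimately show ?thesis by (meson order_le_less_trans)
    qed
    have m1: "nrm pi ^ Suc m < nrm 2" unfolding m_def using ex by (rule LeastI_ex)
    have m2: "nrm 2 \<le> nrm pi ^ m"
    proof (cases m)
      case 0
      then show ?thesis using nrm_2 by simp
    next
      case (Suc k)
      then show ?thesis using not_less_Least[of k "\<lambda>m. nrm pi ^ Suc m < nrm 2"] m_def by force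
    qed
    have p: "0 < nrm pi ^ m" using pi(1) by simp
    have "nrm pi < nrm (2 / pi ^ m)"
      using m1 p by (simp add: nrm_divide nrm_power pos_less_divide_eq)
    then have "1 \<le> nrm (2 / pi ^ m)" using pi(3) by (meson not_le)
    then have "nrm pi ^ m \<le> nrm 2" using p by (simp add: nrm_divide nrm_power)
    then have "nrm (pi ^ m) = nrm 2" using m2 by (simp add: nrm_power)
    then have "pi ^ m * a i \<in> A" if "i \<in> J" for i using a[OF that] by (simp add: A_def nrm_mult)
    then show ?thesis using m2 by blast
  qed
  then obtain m where m: "nrm 2 \<le> nrm pi ^ m" "\<And>i. i \<in> J \<Longrightarrow> pi ^ m * a i \<in> A" by blast
  have "\<forall>i\<in>J. \<exists>p. a i - ((fst p)\<^sup>2 + pi * (snd p)\<^sup>2) \<in> A \<and>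
      nrm ((fst p)\<^sup>2) \<le> inverse (nrm pi ^ m) \<and> nrm (pi * (snd p)\<^sup>2) \<le> inverse (nrm pi ^ m)"
    using square_decomposition[OF True m(1) m(2)] by (metis fst_conv snd_conv)
  then obtain p where p: "\<And>i. i \<in> J \<Longrightarrow> a i - ((fst (p i))\<^sup>2 + pi * (snd (p i))\<^sup>2) \<in> A \<and>
      nrm ((fst (p i))\<^sup>2) \<le> inverse (nrm pi ^ m) \<and> nrm (pi * (snd (p i))\<^sup>2) \<le> inverse (nrm pi ^ m)"
    by metis
  show thesis
  proof (rule that[of "\<lambda>i. fst (p i)" "\<lambda>i. snd (p i)"])
    fix i k assume ik: "i \<in> J" "k \<in> J"
    show "2 * (fst (p i) * fst (p k)) \<in> A \<and> 2 * (pi * (snd (p i) * snd (p k))) \<in> A"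
      using double_product_integral[OF m(1), of 1 "fst (p i)" "fst (p k)"]
        double_product_integral[OF m(1), of pi "snd (p i)" "snd (p k)"] p ik by simp
  qed (use p in blast)
qed

lemma A_reduced: "z \<in> A \<Longrightarrow> y \<in> A \<Longrightarrow> z * z = pi * y \<Longrightarrow> \<exists>w\<in>A. z = pi * w"
proof -
  assume z: "z \<in> A" "y \<in> A" "z * z = pi * y"
  have "nrm y * nrm pi \<le> 1 * nrm pi" using z(2) pi(1) by (intro mult_right_mono) (auto simp: A_def)
  moreover have "nrm z * nrm z = nrm y * nrm pi" using z(3) by (metis nrm_mult mult.commute)
  ultimately have "nrm z * nrm z < 1" using pi(2) by linarith
  then have "nrm z < 1" using nrm_ge_0[of z] by (metis linorder_not_less mult_mono' mult_1 zero_le_one)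
  then have "z / pi \<in> A" by (rule divisible_by_pi)
  then show ?thesis using pi_nz by (intro bexI[of _ "z / pi"]) auto
qed

lemma A_square_descent:
  assumes "r\<^sup>2 + pi * s\<^sup>2 \<in> A"
  shows "r \<in> A \<and> s \<in> A"
proof -
  obtain m k where "pi ^ m * r \<in> A" "pi ^ k * s \<in> A" using denominator by blast
  then have "pi ^ max m k * r \<in> A" "pi ^ max m k * s \<in> A" using denominator_mono by force+
  then show ?thesis
    by (intro square_descent[where p = pi and q = "inverse pi" and R = A and m = "max m k"])
      (use A_closed A_mult pi_A pi_nz A_reduced assms in \<open>auto simp: power2_eq_square\<close>)
qed

text \<open>Equivalently, \<open>-pi\<close> is not a square. If the sum is zero, then
  \<open>r / pi ^ m\<close> and \<open>s / pi ^ m\<close> satisfy the hypothesis of the descent for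
  every \<open>m\<close>, so \<open>r\<close> and \<open>s\<close> are divisible by all powers of
  \<open>pi\<close>.\<close>

lemma A_square_zero:
  assumes "r\<^sup>2 + pi * s\<^sup>2 = 0"
  shows "r = 0 \<and> s = 0"
proof -
  have *: "r / pi ^ m \<in> A \<and> s / pi ^ m \<in> A" for m
  proof -
    have "(r / pi ^ m)\<^sup>2 + pi * (s / pi ^ m)\<^sup>2 = (r\<^sup>2 + pi * s\<^sup>2) / (pi ^ m)\<^sup>2"
      by (simp add: power_divide add_divide_distrib)
    then have "(r / pi ^ m)\<^sup>2 + pi * (s / pi ^ m)\<^sup>2 \<in> A" by (simp only: assms) simp
    then show ?thesis by (rule A_square_descent)
  qed
  have "nrm r \<le> nrm pi ^ m \<and> nrm s \<le> nrm pi ^ m" for m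
    using *[of m] pi(1) by (simp add: A_def nrm_divide nrm_power)
  then show ?thesis using eq_0_if_small by blast
qed

text \<open>In characteristic 2, \<open>F = F^2 + pi F^2\<close>. Decomposing
  \<open>a / pi ^ (2 k)\<close> modulo \<open>A\<close> and rescaling gives solutions modulo
  \<open>pi ^ (2 k)\<close>. Since squaring is additive, the form \<open>r^2 + pi s^2\<close> also
  measures the difference of two such solutions, and the descent bounds it; so the approximations
  are Cauchy and completeness supplies the limit.\<close>

lemma exact_square_decomposition:
  assumes two: "(2::'f) = 0"
  shows "\<exists>u v. a = u\<^sup>2 + pi * v\<^sup>2"
proof -
  have n2: "nrm 2 < 1" using two nrm_0 by simp
  have "\<exists>p. (a - ((fst p)\<^sup>2 + pi * (snd p)\<^sup>2)) / (pi ^ k)\<^sup>2 \<in> A" for k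
  proof -
    obtain m where m: "pi ^ m * (a / (pi ^ k)\<^sup>2) \<in> A" using denominator by blast
    have "nrm 2 \<le> nrm pi ^ m" using two nrm_0 pi(1) by simp
    then obtain u v where "a / (pi ^ k)\<^sup>2 - (u\<^sup>2 + pi * v\<^sup>2) \<in> A"
      using square_decomposition[OF n2 _ m] by blast
    moreover have "a / (pi ^ k)\<^sup>2 - (u\<^sup>2 + pi * v\<^sup>2) = (a - ((pi ^ k * u)\<^sup>2 + pi * (pi ^ k * v)\<^sup>2)) / (pi ^ k)\<^sup>2"
      using pi_nz by (simp add: field_simps power_mult_distrib)
    ultimately show ?thesis by (intro exI[of _ "(pi ^ k * u, pi ^ k * v)"]) simp
  qed
  then obtain P where P: "\<And>k. (a - ((fst (P k))\<^sup>2 + pi * (snd (P k))\<^sup>2)) / (pi ^ k)\<^sup>2 \<in> A" by metis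
  define U where "U = (\<lambda>k. fst (P k))"
  define V where "V = (\<lambda>k. snd (P k))"
  have dUV: "a - ((U k)\<^sup>2 + pi * (V k)\<^sup>2) = (pi ^ k)\<^sup>2 * ((a - ((U k)\<^sup>2 + pi * (V k)\<^sup>2)) / (pi ^ k)\<^sup>2)" for k
    using pi_nz by simp
  have sq2: "(x - y)\<^sup>2 = x\<^sup>2 - y\<^sup>2" for x y :: 'f
  proof -
    have "(x - y)\<^sup>2 = x\<^sup>2 - y\<^sup>2 - 2 * (y * (x - y))" by (simp add: power2_eq_square algebra_simps)
    then show ?thesis by (simp add: two)
  qed
  have step: "nrm (U j - U i) \<le> nrm pi ^ i \<and> nrm (V j - V i) \<le> nrm pi ^ i" if "i \<le> j" for i j
  proof -
    define x where "x = (a - ((U i)\<^sup>2 + pi * (V i)\<^sup>2)) / (pi ^ i)\<^sup>2"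
    define y where "y = (a - ((U j)\<^sup>2 + pi * (V j)\<^sup>2)) / (pi ^ j)\<^sup>2"
    have xy: "x \<in> A" "y \<in> A" using P unfolding x_def y_def U_def V_def by auto
    have "((U j - U i) / pi ^ i)\<^sup>2 + pi * ((V j - V i) / pi ^ i)\<^sup>2
      = ((a - ((U i)\<^sup>2 + pi * (V i)\<^sup>2)) - (a - ((U j)\<^sup>2 + pi * (V j)\<^sup>2))) / (pi ^ i)\<^sup>2"
      by (simp add: power_divide sq2 add_divide_distrib[symmetric] algebra_simps)
    also have "\<dots> = ((pi ^ i)\<^sup>2 * x - (pi ^ j)\<^sup>2 * y) / (pi ^ i)\<^sup>2"
      unfolding x_def y_def by (simp only: dUV[symmetric])
    also have "\<dots> = x - (pi ^ j)\<^sup>2 * y / (pi ^ i)\<^sup>2"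
      using pi_nz by (simp add: diff_divide_distrib)
    also have "(pi ^ j)\<^sup>2 * y / (pi ^ i)\<^sup>2 = (pi ^ (j - i))\<^sup>2 * y"
      using that pi_nz by (simp add: field_simps power_mult_distrib[symmetric] power_add[symmetric])
    finally have eq: "((U j - U i) / pi ^ i)\<^sup>2 + pi * ((V j - V i) / pi ^ i)\<^sup>2 = x - (pi ^ (j - i))\<^sup>2 * y" .
    have "x - (pi ^ (j - i))\<^sup>2 * y \<in> A" by (intro A_diff A_mult A_power pi_A xy)
    then have "(U j - U i) / pi ^ i \<in> A \<and> (V j - V i) / pi ^ i \<in> A"
      by (intro A_square_descent) (simp only: eq)
    then show ?thesis using pi(1) by (simp add: A_def nrm_divide nrm_power)
  qed
  \<comment> \<open>Convergence with an explicit rate: the limit inherits the bound on the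
    increments.\<close>
  have lim: "\<exists>l. \<forall>i. nrm (s i - l) \<le> nrm pi ^ i"
    if s: "\<And>i j. i \<le> j \<Longrightarrow> nrm (s j - s i) \<le> nrm pi ^ i" for s :: "nat \<Rightarrow> 'f"
  proof -
    have s': "nrm (s i - s j) \<le> nrm pi ^ N" if "N \<le> i" "N \<le> j" for i j N
    proof -
      have "nrm (s i - s j) \<le> max (nrm (s i - s N)) (nrm (s j - s N))"
        using nrm_diff[of "s i - s N" "s j - s N"] by simp
      then show ?thesis using s[OF that(1)] s[OF that(2)] by linarith
    qed
    have cauchy: "\<forall>e>0. \<exists>N. \<forall>i\<ge>N. \<forall>j\<ge>N. nrm (s i - s j) < e"
    proof (intro allI impI)
      fix e :: real assume "0 < e"
      then obtain N where "nrm pi ^ N < e" using pi_power_small by blast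
      then show "\<exists>N. \<forall>i\<ge>N. \<forall>j\<ge>N. nrm (s i - s j) < e" using s' by (meson order_le_less_trans)
    qed
    have "\<forall>s :: nat \<Rightarrow> 'f. (\<forall>e>0. \<exists>N. \<forall>i\<ge>N. \<forall>j\<ge>N. nrm (s i - s j) < e) \<longrightarrow>
        (\<exists>l. \<forall>e>0. \<exists>N. \<forall>i\<ge>N. nrm (s i - l) < e)"
      using nonarch unfolding nonarch_local_field_def by blast
    then obtain l where l: "\<And>e. e > 0 \<Longrightarrow> \<exists>N. \<forall>i\<ge>N. nrm (s i - l) < e" using cauchy by blast
    have "nrm (s i - l) \<le> nrm pi ^ i" for i
    proof -
      obtain N where N: "\<forall>k\<ge>N. nrm (s k - l) < nrm pi ^ i" using l[of "nrm pi ^ i"] pi(1) by auto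
      define k where "k = max N i"
      have "nrm (s i - l) \<le> max (nrm (s i - s k)) (nrm (s k - l))"
        using nrm_add[of "s i - s k" "s k - l"] by simp
      moreover have "nrm (s i - s k) \<le> nrm pi ^ i" by (rule s') (simp_all add: k_def)
      moreover have "nrm (s k - l) < nrm pi ^ i" using N by (simp add: k_def)
      ultimately show ?thesis by simp
    qed
    then show ?thesis by blast
  qed
  obtain u where u: "\<And>i. nrm (U i - u) \<le> nrm pi ^ i" using lim[of U] step by blast
  obtain v where v: "\<And>i. nrm (V i - v) \<le> nrm pi ^ i" using lim[of V] step by blast
  have "nrm (a - (u\<^sup>2 + pi * v\<^sup>2)) \<le> nrm pi ^ m" for m
  proof -
    have eq: "a - (u\<^sup>2 + pi * v\<^sup>2) = (a - ((U m)\<^sup>2 + pi * (V m)\<^sup>2)) + (1 * (U m - u)\<^sup>2 + pi * (V m - v)\<^sup>2)"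
      by (simp add: sq2 algebra_simps)
    have le: "(nrm pi ^ m)\<^sup>2 \<le> nrm pi ^ m"
      using pi by (simp add: power2_eq_square mult_left_le_one_le power_le_one)
    have "nrm (a - ((U m)\<^sup>2 + pi * (V m)\<^sup>2)) \<le> nrm pi ^ m"
    proof -
      have "nrm ((a - ((U m)\<^sup>2 + pi * (V m)\<^sup>2)) / (pi ^ m)\<^sup>2) \<le> 1"
        using P[of m] by (simp add: A_def U_def V_def)
      then show ?thesis using le pi(1) by (simp add: nrm_divide nrm_power)
    qed
    moreover have "nrm (1 * (U m - u)\<^sup>2) \<le> nrm pi ^ m"
      using power_mono[OF u[of m] nrm_ge_0, of 2] le by (simp add: nrm_power)
    moreover have "nrm (pi * (V m - v)\<^sup>2) \<le> nrm pi ^ m"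
    proof -
      have "nrm pi * (nrm (V m - v))\<^sup>2 \<le> 1 * (nrm pi ^ m)\<^sup>2"
        using power_mono[OF v[of m] nrm_ge_0, of 2] pi by (intro mult_mono) auto
      then show ?thesis using le by (simp add: nrm_power nrm_mult)
    qed
    ultimately show ?thesis unfolding eq
      using nrm_add[of "a - ((U m)\<^sup>2 + pi * (V m)\<^sup>2)" "1 * (U m - u)\<^sup>2 + pi * (V m - v)\<^sup>2"]
        nrm_add[of "1 * (U m - u)\<^sup>2" "pi * (V m - v)\<^sup>2"] by linarith
  qed
  then have "a - (u\<^sup>2 + pi * v\<^sup>2) = 0" by (rule eq_0_if_small)
  then show ?thesis by auto
qed

end

section \<open>Evaluating formal sums of pure tensors\<close>

text \<open>Formal sums have integer coefficients while the target is merely an abelian group, so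
  its \<open>\<int>\<close>-module structure is built from iterated addition.\<close>

definition nat_multiple :: "nat \<Rightarrow> 'm::ab_group_add \<Rightarrow> 'm" where
  "nat_multiple n x = ((+) x ^^ n) 0"

lemma nat_multiple_add: "nat_multiple (m + n) x = nat_multiple m x + nat_multiple n x"
  by (induction m) (auto simp: nat_multiple_def)

definition int_multiple :: "int \<Rightarrow> 'm::ab_group_add \<Rightarrow> 'm" where
  "int_multiple k x = nat_multiple (nat k) x - nat_multiple (nat (- k)) x"

lemma int_multiple_nat_diff: "int_multiple (int a - int b) x = nat_multiple a x - nat_multiple b x"
proof (cases "a \<le> b")
  case True
  then obtain c where "b = a + c" using le_Suc_ex by blast
  then show ?thesis by (simp add: int_multiple_def nat_multiple_add) (simp add: nat_multiple_def)
next
  case False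
  then obtain c where "a = b + c" using le_Suc_ex nat_le_linear by blast
  then show ?thesis by (simp add: int_multiple_def nat_multiple_add) (simp add: nat_multiple_def)
qed

lemma int_multiple_diff: "int_multiple (k - l) x = int_multiple k x - int_multiple l x"
proof -
  obtain a b c d where "k = int a - int b" "l = int c - int d" by (metis int_diff_cases)
  moreover have "k - l = int (a + d) - int (b + c)" using calculation by simp
  ultimately show ?thesis by (simp only: int_multiple_nat_diff nat_multiple_add) simp
qed

lemma int_multiple_0: "int_multiple 0 x = 0" and int_multiple_1: "int_multiple 1 x = x"
  by (auto simp: int_multiple_def nat_multiple_def)

text \<open>The homomorphism out of the free abelian group that extends
  \<open>\<beta>\<close>.\<close>

definition eval_sum :: "('k \<Rightarrow> 'm::ab_group_add) \<Rightarrow> ('k \<Rightarrow>\<^sub>0 int) \<Rightarrow> 'm" where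
  "eval_sum \<beta> f = (\<Sum>k\<in>Poly_Mapping.keys f. int_multiple (Poly_Mapping.lookup f k) (\<beta> k))"

lemma eval_sum_superset:
  assumes "finite S" "Poly_Mapping.keys f \<subseteq> S"
  shows "eval_sum \<beta> f = (\<Sum>k\<in>S. int_multiple (Poly_Mapping.lookup f k) (\<beta> k))"
  unfolding eval_sum_def
  by (rule sum.mono_neutral_left) (use assms in \<open>auto simp: in_keys_iff int_multiple_0\<close>)

lemma eval_sum_diff: "eval_sum \<beta> (f - g) = eval_sum \<beta> f - eval_sum \<beta> g"
proof -
  let ?S = "Poly_Mapping.keys f \<union> Poly_Mapping.keys g"
  have "eval_sum \<beta> h = (\<Sum>k\<in>?S. int_multiple (Poly_Mapping.lookup h k) (\<beta> k))" if "h \<in> {f, g, f - g}" for h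
    using that keys_diff[of f g] by (intro eval_sum_superset) auto
  then show ?thesis by (simp add: lookup_minus int_multiple_diff sum_subtractf)
qed

lemma eval_sum_0 [simp]: "eval_sum \<beta> 0 = 0" by (simp add: eval_sum_def)

lemma eval_sum_frag_of [simp]: "eval_sum \<beta> (frag_of k) = \<beta> k"
  by (simp add: eval_sum_def int_multiple_1)

lemma eval_sum_add: "eval_sum \<beta> (f + g) = eval_sum \<beta> f + eval_sum \<beta> g"
  using eval_sum_diff[of \<beta> "f + g" g] by (simp add: eq_diff_eq)

lemma eval_sum_sum_list: "eval_sum \<beta> (\<Sum>z\<leftarrow>xs. frag_of z) = (\<Sum>z\<leftarrow>xs. \<beta> z)"
  by (induction xs) (auto simp: eval_sum_add)

lemma eval_sum_in:
  assumes N: "additively_closed N" and "\<And>k. \<beta> k \<in> N"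
  shows "eval_sum \<beta> f \<in> N"
  by (induction f rule: frag_induction[OF subset_UNIV])
    (use assms additively_closedD[OF N] in \<open>auto simp: eval_sum_diff\<close>)

lemma eval_sum_compose:
  assumes "\<And>x y. g (x - y) = g x - g y"
  shows "eval_sum (\<lambda>k. g (\<beta> k)) f = g (eval_sum \<beta> f)"
proof (induction f rule: frag_induction[OF subset_UNIV])
  show "eval_sum (\<lambda>k. g (\<beta> k)) 0 = g (eval_sum \<beta> 0)" using assms[of 0 0] by simp
qed (simp_all add: eval_sum_diff assms)

lemma eval_sum_minus: "eval_sum (\<lambda>k. \<beta> k - \<gamma> k) f = eval_sum \<beta> f - eval_sum \<gamma> f"
  by (induction f rule: frag_induction[OF subset_UNIV]) (auto simp: eval_sum_diff)

text \<open>A balanced bilinear map, up to a subgroup \<open>N\<close>. This admits maps into a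
  quotient without forming the quotient, such as sequences up to finitely many terms or elements
  modulo \<open>pi R\<close>.\<close>

definition balanced_mod ::
  "'f set \<Rightarrow> ('f \<Rightarrow> 'm::ab_group_add \<Rightarrow> 'm) \<Rightarrow> ('f \<Rightarrow> 'r::{comm_ring,comm_monoid_mult}) \<Rightarrow> 'm set
     \<Rightarrow> 't::ab_group_add set \<Rightarrow> ('m \<Rightarrow> 'r \<Rightarrow> 't) \<Rightarrow> bool" where
  "balanced_mod A sc \<alpha> M N \<beta> \<longleftrightarrow>
     (\<forall>x\<in>M. \<forall>y\<in>M. \<forall>r. \<beta> (x + y) r - \<beta> x r - \<beta> y r \<in> N) \<and>
     (\<forall>x\<in>M. \<forall>r s. \<beta> x (r + s) - \<beta> x r - \<beta> x s \<in> N) \<and>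
     (\<forall>a\<in>A. \<forall>x\<in>M. \<forall>r. \<beta> (sc a x) r - \<beta> x (\<alpha> a * r) \<in> N)"

lemma eval_sum_tensor_relations:
  assumes N: "additively_closed N" and \<beta>: "balanced_mod A sc \<alpha> M N \<beta>"
    and f: "f \<in> tensor_relations A sc \<alpha> M"
  shows "eval_sum (\<lambda>(m, r). \<beta> m r) f \<in> N"
  using f unfolding tensor_relations_def
proof (induction f rule: group_closure.induct)
  case (base s)
  then show ?case using \<beta> additively_closedD(1)[OF N]
    by (auto simp: eval_sum_diff balanced_mod_def)
qed (auto simp: eval_sum_diff additively_closedD(2)[OF N])

lemma tensor_sum_simps [simp]:
  "tensor_sum \<tau> [] = 0" "tensor_sum \<tau> ((m, r) # xs) = \<tau> m r + tensor_sum \<tau> xs"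
  "tensor_sum \<tau> (xs @ ys) = tensor_sum \<tau> xs + tensor_sum \<tau> ys"
  by (auto simp: tensor_sum_def)

lemma tensor_image_pure: "m \<in> M \<Longrightarrow> \<tau> m r \<in> tensor_image \<tau> M"
  unfolding tensor_image_def by (intro CollectI exI[of _ "[(m, r)]"]) auto

lemma tensor_image_zero: "0 \<in> tensor_image \<tau> M"
  unfolding tensor_image_def by (intro CollectI exI[of _ "[]"]) auto

lemma tensor_image_add:
  assumes "x \<in> tensor_image \<tau> M" "y \<in> tensor_image \<tau> M"
  shows "x + y \<in> tensor_image \<tau> M"
proof -
  obtain xs ys where "x = tensor_sum \<tau> xs" "fst ` set xs \<subseteq> M" "y = tensor_sum \<tau> ys" "fst ` set ys \<subseteq> M"
    using assms unfolding tensor_image_def by auto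
  then show ?thesis unfolding tensor_image_def by (intro CollectI exI[of _ "xs @ ys"]) auto
qed

lemma tensor_image_induct [consumes 1, case_names zero pure add]:
  assumes "y \<in> tensor_image \<tau> M" and "P 0" and "\<And>m r. m \<in> M \<Longrightarrow> P (\<tau> m r)"
    and "\<And>x y. x \<in> tensor_image \<tau> M \<Longrightarrow> y \<in> tensor_image \<tau> M \<Longrightarrow> P x \<Longrightarrow> P y \<Longrightarrow> P (x + y)"
  shows "P y"
proof -
  obtain xs where xs: "y = tensor_sum \<tau> xs" "fst ` set xs \<subseteq> M" using assms(1) unfolding tensor_image_def by auto
  have "fst ` set xs \<subseteq> M \<Longrightarrow> tensor_sum \<tau> xs \<in> tensor_image \<tau> M \<and> P (tensor_sum \<tau> xs)" for xs
  proof (induction xs)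
    case Nil
    then show ?case using assms(2) tensor_image_zero by simp
  next
    case (Cons z xs)
    obtain m r where z: "z = (m, r)" by (cases z)
    then show ?case using Cons assms(3,4) tensor_image_pure[of m M \<tau> r] tensor_image_add by auto
  qed
  then show ?thesis using xs by blast
qed

lemma tensor_productD:
  assumes "tensor_product A sc \<alpha> M \<tau> N"
  shows "x \<in> M \<Longrightarrow> y \<in> M \<Longrightarrow> \<tau> (x + y) r = \<tau> x r + \<tau> y r"
    and "x \<in> M \<Longrightarrow> \<tau> x (r + s) = \<tau> x r + \<tau> x s"
    and "a \<in> A \<Longrightarrow> x \<in> M \<Longrightarrow> \<tau> (sc a x) r = \<tau> x (\<alpha> a * r)"
    and "tensor_image \<tau> M = N"
  using assms unfolding tensor_product_def by blast+

lemma tensor_product_kernel: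
  assumes tp: "tensor_product A sc \<alpha> M \<tau> N" and K: "additively_closed K" and \<beta>: "balanced_mod A sc \<alpha> M K \<beta>"
    and xs: "fst ` set xs \<subseteq> M" "tensor_sum \<tau> xs = 0"
  shows "tensor_sum \<beta> xs \<in> K"
proof -
  have "(\<Sum>z\<leftarrow>xs. frag_of z) \<in> tensor_relations A sc \<alpha> M"
    using tp xs unfolding tensor_product_def tensor_injective_def by blast
  then show ?thesis using eval_sum_tensor_relations[OF K \<beta>]
    by (force simp: eval_sum_sum_list tensor_sum_def)
qed

text \<open>\<open>g\<close> is computed from any expression as a sum of pure tensors. Two
  expressions differ by a list with sum zero; injectivity in \<open>tensor_product\<close> puts its
  formal sum among the tensor relations, on which \<open>\<beta>\<close> vanishes.\<close>

lemma tensor_product_lift: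
  assumes tp: "tensor_product A sc \<alpha> UNIV \<tau> UNIV" and \<beta>: "balanced_mod A sc \<alpha> UNIV {0} \<beta>"
  obtains g where "\<And>x y. g (x + y) = g x + g y" "\<And>m r. g (\<tau> m r) = \<beta> m r"
proof -
  have ex: "\<exists>xs. tensor_sum \<tau> xs = y" for y
  proof -
    have "y \<in> tensor_image \<tau> UNIV" using tensor_productD(4)[OF tp] by simp
    then show ?thesis by (auto simp: tensor_image_def)
  qed
  define g where "g = (\<lambda>y. tensor_sum \<beta> (SOME xs. tensor_sum \<tau> xs = y))"
  have zero: "tensor_sum \<beta> xs = 0" if "tensor_sum \<tau> xs = 0" for xs
    using tensor_product_kernel[OF tp _ \<beta>, of xs] that by (auto simp: additively_closed_def)
  have \<tau>0: "\<tau> m 0 = 0" for m using tensor_productD(2)[OF tp, of m 0 0] by simp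
  have \<beta>d: "\<beta> m (r + s) = \<beta> m r + \<beta> m s" for m r s
    using \<beta> unfolding balanced_mod_def by (simp add: diff_diff_eq)
  have \<beta>0: "\<beta> m 0 = 0" for m using \<beta>d[of m 0 0] by simp
  \<comment> \<open>Lists can be concatenated but not subtracted; a list is negated through its
    second components.\<close>
  have neg: "tensor_sum \<tau> (map (\<lambda>(m, r). (m, - r)) xs) = - tensor_sum \<tau> xs"
    "tensor_sum \<beta> (map (\<lambda>(m, r). (m, - r)) xs) = - tensor_sum \<beta> xs" for xs
  proof -
    have "\<tau> m (- r) = - \<tau> m r" "\<beta> m (- r) = - \<beta> m r" for m r
      using tensor_productD(2)[OF tp, of m r "- r"] \<beta>d[of m r "- r"] \<tau>0 \<beta>0
      by (auto simp: eq_neg_iff_add_eq_0 add.commute)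
    then show "tensor_sum \<tau> (map (\<lambda>(m, r). (m, - r)) xs) = - tensor_sum \<tau> xs"
      "tensor_sum \<beta> (map (\<lambda>(m, r). (m, - r)) xs) = - tensor_sum \<beta> xs"
      by (induction xs) auto
  qed
  have g: "g (tensor_sum \<tau> xs) = tensor_sum \<beta> xs" for xs
  proof -
    define ys where "ys = (SOME ys. tensor_sum \<tau> ys = tensor_sum \<tau> xs)"
    have "tensor_sum \<tau> ys = tensor_sum \<tau> xs" unfolding ys_def using ex by (rule someI_ex)
    then have "tensor_sum \<beta> (ys @ map (\<lambda>(m, r). (m, - r)) xs) = 0" by (intro zero) (simp add: neg)
    then show ?thesis by (simp add: neg g_def ys_def)
  qed
  show thesis
  proof
    fix x y obtain xs ys where "x = tensor_sum \<tau> xs" "y = tensor_sum \<tau> ys" using ex by metis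
    then show "g (x + y) = g x + g y" using g[of "xs @ ys"] by (simp add: g)
  next
    fix m r show "g (\<tau> m r) = \<beta> m r" using g[of "[(m, r)]"] by simp
  qed
qed

section \<open>A separability element of an unramified algebra\<close>

text \<open>Wrapping the multiplicative monoid of \<open>R\<close> additively makes the monoid ring
  \<open>\<int>[R \<times> R]\<close> available as a type of polynomial mappings; \<open>R \<otimes> R\<close> is its quotient by \<open>tensor_ideal\<close>.\<close>

typedef 'r additive_wrap = "UNIV :: 'r set" morphisms unwrap wrap ..

instantiation additive_wrap :: (comm_monoid_mult) comm_monoid_add
begin

definition "0 = wrap 1"
definition "x + y = wrap (unwrap x * unwrap y)"

instance
  by standard (auto simp: zero_additive_wrap_def plus_additive_wrap_def wrap_inverse unwrap_inverse mult.assoc,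
    simp add: mult.commute)

end

lemma unwrap_wrap [simp]: "unwrap (wrap x) = x" by (simp add: wrap_inverse)

lemma wrap_add: "wrap x + wrap y = wrap (x * y)" by (simp add: plus_additive_wrap_def)

definition pure :: "'r \<Rightarrow> 'r \<Rightarrow> ('r::comm_monoid_mult additive_wrap \<times> 'r additive_wrap) \<Rightarrow>\<^sub>0 int" where
  "pure x y = frag_of (wrap x, wrap y)"

lemma pure_mult: "pure x y * pure x' y' = pure (x * x') (y * y')"
  by (simp add: pure_def mult_single wrap_add)

lemma pure_one: "pure 1 1 = 1"
  by (simp add: pure_def zero_additive_wrap_def[symmetric] zero_prod_def[symmetric])

lemma pure_induct [case_names zero pure diff]:
  assumes "P 0" "\<And>x y. P (pure x y)" "\<And>a b. P a \<Longrightarrow> P b \<Longrightarrow> P (a - b)"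
  shows "P w"
proof (induction w rule: frag_induction[OF subset_UNIV])
  case (2 z)
  obtain x y where "z = (wrap x, wrap y)" by (metis surj_pair unwrap_inverse)
  then show ?case using assms(2) by (simp add: pure_def)
qed (use assms in auto)

definition eval_pure :: "('r \<Rightarrow> 'r \<Rightarrow> 'm) \<Rightarrow> (('r::comm_monoid_mult additive_wrap \<times> 'r additive_wrap) \<Rightarrow>\<^sub>0 int)
    \<Rightarrow> 'm::ab_group_add" where
  "eval_pure \<beta> = eval_sum (\<lambda>(x, y). \<beta> (unwrap x) (unwrap y))"

lemma eval_pure_simps [simp]:
  "eval_pure \<beta> 0 = 0" "eval_pure \<beta> (pure x y) = \<beta> x y" "eval_pure \<beta> (f - g) = eval_pure \<beta> f - eval_pure \<beta> g"
  by (auto simp: eval_pure_def pure_def eval_sum_diff)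

text \<open>With this, evaluation on \<open>e * (r \<otimes> 1 - 1 \<otimes> r)\<close> compares
  multiplication by \<open>r\<close> in the two arguments.\<close>

lemma eval_pure_shift: "eval_pure \<beta> (f * pure r s) = eval_pure (\<lambda>x y. \<beta> (x * r) (y * s)) f"
  by (induction f rule: pure_induct) (auto simp: pure_mult left_diff_distrib)

section \<open>The ideal of tensor relations in the monoid ring\<close>

definition tensor_ideal :: "'f set \<Rightarrow> ('f \<Rightarrow> 'r::{comm_ring,comm_monoid_mult})
    \<Rightarrow> (('r additive_wrap \<times> 'r additive_wrap) \<Rightarrow>\<^sub>0 int) set" where
  "tensor_ideal A \<alpha> = group_closure
     ({pure (x + y) r - pure x r - pure y r | x y r. True} \<union>
      {pure x (r + s) - pure x r - pure x s | x r s. True} \<union>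
      {pure (\<alpha> a * x) r - pure x (\<alpha> a * r) | a x r. a \<in> A})"

lemma eval_pure_tensor_ideal:
  assumes N: "additively_closed N" and \<beta>: "balanced_mod A (\<lambda>a x. \<alpha> a * x) \<alpha> UNIV N \<beta>"
    and f: "f \<in> tensor_ideal A \<alpha>"
  shows "eval_pure \<beta> f \<in> N"
  using f unfolding tensor_ideal_def
proof (induction f rule: group_closure.induct)
  case (base s)
  then show ?case using \<beta> additively_closedD(1)[OF N] by (auto simp: balanced_mod_def)
qed (auto simp: additively_closedD(2)[OF N])

definition ideal :: "'w::comm_ring_1 set \<Rightarrow> bool" where
  "ideal I \<longleftrightarrow> additively_closed I \<and> (\<forall>w. \<forall>x\<in>I. w * x \<in> I)"

text \<open>Multiplication by a pure tensor maps each of the three families of generators into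
  itself, and pure tensors generate the monoid ring additively. Thus \<open>R \<otimes> R\<close> is
  handled by congruences in a commutative ring.\<close>

lemma ideal_tensor_ideal: "ideal (tensor_ideal A \<alpha>)"
proof -
  have ac: "additively_closed (tensor_ideal A \<alpha>)"
    by (auto simp: additively_closed_def tensor_ideal_def group_closure.diff)
  have p: "pure a b * f \<in> tensor_ideal A \<alpha>" if "f \<in> tensor_ideal A \<alpha>" for a b f
    using that unfolding tensor_ideal_def
  proof (induction f rule: group_closure.induct)
    case (base s)
    show ?case
    proof (rule group_closure.base)
      let ?G1 = "{pure (x + y) r - pure x r - pure y r | x y r. True}"
      let ?G2 = "{pure x (r + s) - pure x r - pure x s | x r s. True}"
      let ?G3 = "{pure (\<alpha> a * x) r - pure x (\<alpha> a * r) | a x r. a \<in> A}"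
      from base consider "s = 0" | x y r where "s = pure (x + y) r - pure x r - pure y r"
        | x r t where "s = pure x (r + t) - pure x r - pure x t"
        | c x r where "c \<in> A" "s = pure (\<alpha> c * x) r - pure x (\<alpha> c * r)" by blast
      then show "pure a b * s \<in> insert 0 (?G1 \<union> ?G2 \<union> ?G3)"
      proof cases
        case 2
        then have "pure a b * s = pure (a * x + a * y) (b * r) - pure (a * x) (b * r) - pure (a * y) (b * r)"
          by (simp add: right_diff_distrib pure_mult distrib_left)
        then show ?thesis by blast
      next
        case 3
        then have "pure a b * s = pure (a * x) (b * r + b * t) - pure (a * x) (b * r) - pure (a * x) (b * t)"
          by (simp add: right_diff_distrib pure_mult distrib_left)
        then show ?thesis by blast
      next
        case 4
        then have "pure a b * s = pure (\<alpha> c * (a * x)) (b * r) - pure (a * x) (\<alpha> c * (b * r))"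
          by (simp add: right_diff_distrib pure_mult mult.left_commute)
        then show ?thesis using 4 by blast
      qed simp
    qed
  qed (simp add: right_diff_distrib group_closure.diff)
  have "w * f \<in> tensor_ideal A \<alpha>" if "f \<in> tensor_ideal A \<alpha>" for w f
    by (induction w rule: pure_induct)
      (use p that additively_closedD[OF ac] in \<open>auto simp: left_diff_distrib\<close>)
  then show ?thesis using ac by (auto simp: ideal_def)
qed

lemma idealD:
  assumes "ideal I"
  shows "additively_closed I" "0 \<in> I" "x \<in> I \<Longrightarrow> w * x \<in> I" "x \<in> I \<Longrightarrow> x * w \<in> I"
    "x \<in> I \<Longrightarrow> y \<in> I \<Longrightarrow> x - y \<in> I" "x \<in> I \<Longrightarrow> y \<in> I \<Longrightarrow> x + y \<in> I"
  using assms additively_closedD[of I] by (auto simp: ideal_def mult.commute[of x w])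

text \<open>For an ideal \<open>J\<close>, the ideal generated by \<open>J\<close> and the list, in
  a form that lets generators be eliminated by induction on the list.\<close>

fun ideal_span :: "'w::comm_ring_1 set \<Rightarrow> 'w list \<Rightarrow> 'w set" where
  "ideal_span J [] = J"
| "ideal_span J (d # ds) = {c * d + x | c x. x \<in> ideal_span J ds}"

lemma ideal_span_ConsI: "x = c * d + u \<Longrightarrow> u \<in> ideal_span J ds \<Longrightarrow> x \<in> ideal_span J (d # ds)"
  by auto

lemma ideal_span_ConsE:
  assumes "x \<in> ideal_span J (d # ds)"
  obtains c u where "x = c * d + u" "u \<in> ideal_span J ds"
proof -
  have "\<exists>c u. x = c * d + u \<and> u \<in> ideal_span J ds" using assms by simp
  then show thesis using that by blast
qed

lemma ideal_ideal_span: "ideal J \<Longrightarrow> ideal (ideal_span J ds)"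
proof (induction ds)
  case (Cons d ds)
  then have I: "ideal (ideal_span J ds)" by simp
  have "0 \<in> ideal_span J (d # ds)" by (rule ideal_span_ConsI[of _ 0 _ 0]) (simp_all add: idealD(2)[OF I])
  moreover have "x - y \<in> ideal_span J (d # ds)" if x: "x \<in> ideal_span J (d # ds)" and y: "y \<in> ideal_span J (d # ds)" for x y
  proof -
    obtain c u where cu: "x = c * d + u" "u \<in> ideal_span J ds" using x by (rule ideal_span_ConsE)
    obtain c' u' where "y = c' * d + u'" "u' \<in> ideal_span J ds" using y by (rule ideal_span_ConsE)
    with cu show ?thesis using idealD(5)[OF I, of u u']
      by (intro ideal_span_ConsI[of _ "c - c'" _ "u - u'"]) (simp_all add: algebra_simps)
  qed
  moreover have "w * x \<in> ideal_span J (d # ds)" if x: "x \<in> ideal_span J (d # ds)" for w x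
  proof -
    obtain c u where "x = c * d + u" "u \<in> ideal_span J ds" using x by (rule ideal_span_ConsE)
    then show ?thesis using idealD(3)[OF I, of u w]
      by (intro ideal_span_ConsI[of _ "w * c" _ "w * u"]) (simp_all add: algebra_simps)
  qed
  ultimately show ?case by (auto simp: ideal_def additively_closed_def)
qed simp

lemma ideal_span_superset: "ideal J \<Longrightarrow> J \<union> set ds \<subseteq> ideal_span J ds"
proof (induction ds)
  case (Cons d ds)
  have I: "ideal (ideal_span J ds)" using Cons by (simp add: ideal_ideal_span)
  have "x \<in> ideal_span J (d # ds)" if "x \<in> ideal_span J ds" for x
    by (rule ideal_span_ConsI[of _ 0 _ x]) (simp_all add: that)
  moreover have "d \<in> ideal_span J (d # ds)"
    by (rule ideal_span_ConsI[of _ 1 _ 0]) (simp_all add: idealD(2)[OF I])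
  ultimately show ?case using Cons by auto
qed simp

text \<open>As in Nakayama's lemma, with the generators of \<open>I\<close> eliminated one at a time.\<close>

lemma idempotent_ideal_annihilator:
  fixes I J :: "'w::comm_ring_1 set"
  assumes I: "ideal I" and J: "ideal J" "J \<subseteq> I"
    and sq: "I \<subseteq> group_closure ({m * k | m k. m \<in> I \<and> k \<in> I} \<union> J)"
  shows "set ds \<subseteq> I \<Longrightarrow> e - 1 \<in> I \<Longrightarrow> (\<And>x. x \<in> I \<Longrightarrow> e * x \<in> ideal_span J ds) \<Longrightarrow>
    \<exists>e. e - 1 \<in> I \<and> (\<forall>x\<in>I. e * x \<in> J)"
proof (induction ds arbitrary: e)
  case (Cons d ds)
  let ?K = "ideal_span J ds"
  have K: "ideal ?K" using J by (simp add: ideal_ideal_span)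
  have JK: "J \<subseteq> ?K" using ideal_span_superset[OF J(1)] by blast
  \<comment> \<open>Modulo the span of the remaining generators, \<open>e\<close> maps
    \<open>I\<close> to multiples of \<open>d\<close>, hence maps products of two elements of
    \<open>I\<close> to multiples of \<open>d\<close> with factor in \<open>I\<close>.\<close>
  have mu: "\<exists>\<mu>\<in>I. e * x - \<mu> * d \<in> ?K" if "x \<in> group_closure ({m * k | m k. m \<in> I \<and> k \<in> I} \<union> J)" for x
    using that
  proof (induction x rule: group_closure.induct)
    case (base s)
    then consider "s \<in> J" | m k where "s = m * k" "m \<in> I" "k \<in> I" using idealD(2)[OF J(1)] by blast
    then show ?case
    proof cases
      case 1
      then show ?thesis using idealD(3)[OF J(1)] JK idealD(2)[OF I] by (intro bexI[of _ 0]) auto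
    next
      case 2
      obtain c u where cu: "e * k = c * d + u" "u \<in> ?K" using Cons.prems(3)[OF 2(3)] by (rule ideal_span_ConsE)
      have "e * s - (m * c) * d = m * u" unfolding 2(1) by (simp only: mult.left_commute[of e m k] cu(1)) (simp add: algebra_simps)
      then show ?thesis using idealD(3)[OF K cu(2)] idealD(4)[OF I 2(2)] by metis
    qed
  next
    case (diff s t)
    then obtain \<mu> \<nu> where "\<mu> \<in> I" "\<nu> \<in> I" "e * s - \<mu> * d \<in> ?K" "e * t - \<nu> * d \<in> ?K" by blast
    moreover have "e * (s - t) - (\<mu> - \<nu>) * d = (e * s - \<mu> * d) - (e * t - \<nu> * d)" by (simp add: algebra_simps)
    ultimately show ?case using idealD(5)[OF I] idealD(5)[OF K] by metis
  qed
  obtain \<mu> where \<mu>: "\<mu> \<in> I" "e * d - \<mu> * d \<in> ?K" using mu[of d] sq Cons.prems(1) by auto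
  show ?case
  \<comment> \<open>The factor \<open>e\<close> brings \<open>I\<close> into the span of
    \<open>d\<close> and \<open>?K\<close>, and then \<open>e - \<mu>\<close> kills \<open>d\<close>
    modulo \<open>?K\<close>. Both factors are 1 modulo \<open>I\<close>.\<close>
  proof (rule Cons.IH[of "(e - \<mu>) * e"])
    have "(e - \<mu>) * e - 1 = (e + 1) * (e - 1) - \<mu> * e" by (simp add: algebra_simps)
    then show "(e - \<mu>) * e - 1 \<in> I"
      using idealD(5)[OF I idealD(3)[OF I Cons.prems(2)] idealD(4)[OF I \<mu>(1)]] by metis
    fix x assume "x \<in> I"
    then obtain c u where cu: "e * x = c * d + u" "u \<in> ?K" using Cons.prems(3) ideal_span_ConsE by metis
    have "(e - \<mu>) * e * x = c * (e * d - \<mu> * d) + (e - \<mu>) * u"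
      by (simp add: mult.assoc cu(1)) (simp add: algebra_simps)
    then show "(e - \<mu>) * e * x \<in> ?K" using idealD(3)[OF K] idealD(6)[OF K] \<mu>(2) cu(2) by metis
  qed (use Cons.prems in auto)
qed auto

text \<open>Let \<open>I\<close> be the ideal of \<open>R \<otimes> R\<close> generated by all
  \<open>x \<otimes> 1 - 1 \<otimes> x\<close>, the kernel of multiplication. The module of
  differentials is \<open>I / I^2\<close>, so being unramified means \<open>I = I^2\<close>. As
  \<open>I\<close> is finitely generated, the Nakayama argument yields \<open>e\<close> congruent to
  1 modulo \<open>I\<close> with \<open>e I = 0\<close>.\<close>

lemma separability_element:
  fixes \<alpha> :: "'f::field \<Rightarrow> 'r::{comm_ring,comm_monoid_mult}"
  assumes alg: "algebra_map A \<alpha>" and fp: "finitely_presented A \<alpha>" and un: "unramified_algebra A \<alpha>"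
  obtains e where "eval_pure (*) e = 1" "\<And>x. e * (pure x 1 - pure 1 x) \<in> tensor_ideal A \<alpha>"
proof -
  define J where "J = tensor_ideal A \<alpha>"
  have J: "ideal J" unfolding J_def by (rule ideal_tensor_ideal)
  define \<delta> where "\<delta> = (\<lambda>x :: 'r. pure x 1 - pure 1 x)"
  have Jl: "pure (x + y) r - pure x r - pure y r \<in> J" for x y r
    unfolding J_def tensor_ideal_def by (rule group_closure.base) blast
  have Jr: "pure x (r + s) - pure x r - pure x s \<in> J" for x r s
    unfolding J_def tensor_ideal_def by (rule group_closure.base) blast
  have Jb: "a \<in> A \<Longrightarrow> pure (\<alpha> a * x) r - pure x (\<alpha> a * r) \<in> J" for a x r
    unfolding J_def tensor_ideal_def by (rule group_closure.base) blast
  note Jac = additively_closedD[OF idealD(1)[OF J]]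
  have \<delta>_add: "\<delta> (x + y) - \<delta> x - \<delta> y \<in> J" for x y
  proof -
    have "\<delta> (x + y) - \<delta> x - \<delta> y = (pure (x + y) 1 - pure x 1 - pure y 1) - (pure 1 (x + y) - pure 1 x - pure 1 y)"
      by (simp add: \<delta>_def algebra_simps)
    then show ?thesis using Jac(2)[OF Jl Jr] by metis
  qed
  have \<delta>_mult: "\<delta> (x * y) = pure x 1 * \<delta> y + pure 1 y * \<delta> x" for x y
    by (simp add: \<delta>_def right_diff_distrib pure_mult mult.commute)
  have \<delta>_\<alpha>: "a \<in> A \<Longrightarrow> \<delta> (\<alpha> a) \<in> J" for a
    using Jb[of a 1 1] by (simp add: \<delta>_def)
  obtain n and x :: "nat \<Rightarrow> 'r" where gen: "\<And>r. \<exists>P\<in>mpolys A n. mpoly_eval \<alpha> x P = r"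
    using fp unfolding finitely_presented_def by blast
  \<comment> \<open>Algebra generators suffice: by the sum and product rules,
    \<open>\<delta>\<close> of every polynomial expression in the \<open>x i\<close> lies in the
    ideal generated by these finitely many elements.\<close>
  define ds where "ds = map (\<lambda>i. \<delta> (x i)) [0..<n]"
  define I where "I = ideal_span J ds"
  have I: "ideal I" unfolding I_def by (rule ideal_ideal_span[OF J])
  have JI: "J \<subseteq> I" and dsI: "set ds \<subseteq> I" using ideal_span_superset[OF J, of ds] unfolding I_def by auto
  note Iac = additively_closedD[OF idealD(1)[OF I]]
  have I_mult: "\<delta> (u * v) \<in> I" if "\<delta> u \<in> I" "\<delta> v \<in> I" for u v
    unfolding \<delta>_mult using that by (intro idealD(6)[OF I] idealD(3)[OF I])
  have I_add: "\<delta> (u + v) \<in> I" if "\<delta> u \<in> I" "\<delta> v \<in> I" for u v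
  proof -
    have "\<delta> (u + v) = (\<delta> (u + v) - \<delta> u - \<delta> v) + (\<delta> u + \<delta> v)" by simp
    then show ?thesis using \<delta>_add JI that Iac(4) by (metis subsetD)
  qed
  have I_one: "\<delta> 1 \<in> I" using idealD(2)[OF I] by (simp add: \<delta>_def)
  have I_zero: "\<delta> 0 \<in> I" using \<delta>_add[of 0 0] Jac(3)[of "- \<delta> 0"] JI by auto
  have I_pow: "\<delta> (u ^ k) \<in> I" if "\<delta> u \<in> I" for u k
    by (induction k) (use that I_mult I_one in auto)
  have I_prod: "\<delta> (\<Prod>i\<in>S. f i) \<in> I" if "\<And>i. i \<in> S \<Longrightarrow> \<delta> (f i) \<in> I" for S :: "nat set" and f
    using that by (induction S rule: infinite_finite_induct) (auto intro: I_mult I_one)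
  have I_sum: "\<delta> (\<Sum>i\<in>S. f i) \<in> I" if "\<And>i. i \<in> S \<Longrightarrow> \<delta> (f i) \<in> I" for S :: "(nat \<Rightarrow>\<^sub>0 nat) set" and f
    using that by (induction S rule: infinite_finite_induct) (auto intro: I_add I_zero)
  have \<delta>I: "\<delta> r \<in> I" for r
  proof -
    obtain P where P: "P \<in> mpolys A n" "mpoly_eval \<alpha> x P = r" using gen by blast
    have "\<delta> (mpoly_eval \<alpha> x P) \<in> I" unfolding mpoly_eval_def
    proof (intro I_sum I_mult I_prod I_pow)
      fix m assume m: "m \<in> Poly_Mapping.keys P"
      show "\<delta> (\<alpha> (poly_mapping.lookup P m)) \<in> I"
        using P(1) \<delta>_\<alpha> JI unfolding mpolys_def by blast
      fix i assume "i \<in> Poly_Mapping.keys m"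
      then have "i < n" using P(1) m unfolding mpolys_def by blast
      then show "\<delta> (x i) \<in> I" using dsI unfolding ds_def by auto
    qed
    then show ?thesis using P(2) by simp
  qed
  define I2 where "I2 = group_closure ({m * k | m k. m \<in> I \<and> k \<in> I} \<union> J)"
  have I2ac: "additively_closed I2"
    by (auto simp: additively_closed_def I2_def group_closure.diff)
  have I2: "ideal I2"
  proof -
    have "w * f \<in> I2" if "f \<in> I2" for w f
      using that unfolding I2_def
    proof (induction f rule: group_closure.induct)
      case (base s)
      then consider "s \<in> J" | m k where "s = m * k" "m \<in> I" "k \<in> I" using idealD(2)[OF J] by blast
      then show ?case
      proof cases
        case 1
        then have "w * s \<in> J" by (rule idealD(3)[OF J])
        then show ?thesis by (intro group_closure.base) blast
      next
        case 2
        then have "w * s = (w * m) * k" "w * m \<in> I" using idealD(3)[OF I] by (auto simp: mult.assoc)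
        then show ?thesis using 2 by (intro group_closure.base) blast
      qed
    qed (simp add: right_diff_distrib group_closure.diff)
    then show ?thesis using I2ac by (auto simp: ideal_def)
  qed
  have JI2: "J \<subseteq> I2" unfolding I2_def by (auto intro: group_closure.base)
  have II2: "m \<in> I \<Longrightarrow> k \<in> I \<Longrightarrow> m * k \<in> I2" for m k
    unfolding I2_def by (auto intro: group_closure.base)
  note I2c = additively_closedD[OF I2ac]
  \<comment> \<open>The map \<open>c dx \<mapsto> (c \<otimes> 1)(x \<otimes> 1 - 1 \<otimes>
    x)\<close>. It is additive only modulo \<open>J\<close>, because pure tensors are independent in
    the monoid ring. The aim is that it sends the relations between differentials into
    \<open>I2\<close>, which is \<open>I^2 + J\<close>.\<close>
  define \<Phi> where "\<Phi> = (\<lambda>f :: 'r \<Rightarrow>\<^sub>0 'r. \<Sum>x\<in>Poly_Mapping.keys f. pure (Poly_Mapping.lookup f x) 1 * \<delta> x)"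
  have p0: "pure 0 1 \<in> J"
    using Jl[of 0 0 1] Jac(3)[of "- pure 0 1"] by simp
  have \<Phi>_sup: "\<Phi> f - (\<Sum>x\<in>S. pure (Poly_Mapping.lookup f x) 1 * \<delta> x) \<in> J"
    if "finite S" "Poly_Mapping.keys f \<subseteq> S" for f S
  proof -
    have "(\<Sum>x\<in>S. pure (Poly_Mapping.lookup f x) 1 * \<delta> x)
       = \<Phi> f + (\<Sum>x\<in>S - Poly_Mapping.keys f. pure (Poly_Mapping.lookup f x) 1 * \<delta> x)"
      unfolding \<Phi>_def using sum.subset_diff[OF that(2,1)] by (simp add: add.commute)
    moreover have "(\<Sum>x\<in>S - Poly_Mapping.keys f. pure (Poly_Mapping.lookup f x) 1 * \<delta> x) \<in> J"
      by (intro additively_closed_sum[OF idealD(1)[OF J]])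
        (auto simp: in_keys_iff intro!: idealD(4)[OF J] p0)
    ultimately show ?thesis using Jac(3) by simp
  qed
  have \<Phi>_diff: "\<Phi> (f - g) - (\<Phi> f - \<Phi> g) \<in> J" for f g
  proof -
    let ?S = "Poly_Mapping.keys f \<union> Poly_Mapping.keys g"
    let ?s = "\<lambda>h. \<Sum>x\<in>?S. pure (Poly_Mapping.lookup h x) 1 * \<delta> x"
    have a: "\<Phi> f - ?s f \<in> J" "\<Phi> g - ?s g \<in> J" "\<Phi> (f - g) - ?s (f - g) \<in> J"
      using keys_diff[of f g] by (auto intro!: \<Phi>_sup)
    have "?s f - (?s (f - g) + ?s g)
      = (\<Sum>x\<in>?S. (pure (Poly_Mapping.lookup f x) 1 - pure (Poly_Mapping.lookup (f - g) x) 1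
          - pure (Poly_Mapping.lookup g x) 1) * \<delta> x)"
      by (simp add: sum_subtractf sum.distrib[symmetric] left_diff_distrib algebra_simps)
    also have "\<dots> \<in> J"
    proof (intro additively_closed_sum[OF idealD(1)[OF J]] idealD(4)[OF J])
      fix x show "pure (Poly_Mapping.lookup f x) 1 - pure (Poly_Mapping.lookup (f - g) x) 1
          - pure (Poly_Mapping.lookup g x) 1 \<in> J"
        using Jl[of "Poly_Mapping.lookup (f - g) x" "Poly_Mapping.lookup g x" 1] by (simp add: lookup_minus)
    qed
    finally have b: "?s f - (?s (f - g) + ?s g) \<in> J" .
    have "p - (u - v) = ((p - p') - (u - u')) + ((v - v') - (u' - (p' + v')))"
      for p u v p' u' v' :: "('r additive_wrap \<times> 'r additive_wrap) \<Rightarrow>\<^sub>0 int"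
      by simp
    then show ?thesis
      using Jac(4)[OF Jac(2)[OF a(3) a(1)] Jac(2)[OF a(2) b]] by metis
  qed
  have \<Phi>_single: "\<Phi> (Poly_Mapping.single x c) - pure c 1 * \<delta> x \<in> J" for x c
    using \<Phi>_sup[of "{x}" "Poly_Mapping.single x c"] by (simp split: if_splits)
  have \<Phi>_eq: "\<Phi> f \<in> I2" if "f \<in> kaehler_relations A \<alpha>" for f
    using that unfolding kaehler_relations_def
  proof (induction f rule: group_closure.induct)
    case (diff s t)
    have "\<Phi> (s - t) = (\<Phi> (s - t) - (\<Phi> s - \<Phi> t)) + (\<Phi> s - \<Phi> t)" by simp
    then show ?case using \<Phi>_diff JI2 diff.IH I2c(2,4) by (metis subsetD)
  next
    case (base s)
    let ?S = "Poly_Mapping.single :: 'r \<Rightarrow> 'r \<Rightarrow> ('r \<Rightarrow>\<^sub>0 'r)"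
    have s1: "\<Phi> (?S x c) - pure c 1 * \<delta> x \<in> I2" for x c using \<Phi>_single JI2 by blast
    have s3: "\<Phi> (?S x c - ?S y c' - ?S z c'') \<in> I2"
      if "pure c 1 * \<delta> x - pure c' 1 * \<delta> y - pure c'' 1 * \<delta> z \<in> I2" for x y z c c' c''
    proof -
      have "\<Phi> (?S x c - ?S y c' - ?S z c'') - (\<Phi> (?S x c - ?S y c') - \<Phi> (?S z c'')) \<in> I2"
        "\<Phi> (?S x c - ?S y c') - (\<Phi> (?S x c) - \<Phi> (?S y c')) \<in> I2" using \<Phi>_diff JI2 by blast+
      note m = I2c(4)[OF I2c(4)[OF I2c(4)[OF this] I2c(2)[OF I2c(2)[OF s1[of x c] s1[of y c']] s1[of z c'']]] that]
      have "(p - (q - r)) + (q - (t - u)) + ((t - t') - (u - u') - (r - r')) + (t' - u' - r') = p"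
        for p q r t u t' u' r' :: "('r additive_wrap \<times> 'r additive_wrap) \<Rightarrow>\<^sub>0 int"
        by simp
      then show ?thesis using m by metis
    qed
    from base consider "s = 0" | a c where "a \<in> A" "s = ?S (\<alpha> a) c"
      | x y c where "s = ?S (x + y) c - ?S x c - ?S y c"
      | x y c where "s = ?S (x * y) c - ?S y (c * x) - ?S x (c * y)" by blast
    then show ?case
    proof cases
      case 1
      then show ?thesis using I2c(1) by (simp add: \<Phi>_def)
    next
      case 2
      have "pure c 1 * \<delta> (\<alpha> a) \<in> I2" using \<delta>_\<alpha>[OF 2(1)] JI2 idealD(3)[OF I2] by blast
      then show ?thesis using s1[of "\<alpha> a" c] I2c(4) 2(2) by (metis diff_add_cancel)
    next
      case 3
      have "pure c 1 * (\<delta> (x + y) - \<delta> x - \<delta> y) \<in> I2" using \<delta>_add JI2 idealD(3)[OF I2] by blast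
      then show ?thesis unfolding 3 by (intro s3) (simp add: right_diff_distrib)
    next
      case 4
      \<comment> \<open>The Leibniz rule holds up to a product of two elements of \<open>I\<close>;
        this is why the target is \<open>I2\<close> and not \<open>J\<close>.\<close>
      have "pure c 1 * \<delta> (x * y) - pure (c * x) 1 * \<delta> y - pure (c * y) 1 * \<delta> x = - (pure c 1 * (\<delta> x * \<delta> y))"
        by (simp add: \<delta>_def algebra_simps pure_mult)
      moreover have "- (pure c 1 * (\<delta> x * \<delta> y)) \<in> I2" using II2[OF \<delta>I \<delta>I] idealD(3)[OF I2] I2c(3) by blast
      ultimately show ?thesis unfolding 4 by (intro s3) simp
    qed
  qed
  have \<delta>I2: "\<delta> r \<in> I2" for r
  proof -
    have "\<Phi> (Poly_Mapping.single r 1) \<in> I2" using un \<Phi>_eq unfolding unramified_algebra_def by blast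
    moreover have "\<Phi> (Poly_Mapping.single r 1) - \<delta> r \<in> I2"
      using \<Phi>_single[of r 1] JI2 by (auto simp: pure_one)
    ultimately have "\<Phi> (Poly_Mapping.single r 1) - (\<Phi> (Poly_Mapping.single r 1) - \<delta> r) \<in> I2"
      by (rule I2c(2))
    then show ?thesis by (simp only: diff_diff_eq2 add_diff_cancel_left')
  qed
  have "ideal_span J ds' \<subseteq> I2" if "set ds' \<subseteq> I2" for ds'
    using that by (induction ds') (use JI2 idealD(3,6)[OF I2] in auto)
  moreover have "set ds \<subseteq> I2" unfolding ds_def using \<delta>I2 by auto
  ultimately have sq: "I \<subseteq> I2" unfolding I_def by blast
  have "\<exists>e. e - 1 \<in> I \<and> (\<forall>x\<in>I. e * x \<in> J)"
    by (rule idempotent_ideal_annihilator[OF I J JI sq[unfolded I2_def] dsI, of 1])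
      (use idealD(2)[OF I] in \<open>auto simp: I_def\<close>)
  then obtain e where e: "e - 1 \<in> I" "\<And>x. x \<in> I \<Longrightarrow> e * x \<in> J" by blast
  have bal: "balanced_mod A (\<lambda>a x. \<alpha> a * x) \<alpha> UNIV {0} (*)"
    by (auto simp: balanced_mod_def algebra_simps)
  have JK: "eval_pure (*) f = 0" if "f \<in> J" for f
    using eval_pure_tensor_ideal[OF _ bal] that unfolding J_def by (auto simp: additively_closed_def)
  have \<delta>K: "eval_pure (*) (c * \<delta> r) = 0" for c r
    by (simp add: \<delta>_def right_diff_distrib eval_pure_shift mult.left_commute mult.assoc) (simp add: mult.commute mult.left_commute)
  have eval_add: "eval_pure (*) (f + g) = eval_pure (*) f + eval_pure (*) g"
    for f g :: "('r additive_wrap \<times> 'r additive_wrap) \<Rightarrow>\<^sub>0 int"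
    by (simp add: eval_pure_def eval_sum_add)
  have "eval_pure (*) f = 0" if "f \<in> ideal_span J (map (\<lambda>i. \<delta> (x i)) is)" for f "is"
    using that by (induction "is" arbitrary: f) (auto simp: JK eval_add \<delta>K)
  then have "eval_pure (*) (e - 1) = 0" using e(1) unfolding I_def ds_def by blast
  then have "eval_pure (*) e = 1" using eval_pure_simps(2)[of "(*)" 1 1] by (simp add: pure_one)
  then show thesis using that e(2)[OF \<delta>I] unfolding \<delta>_def J_def by blast
qed

section \<open>Reducedness of unramified algebras\<close>

definition stable :: "('m \<Rightarrow> 'm) set \<Rightarrow> 'm set \<Rightarrow> bool" where
  "stable \<Lambda> S \<longleftrightarrow> (\<forall>f\<in>\<Lambda>. \<forall>x\<in>S. f x \<in> S)"

text \<open>Modulo \<open>N\<close>, the operators \<open>\<Lambda>\<close> act through a field.\<close>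

lemma complement_exists:
  fixes \<Lambda> :: "('m::ab_group_add \<Rightarrow> 'm) set"
  assumes N: "additively_closed N" "stable \<Lambda> N" and W: "additively_closed W" "stable \<Lambda> W"
    and add: "\<And>f x y. f \<in> \<Lambda> \<Longrightarrow> f (x - y) = f x - f y"
    and id: "id \<in> \<Lambda>" and comp: "\<And>f g. f \<in> \<Lambda> \<Longrightarrow> g \<in> \<Lambda> \<Longrightarrow> f \<circ> g \<in> \<Lambda>"
    and diff: "\<And>f g. f \<in> \<Lambda> \<Longrightarrow> g \<in> \<Lambda> \<Longrightarrow> (\<lambda>x. f x - g x) \<in> \<Lambda>"
    and inv: "\<And>f. f \<in> \<Lambda> \<Longrightarrow> (\<forall>x. f x \<in> N) \<or> (\<exists>g\<in>\<Lambda>. \<forall>x. g (f x) - x \<in> N)"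
  obtains C where "additively_closed C" "stable \<Lambda> C" "C \<inter> W \<subseteq> N" "\<And>x. \<exists>w\<in>W. x - w \<in> C"
proof -
  \<comment> \<open>A maximal stable subgroup that contains \<open>N\<close> and meets
    \<open>W\<close> inside \<open>N\<close> is a complement of \<open>W\<close> modulo
    \<open>N\<close>, as in linear algebra over a field.\<close>
  define \<S> where "\<S> = {C. additively_closed C \<and> stable \<Lambda> C \<and> N \<subseteq> C \<and> C \<inter> W \<subseteq> N}"
  have "\<exists>M\<in>\<S>. \<forall>X\<in>\<S>. M \<subseteq> X \<longrightarrow> X = M"
  proof (rule subset_Zorn_nonempty)
    show "\<S> \<noteq> {}" using N unfolding \<S>_def by blast
    fix \<C> assume c: "\<C> \<noteq> {}" "subset.chain \<S> \<C>"
    then have sub: "\<C> \<subseteq> \<S>" by (simp add: subset_chain_def)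
    have "x - y \<in> \<Union>\<C>" if "x \<in> \<Union>\<C>" "y \<in> \<Union>\<C>" for x y
    proof -
      from that obtain X Y where "X \<in> \<C>" "Y \<in> \<C>" "x \<in> X" "y \<in> Y" by blast
      then obtain Z where "Z \<in> \<C>" "x \<in> Z" "y \<in> Z" using c(2) unfolding subset_chain_def by blast
      moreover have "additively_closed Z" using \<open>Z \<in> \<C>\<close> sub unfolding \<S>_def by blast
      ultimately show ?thesis using additively_closedD(2) by blast
    qed
    moreover have "0 \<in> \<Union>\<C>" using c(1) sub additively_closedD(1) unfolding \<S>_def by blast
    ultimately have "additively_closed (\<Union>\<C>)" by (simp add: additively_closed_def)
    moreover have "stable \<Lambda> (\<Union>\<C>)" using sub unfolding \<S>_def stable_def by blast
    ultimately show "\<Union>\<C> \<in> \<S>" using c(1) sub unfolding \<S>_def by blast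
  qed
  then obtain C where CS: "C \<in> \<S>" and max: "\<And>X. X \<in> \<S> \<Longrightarrow> C \<subseteq> X \<Longrightarrow> X = C" by blast
  from CS have C: "additively_closed C" "stable \<Lambda> C" "N \<subseteq> C" "C \<inter> W \<subseteq> N"
    by (simp_all add: \<S>_def)
  have "\<exists>w\<in>W. x - w \<in> C" for x
  proof (cases "x \<in> C")
    case True
    then show ?thesis using additively_closedD(1)[OF W(1)] by (intro bexI[of _ 0]) auto
  next
    case False
    define C' where "C' = {c + f x | c f. c \<in> C \<and> f \<in> \<Lambda>}"
    have CC': "C \<subseteq> C'"
    proof
      fix c assume "c \<in> C"
      moreover have "(\<lambda>x. id x - id x) \<in> \<Lambda>" by (rule diff[OF id id])
      ultimately show "c \<in> C'" unfolding C'_def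
        by (intro CollectI exI[of _ c] exI[of _ "\<lambda>x. id x - id x"]) auto
    qed
    have "x \<in> C'" unfolding C'_def
      using id additively_closedD(1)[OF C(1)] by (intro CollectI exI[of _ 0] exI[of _ id]) auto
    then have "C' \<notin> \<S>" using False max[OF _ CC'] by blast
    moreover have "additively_closed C'"
    proof -
      have "u - v \<in> C'" if uv: "u \<in> C'" "v \<in> C'" for u v
      proof -
        obtain c f c' f' where "u = c + f x" "v = c' + f' x" "c \<in> C" "c' \<in> C" "f \<in> \<Lambda>" "f' \<in> \<Lambda>"
          using uv unfolding C'_def by blast
        then show ?thesis unfolding C'_def
          using diff[of f f'] additively_closedD(2)[OF C(1), of c c']
          by (intro CollectI exI[of _ "c - c'"] exI[of _ "\<lambda>x. f x - f' x"]) auto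
      qed
      then show ?thesis using CC' additively_closedD(1)[OF C(1)] by (auto simp: additively_closed_def)
    qed
    moreover have "stable \<Lambda> C'"
      unfolding stable_def
    proof (intro ballI)
      fix g u assume g: "g \<in> \<Lambda>" and "u \<in> C'"
      then obtain c f where u: "u = c + f x" "c \<in> C" "f \<in> \<Lambda>" unfolding C'_def by blast
      have "g (c + f x) = g c + g (f x)"
        using add[OF g, of "c + f x" "f x"] by (simp add: eq_diff_eq)
      then show "g u \<in> C'" unfolding C'_def
        using u g comp[OF g u(3)] C(2) unfolding stable_def
        by (intro CollectI exI[of _ "g c"] exI[of _ "g \<circ> f"]) auto
    qed
    ultimately obtain y where y: "y \<in> C'" "y \<in> W" "y \<notin> N" using CC' C(3) unfolding \<S>_def by blast
    then obtain c f where cf: "y = c + f x" "c \<in> C" "f \<in> \<Lambda>" unfolding C'_def by blast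
    have "\<not> (\<forall>x. f x \<in> N)"
    proof
      assume "\<forall>x. f x \<in> N"
      then have "y \<in> C" using cf C(3) additively_closedD(4)[OF C(1)] by blast
      then show False using y C(4) by blast
    qed
    \<comment> \<open>Solve \<open>y = c + f x\<close> for \<open>x\<close>: up to an element of
      \<open>C\<close>, \<open>x\<close> equals \<open>g y\<close>, which lies in
      \<open>W\<close>.\<close>
    then obtain g where g: "g \<in> \<Lambda>" "g (f x) - x \<in> N" using inv[OF cf(3)] by blast
    have "g (c + f x) = g c + g (f x)"
      using add[OF g(1), of "c + f x" "f x"] by (simp add: eq_diff_eq)
    then have "x - g y = - (g c + (g (f x) - x))" using cf(1) by simp
    moreover have "g c + (g (f x) - x) \<in> C"
      using g C(2,3) cf(2) unfolding stable_def by (intro additively_closedD(4)[OF C(1)]) auto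
    ultimately have "x - g y \<in> C" using additively_closedD(3)[OF C(1)] by metis
    moreover have "g y \<in> W" using W(2) g(1) y(2) unfolding stable_def by blast
    ultimately show ?thesis by blast
  qed
  then show thesis using that C by blast
qed

text \<open>Averaging a \<open>\<Lambda>\<close>-linear projection over the separability element makes it \<open>R\<close>-linear, as in
  Maschke's theorem.\<close>

lemma averaged_projection:
  fixes \<Lambda> :: "('m::ab_group_add \<Rightarrow> 'm) set" and \<alpha> :: "'f::field \<Rightarrow> 'r::{comm_ring,comm_monoid_mult}"
    and act :: "'r \<Rightarrow> 'm \<Rightarrow> 'm"
  assumes e: "eval_pure (*) e = 1" "\<And>x. e * (pure x 1 - pure 1 x) \<in> tensor_ideal A \<alpha>"
    and N: "additively_closed N" "stable \<Lambda> N" and W: "additively_closed W" "stable \<Lambda> W"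
    and add: "\<And>f x y. f \<in> \<Lambda> \<Longrightarrow> f (x - y) = f x - f y"
    and id: "id \<in> \<Lambda>" and comp: "\<And>f g. f \<in> \<Lambda> \<Longrightarrow> g \<in> \<Lambda> \<Longrightarrow> f \<circ> g \<in> \<Lambda>"
    and diff: "\<And>f g. f \<in> \<Lambda> \<Longrightarrow> g \<in> \<Lambda> \<Longrightarrow> (\<lambda>x. f x - g x) \<in> \<Lambda>"
    and inv: "\<And>f. f \<in> \<Lambda> \<Longrightarrow> (\<forall>x. f x \<in> N) \<or> (\<exists>g\<in>\<Lambda>. \<forall>x. g (f x) - x \<in> N)"
    and act_add: "\<And>r x y. act r (x + y) = act r x + act r y" "\<And>r s x. act (r + s) x = act r x + act s x"
    and act_mult: "\<And>r s x. act (r * s) x = act r (act s x)" "\<And>x. act 1 x = x"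
    and act_\<Lambda>: "\<And>a. a \<in> A \<Longrightarrow> act (\<alpha> a) \<in> \<Lambda>" "\<And>f r x. f \<in> \<Lambda> \<Longrightarrow> f (act r x) = act r (f x)"
    and act_N: "\<And>r x. x \<in> N \<Longrightarrow> act r x \<in> N" and act_W: "\<And>r x. x \<in> W \<Longrightarrow> act r x \<in> W"
  obtains \<Xi> where "\<And>x. \<Xi> x \<in> W" "\<And>x. x \<in> W \<Longrightarrow> \<Xi> x - x \<in> N" "\<And>x y. \<Xi> (x + y) - \<Xi> x - \<Xi> y \<in> N"
    "\<And>r x. \<Xi> (act r x) - act r (\<Xi> x) \<in> N" "\<And>f x. f \<in> \<Lambda> \<Longrightarrow> \<Xi> (f x) - f (\<Xi> x) \<in> N"
proof -
  obtain C where C: "additively_closed C" "stable \<Lambda> C" "C \<inter> W \<subseteq> N" "\<And>x. \<exists>w\<in>W. x - w \<in> C"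
    using complement_exists[OF N W add id comp diff inv] by blast
  note Cc = additively_closedD[OF C(1)] and Wc = additively_closedD[OF W(1)] and Nc = additively_closedD[OF N(1)]
  \<comment> \<open>\<open>\<xi>\<close> is an arbitrary choice of the component in
    \<open>W\<close>. Two choices differ by an element of \<open>C \<inter> W\<close>, hence of
    \<open>N\<close>, so additivity and \<open>\<Lambda>\<close>-linearity hold modulo
    \<open>N\<close>.\<close>
  obtain \<xi> where \<xi>: "\<And>x. \<xi> x \<in> W" "\<And>x. x - \<xi> x \<in> C" using C(4) by metis
  have in_N: "u \<in> W \<Longrightarrow> u \<in> C \<Longrightarrow> u \<in> N" for u using C(3) by blast
  have \<xi>W: "\<xi> x - x \<in> N" if "x \<in> W" for x
    using Cc(3)[OF \<xi>(2)[of x]] Wc(2)[OF \<xi>(1) that] by (intro in_N) simp_all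
  have \<xi>add: "\<xi> (x + y) - \<xi> x - \<xi> y \<in> N" for x y
  proof (rule in_N)
    show "\<xi> (x + y) - \<xi> x - \<xi> y \<in> W" by (intro Wc(2) \<xi>(1))
    have "(x - \<xi> x) + (y - \<xi> y) - ((x + y) - \<xi> (x + y)) \<in> C" using Cc(2)[OF Cc(4)[OF \<xi>(2) \<xi>(2)] \<xi>(2)] .
    then show "\<xi> (x + y) - \<xi> x - \<xi> y \<in> C" by (simp add: algebra_simps)
  qed
  have \<xi>\<Lambda>: "\<xi> (f x) - f (\<xi> x) \<in> N" if f: "f \<in> \<Lambda>" for f x
  proof (rule in_N)
    show "\<xi> (f x) - f (\<xi> x) \<in> W" using W(2) f \<xi>(1) unfolding stable_def by (intro Wc(2)) auto
    have "f (x - \<xi> x) \<in> C" using C(2) f \<xi>(2) unfolding stable_def by blast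
    then have "(f x - f (\<xi> x)) - (f x - \<xi> (f x)) \<in> C" using Cc(2)[OF _ \<xi>(2)] add[OF f] by metis
    then show "\<xi> (f x) - f (\<xi> x) \<in> C" by simp
  qed
  have actd: "act r (x - y) = act r x - act r y" for r x y
    using act_add(1)[of r "x - y" y] by (simp add: eq_diff_eq)
  have actd': "act (r - s) x = act r x - act s x" for r s x
    using act_add(2)[of "r - s" s x] by (simp add: eq_diff_eq)
  \<comment> \<open>If \<open>e\<close> is a sum of tensors \<open>a \<otimes> b\<close>, the
    averaged map \<open>\<Xi>\<close> sends \<open>x\<close> to the sum of the
    \<open>a \<xi>(b x)\<close>. It is still the identity on \<open>W\<close> modulo
    \<open>N\<close> because the products \<open>a b\<close> add up to 1.\<close>
  define \<beta> where "\<beta> = (\<lambda>x a b. act a (\<xi> (act b x)))"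
  define \<Xi> where "\<Xi> = (\<lambda>x. eval_pure (\<beta> x) e)"
  have ep_in: "eval_pure \<gamma> f \<in> S" if "additively_closed S" "\<And>a b. \<gamma> a b \<in> S" for \<gamma> f and S :: "'m set"
    unfolding eval_pure_def by (rule eval_sum_in) (use that in auto)
  have ep_diff: "eval_pure \<gamma> f - eval_pure \<delta> f = eval_pure (\<lambda>a b. \<gamma> a b - \<delta> a b) f"
    for \<gamma> \<delta> :: "'r \<Rightarrow> 'r \<Rightarrow> 'm" and f
    unfolding eval_pure_def eval_sum_minus[symmetric] by (simp add: case_prod_unfold)
  have ep_comp: "eval_pure (\<lambda>a b. g (\<gamma> a b)) f = g (eval_pure \<gamma> f)"
    if "\<And>x y. g (x - y) = g x - g y" for g :: "'n::ab_group_add \<Rightarrow> 'm" and \<gamma> :: "'r \<Rightarrow> 'r \<Rightarrow> 'n" and f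
    using eval_sum_compose[of g "\<lambda>(x, y). \<gamma> (unwrap x) (unwrap y)" f] that
    unfolding eval_pure_def by (simp add: case_prod_unfold)
  have bal: "balanced_mod A (\<lambda>a x. \<alpha> a * x) \<alpha> UNIV N (\<beta> x)" for x
    unfolding balanced_mod_def
  proof (intro conjI ballI allI)
    fix a b r show "\<beta> x (a + b) r - \<beta> x a r - \<beta> x b r \<in> N" by (simp add: \<beta>_def act_add Nc(1))
  next
    fix a r s
    have "\<beta> x a (r + s) - \<beta> x a r - \<beta> x a s = act a (\<xi> (act r x + act s x) - \<xi> (act r x) - \<xi> (act s x))"
      by (simp add: \<beta>_def act_add actd)
    then show "\<beta> x a (r + s) - \<beta> x a r - \<beta> x a s \<in> N" using act_N[OF \<xi>add] by metis
  next
    fix c a r assume c: "c \<in> A"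
    have "act (\<alpha> c * a) y = act a (act (\<alpha> c) y)" for y by (simp only: act_mult(1) mult.commute[of "\<alpha> c" a])
    then have "\<beta> x (\<alpha> c * a) r - \<beta> x a (\<alpha> c * r) = - act a (\<xi> (act (\<alpha> c) (act r x)) - act (\<alpha> c) (\<xi> (act r x)))"
      by (simp add: \<beta>_def actd act_mult(1))
    then show "\<beta> x (\<alpha> c * a) r - \<beta> x a (\<alpha> c * r) \<in> N" using Nc(3)[OF act_N[OF \<xi>\<Lambda>[OF act_\<Lambda>(1)[OF c]]]] by metis
  qed
  show thesis
  proof
    show "\<Xi> x \<in> W" for x unfolding \<Xi>_def \<beta>_def by (intro ep_in W(1) act_W \<xi>(1))
    show "\<Xi> x - x \<in> N" if "x \<in> W" for x
    proof -
      have "x = eval_pure (\<lambda>a b. act (a * b) x) e"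
        using ep_comp[of "\<lambda>r. act r x" "(*)" e] actd' e(1) act_mult(2) by simp
      then have "\<Xi> x - x = eval_pure (\<lambda>a b. \<beta> x a b - act (a * b) x) e"
        unfolding \<Xi>_def ep_diff[symmetric] by simp
      moreover have "\<beta> x a b - act (a * b) x \<in> N" for a b
        using act_N[OF \<xi>W[OF act_W[OF that]], of a b] by (simp add: \<beta>_def actd act_mult(1))
      ultimately show ?thesis by (simp only: ep_in[OF N(1)])
    qed
    show "\<Xi> (x + y) - \<Xi> x - \<Xi> y \<in> N" for x y
    proof -
      have "\<Xi> (x + y) - \<Xi> x - \<Xi> y = eval_pure (\<lambda>a b. \<beta> (x + y) a b - \<beta> x a b - \<beta> y a b) e"
        unfolding \<Xi>_def ep_diff by simp
      moreover have "\<beta> (x + y) a b - \<beta> x a b - \<beta> y a b \<in> N" for a b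
        using act_N[OF \<xi>add, of a "act b x" "act b y"] by (simp add: \<beta>_def actd act_add)
      ultimately show ?thesis by (simp only: ep_in[OF N(1)])
    qed
    show "\<Xi> (act r x) - act r (\<Xi> x) \<in> N" for r x
    proof -
      \<comment> \<open>The scalar \<open>r\<close> enters through the right factor on one side and
        the left factor on the other, so the two sides differ by a value of \<open>\<beta> x\<close>
        on an element of the tensor ideal.\<close>
      have "\<Xi> (act r x) = eval_pure (\<beta> x) (e * pure 1 r)"
        unfolding \<Xi>_def eval_pure_shift by (simp add: \<beta>_def act_mult(1))
      moreover have "act r (\<Xi> x) = eval_pure (\<lambda>a b. act r (\<beta> x a b)) e"
        unfolding \<Xi>_def by (rule ep_comp[symmetric]) (rule actd)
      then have "act r (\<Xi> x) = eval_pure (\<beta> x) (e * pure r 1)"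
        unfolding eval_pure_shift by (simp add: \<beta>_def act_mult(1)[symmetric] mult.commute)
      ultimately have "\<Xi> (act r x) - act r (\<Xi> x) = - eval_pure (\<beta> x) (e * (pure r 1 - pure 1 r))"
        by (simp add: right_diff_distrib)
      then show ?thesis using Nc(3)[OF eval_pure_tensor_ideal[OF N(1) bal e(2)]] by metis
    qed
    show "\<Xi> (f x) - f (\<Xi> x) \<in> N" if f: "f \<in> \<Lambda>" for f x
    proof -
      have "f (\<Xi> x) = eval_pure (\<lambda>a b. f (\<beta> x a b)) e"
        unfolding \<Xi>_def by (rule ep_comp[symmetric]) (rule add[OF f])
      then have "\<Xi> (f x) - f (\<Xi> x) = eval_pure (\<lambda>a b. \<beta> (f x) a b - f (\<beta> x a b)) e"
        by (simp add: \<Xi>_def ep_diff)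
      moreover have "\<beta> (f x) a b - f (\<beta> x a b) \<in> N" for a b
        using act_N[OF \<xi>\<Lambda>[OF f], of a "act b x"] by (simp add: \<beta>_def actd act_\<Lambda>(2)[OF f])
      ultimately show ?thesis by (simp only: ep_in[OF N(1)])
    qed
  qed
qed

section \<open>The copies of F and R inside K tensor R\<close>

locale etale_setting = uniformized_field nrm A pi for nrm :: "'f::field \<Rightarrow> real" and A pi +
  fixes \<iota> :: "'f \<Rightarrow> 'k::ring_1" and \<alpha> :: "'f \<Rightarrow> 'r::{comm_ring,comm_monoid_mult}"
    and \<tau>K :: "'k \<Rightarrow> 'r \<Rightarrow> 'kr::{ring,monoid_mult}"
  assumes emb: "central_embedding \<iota>" and etale: "etale_algebra A \<alpha>" and tring: "tensor_ring A \<iota> \<alpha> \<tau>K"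
begin

lemma \<iota>_hom: "\<iota> 1 = 1" "\<iota> (a + b) = \<iota> a + \<iota> b" "\<iota> (a * b) = \<iota> a * \<iota> b"
  and \<iota>_central: "\<iota> a * x = x * \<iota> a"
  using emb unfolding central_embedding_def by blast+

lemma \<iota>_0: "\<iota> 0 = 0" using \<iota>_hom(2)[of 0 0] by simp

lemma \<alpha>_1: "\<alpha> 1 = 1" and \<alpha>_add: "a \<in> A \<Longrightarrow> b \<in> A \<Longrightarrow> \<alpha> (a + b) = \<alpha> a + \<alpha> b"
  and \<alpha>_mult: "a \<in> A \<Longrightarrow> b \<in> A \<Longrightarrow> \<alpha> (a * b) = \<alpha> a * \<alpha> b"
  using etale by (auto simp: etale_algebra_def algebra_map_def)

lemma \<alpha>_diff: "a \<in> A \<Longrightarrow> b \<in> A \<Longrightarrow> \<alpha> (a - b) = \<alpha> a - \<alpha> b"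
  using \<alpha>_add[of "a - b" b] A_diff by (simp add: eq_diff_eq)

definition j :: "'f \<Rightarrow> 'kr" where "j a = \<tau>K (\<iota> a) 1"

definition inc :: "'r \<Rightarrow> 'kr" where "inc r = \<tau>K 1 r"

lemma tproduct_K: "tensor_product A (\<lambda>a x. \<iota> a * x) \<alpha> UNIV \<tau>K UNIV"
  and \<tau>K_mult: "\<tau>K x r * \<tau>K y s = \<tau>K (x * y) (r * s)" and \<tau>K_1: "\<tau>K 1 1 = 1"
  using tring by (auto simp: tensor_ring_def)

lemma \<tau>K_add: "\<tau>K (x + y) r = \<tau>K x r + \<tau>K y r" "\<tau>K x (r + s) = \<tau>K x r + \<tau>K x s"
  and \<tau>K_scale: "a \<in> A \<Longrightarrow> \<tau>K (\<iota> a * x) r = \<tau>K x (\<alpha> a * r)"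
  using tensor_productD[OF tproduct_K] by auto

lemma \<tau>K_0: "\<tau>K 0 r = 0" "\<tau>K x 0 = 0"
  using \<tau>K_add(1)[of 0 0 r] \<tau>K_add(2)[of x 0 0] by auto

lemma KR_induct [case_names zero pure add]:
  assumes "P 0" "\<And>x r. P (\<tau>K x r)" "\<And>y z. P y \<Longrightarrow> P z \<Longrightarrow> P (y + z)"
  shows "P y"
  by (rule tensor_image_induct[of y \<tau>K UNIV P])
    (use tensor_productD(4)[OF tproduct_K] assms in auto)

lemma j_hom: "j 1 = 1" "j (a + b) = j a + j b" "j (a * b) = j a * j b" "j 0 = 0"
  by (simp_all add: j_def \<iota>_hom \<tau>K_1 \<tau>K_add \<tau>K_mult \<iota>_0 \<tau>K_0)

lemma j_diff: "j (a - b) = j a - j b"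
  using j_hom(2)[of "a - b" b] by (simp add: eq_diff_eq)

lemma j_central: "j a * y = y * j a"
proof (induction y rule: KR_induct)
  case (pure x r)
  show ?case using \<iota>_central[of a x] by (simp add: j_def \<tau>K_mult)
qed (auto simp: distrib_left distrib_right)

lemma inc_hom: "inc 1 = 1" "inc (r + s) = inc r + inc s" "inc (r * s) = inc r * inc s" "inc 0 = 0"
  by (simp_all add: inc_def \<tau>K_1 \<tau>K_add \<tau>K_mult \<tau>K_0)

lemma inc_diff: "inc (r - s) = inc r - inc s"
  using inc_hom(2)[of "r - s" s] by (simp add: eq_diff_eq)

lemma inc_sum: "inc (\<Sum>i\<in>I. f i) = (\<Sum>i\<in>I. inc (f i))"
  by (induction I rule: infinite_finite_induct) (auto simp: inc_hom)

lemma inc_central: "inc r * y = y * inc r"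
  by (induction y rule: KR_induct) (auto simp: inc_def \<tau>K_mult mult.commute[of r] distrib_left distrib_right)

lemma inc_\<alpha>: "a \<in> A \<Longrightarrow> inc (\<alpha> a * r) = j a * inc r"
  using \<tau>K_scale[of a 1 r] by (simp add: inc_def j_def \<tau>K_mult)

lemma inc_\<alpha>1: "a \<in> A \<Longrightarrow> inc (\<alpha> a) = j a"
  using inc_\<alpha>[of a 1] by (simp add: inc_hom)

lemma j_inc: "j a * inc r = \<tau>K (\<iota> a) r"
  by (simp add: j_def inc_def \<tau>K_mult)

text \<open>Flatness for the principal ideal \<open>a A\<close>: the tensor
  \<open>a \<otimes> r\<close> becomes 0 in \<open>R\<close>, hence is 0 in
  \<open>a A \<otimes> R\<close>, and the map
  \<open>a x \<otimes> s \<mapsto> \<alpha> x * s\<close> takes it to \<open>r\<close>.\<close>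

lemma torsion_free:
  assumes "a \<in> A" "a \<noteq> 0" "\<alpha> a * r = 0"
  shows "r = 0"
proof -
  define I where "I = {a * x | x. x \<in> A}"
  have "submodule_of A (*) A I"
    unfolding submodule_of_def I_def
  proof (intro conjI ballI subsetI)
    show "0 \<in> {a * x | x. x \<in> A}" by (intro CollectI exI[of _ 0]) auto
    fix x y assume "x \<in> {a * x | x. x \<in> A}" "y \<in> {a * x | x. x \<in> A}"
    then obtain u v where "x = a * u" "y = a * v" "u \<in> A" "v \<in> A" by blast
    then show "x - y \<in> {a * x | x. x \<in> A}"
      by (intro CollectI exI[of _ "u - v"]) (auto simp: A_diff right_diff_distrib)
  next
    fix c x assume "c \<in> A" "x \<in> {a * x | x. x \<in> A}"
    then show "c * x \<in> {a * x | x. x \<in> A}" using A_mult by (auto simp: mult.left_commute)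
  qed (use assms A_mult in auto)
  then have inj: "tensor_injective A (*) \<alpha> I (\<lambda>a r. \<alpha> a * r)"
    using etale unfolding etale_algebra_def flat_algebra_def by blast
  have "a \<in> I" unfolding I_def by (intro CollectI exI[of _ 1]) simp
  then have mem: "(\<Sum>z\<leftarrow>[(a, r)]. frag_of z) \<in> tensor_relations A (*) \<alpha> I"
    using inj assms(3) unfolding tensor_injective_def by (metis (no_types, lifting) add.right_neutral
      empty_set fst_conv image_empty image_insert insert_subset empty_subsetI list.simps(15) tensor_sum_simps(1,2))
  have bal: "balanced_mod A (*) \<alpha> I {0} (\<lambda>x r. \<alpha> (x / a) * r)"
    unfolding balanced_mod_def I_def using assms(2)
    by (auto simp: add_divide_distrib \<alpha>_add \<alpha>_mult A_mult distrib_left distrib_right mult.left_commute mult.assoc[symmetric])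
  have "additively_closed {0 :: 'r}" by (simp add: additively_closed_def)
  from eval_sum_tensor_relations[OF this bal mem] have "\<alpha> (a / a) * r = 0" by simp
  then show ?thesis using assms(2) by (simp add: \<alpha>_1)
qed

lemma vector_space_K: "vector_space (\<lambda>a x. \<iota> a * x)"
  by standard (auto simp: \<iota>_hom distrib_left distrib_right mult.assoc)

text \<open>An \<open>F\<close>-linear \<open>\<kappa>\<close> from \<open>K\<close> to
  \<open>F\<close> with \<open>\<kappa> 1 = 1\<close> reduces the claim to \<open>R\<close>
  injecting into \<open>R\<close> with \<open>pi\<close> inverted, which is
  torsion-freeness.\<close>

lemma inc_inj: "inc r = inc s \<Longrightarrow> r = s"
proof -
  have "t = 0" if t: "inc t = 0" for t
  proof -
    obtain \<kappa> where \<kappa>: "functional (\<lambda>a x. \<iota> a * x) \<kappa>" "\<kappa> 1 = 1"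
      using vector_space.functional_with_value_one[OF vector_space_K, of 1] by auto
    define N where "N = {s :: nat \<Rightarrow> 'r. \<exists>m. \<forall>i\<ge>m. s i = 0}"
    have N: "additively_closed N"
      unfolding additively_closed_def N_def
    proof (intro conjI ballI)
      fix s s' :: "nat \<Rightarrow> 'r" assume "s \<in> {s. \<exists>m. \<forall>i\<ge>m. s i = 0}" "s' \<in> {s. \<exists>m. \<forall>i\<ge>m. s i = 0}"
      then obtain m k where "\<forall>i\<ge>m. s i = 0" "\<forall>i\<ge>k. s' i = 0" by blast
      then have "\<forall>i\<ge>max m k. (s - s') i = 0" by simp
      then show "s - s' \<in> {s. \<exists>m. \<forall>i\<ge>m. s i = 0}" by blast
    qed simp
    \<comment> \<open>This replaces the map
      \<open>K \<otimes> R \<rightarrow> F \<otimes> R\<close>: the fraction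
      \<open>\<kappa>(x) r\<close> is represented by its numerators over \<open>pi ^ i\<close>. The
      value 0 where \<open>i\<close> is too small concerns finitely many \<open>i\<close> and is
      invisible modulo \<open>N\<close>.\<close>
    define \<beta> where "\<beta> = (\<lambda>x r i. if pi ^ i * \<kappa> x \<in> A then \<alpha> (pi ^ i * \<kappa> x) * r else 0)"
    have ev: "\<exists>m. \<forall>i\<ge>m. pi ^ i * \<kappa> x \<in> A" for x using denominator denominator_mono by blast
    have "balanced_mod A (\<lambda>a x. \<iota> a * x) \<alpha> UNIV N \<beta>"
      unfolding balanced_mod_def
    proof (intro conjI ballI allI)
      fix x y r
      obtain m k where mk: "\<forall>i\<ge>m. pi ^ i * \<kappa> x \<in> A" "\<forall>i\<ge>k. pi ^ i * \<kappa> y \<in> A" using ev by blast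
      have "(\<beta> (x + y) r - \<beta> x r - \<beta> y r) i = 0" if "max m k \<le> i" for i
        using mk that A_add[of "pi ^ i * \<kappa> x" "pi ^ i * \<kappa> y"]
        by (simp add: \<beta>_def functional_add[OF \<kappa>(1)] distrib_left \<alpha>_add distrib_right)
      then show "\<beta> (x + y) r - \<beta> x r - \<beta> y r \<in> N" unfolding N_def by blast
    next
      fix x r s
      have "\<beta> x (r + s) - \<beta> x r - \<beta> x s = 0" by (rule ext) (simp add: \<beta>_def distrib_left)
      then show "\<beta> x (r + s) - \<beta> x r - \<beta> x s \<in> N" using additively_closedD(1)[OF N] by simp
    next
      fix a x r assume a: "a \<in> A"
      obtain m where m: "\<forall>i\<ge>m. pi ^ i * \<kappa> x \<in> A" using ev by blast
      have "(\<beta> (\<iota> a * x) r - \<beta> x (\<alpha> a * r)) i = 0" if "m \<le> i" for i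
      proof -
        have i: "pi ^ i * \<kappa> x \<in> A" using m that by blast
        have eq: "pi ^ i * \<kappa> (\<iota> a * x) = a * (pi ^ i * \<kappa> x)"
          using functional_scale[OF \<kappa>(1), of a x] by simp
        have "\<beta> (\<iota> a * x) r i = \<alpha> a * \<alpha> (pi ^ i * \<kappa> x) * r"
          unfolding \<beta>_def eq using A_mult[OF a i] \<alpha>_mult[OF a i] by simp
        moreover have "\<beta> x (\<alpha> a * r) i = \<alpha> a * \<alpha> (pi ^ i * \<kappa> x) * r"
          unfolding \<beta>_def using i by (simp add: mult.assoc mult.left_commute)
        ultimately show ?thesis by simp
      qed
      then show "\<beta> (\<iota> a * x) r - \<beta> x (\<alpha> a * r) \<in> N" unfolding N_def by blast
    qed
    then have "tensor_sum \<beta> [(1, t)] \<in> N"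
      by (intro tensor_product_kernel[OF tproduct_K N]) (use t in \<open>simp_all add: inc_def\<close>)
    then obtain m where "\<beta> 1 t m = 0" unfolding N_def by auto
    then have "\<alpha> (pi ^ m) * t = 0" using A_power[OF pi_A] by (simp add: \<beta>_def \<kappa>(2))
    then show "t = 0" using torsion_free[OF A_power[OF pi_A]] pi_nz by simp
  qed
  from this[of "r - s"] show "inc r = inc s \<Longrightarrow> r = s" by (simp add: inc_diff)
qed

text \<open>Modulo \<open>pi R\<close> the operators from \<open>A\<close> act through the residue
  field, so averaging gives an \<open>R\<close>-linear projection \<open>\<Xi>\<close> of
  \<open>R\<close> onto \<open>W = z R + pi R\<close>. Then \<open>z\<close> is congruent to
  \<open>\<Xi> z\<close>, hence to \<open>z * \<Xi> 1\<close>; this lies in \<open>z W\<close>, and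
  \<open>z W\<close> is contained in \<open>pi R\<close> because \<open>z^2\<close> is in
  \<open>pi R\<close>.\<close>

lemma reduced_mod_pi:
  fixes z y :: 'r
  assumes zz: "z * z = \<alpha> pi * y"
  shows "\<exists>w. z = \<alpha> pi * w"
proof -
  obtain e where e: "eval_pure (*) e = 1" "\<And>x. e * (pure x 1 - pure 1 x) \<in> tensor_ideal A \<alpha>"
    using separability_element[of A \<alpha>] etale unfolding etale_algebra_def by blast
  define N where "N = range (\<lambda>x. \<alpha> pi * x)"
  define W where "W = range (\<lambda>(r, s). z * r + \<alpha> pi * s)"
  define \<Lambda> where "\<Lambda> = (\<lambda>a x. \<alpha> a * x) ` A"
  have NI: "x = \<alpha> pi * y \<Longrightarrow> x \<in> N" for x y unfolding N_def by blast
  have WI: "x = z * r + \<alpha> pi * s \<Longrightarrow> x \<in> W" for x r s unfolding W_def by force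
  have WE: "\<exists>r s. x = z * r + \<alpha> pi * s" if "x \<in> W" for x using that unfolding W_def by force
  have Nm: "x \<in> N \<Longrightarrow> r * x \<in> N" for x r 
  proof -
    assume "x \<in> N"
    then obtain u where "x = \<alpha> pi * u" unfolding N_def by blast
    then have "r * x = \<alpha> pi * (r * u)" by (simp add: mult.left_commute)
    then show "r * x \<in> N" by (rule NI)
  qed
  have Wm: "x \<in> W \<Longrightarrow> r * x \<in> W" for x r
  proof -
    assume "x \<in> W"
    then obtain u v where "x = z * u + \<alpha> pi * v" using WE by blast
    then have "r * x = z * (r * u) + \<alpha> pi * (r * v)" by (simp add: distrib_left mult.left_commute)
    then show "r * x \<in> W" by (rule WI)
  qed
  have N: "additively_closed N" unfolding additively_closed_def
  proof (intro conjI ballI)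
    show "0 \<in> N" by (rule NI[of _ 0]) simp
    fix x y assume "x \<in> N" "y \<in> N"
    then obtain u v where "x = \<alpha> pi * u" "y = \<alpha> pi * v" unfolding N_def by blast
    then show "x - y \<in> N" by (intro NI[of _ "u - v"]) (simp add: right_diff_distrib)
  qed
  have W: "additively_closed W" unfolding additively_closed_def
  proof (intro conjI ballI)
    show "0 \<in> W" by (rule WI[of _ 0 0]) simp
    fix x y assume "x \<in> W" "y \<in> W"
    then obtain u v u' v' where "x = z * u + \<alpha> pi * v" "y = z * u' + \<alpha> pi * v'" using WE by metis
    then show "x - y \<in> W" by (intro WI[of _ "u - u'" "v - v'"]) (simp add: right_diff_distrib)
  qed
  obtain \<Xi> where \<Xi>: "\<And>x. \<Xi> x \<in> W" "\<And>x. x \<in> W \<Longrightarrow> \<Xi> x - x \<in> N" "\<And>r x. \<Xi> (r * x) - r * \<Xi> x \<in> N"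
  proof (rule averaged_projection[OF e N _ W _, of \<Lambda> "(*)"])
    show "stable \<Lambda> N" "stable \<Lambda> W" unfolding stable_def \<Lambda>_def using Nm Wm by auto
    show "f (x - y) = f x - f y" if "f \<in> \<Lambda>" for f x y
      using that unfolding \<Lambda>_def by (auto simp: right_diff_distrib)
    show "id \<in> \<Lambda>" unfolding \<Lambda>_def by (rule image_eqI[of _ _ 1]) (auto simp: \<alpha>_1)
    show "f \<circ> g \<in> \<Lambda>" if "f \<in> \<Lambda>" "g \<in> \<Lambda>" for f g
    proof -
      obtain a b where "f = (\<lambda>x. \<alpha> a * x)" "g = (\<lambda>x. \<alpha> b * x)" "a \<in> A" "b \<in> A" using \<open>f \<in> \<Lambda>\<close> \<open>g \<in> \<Lambda>\<close> unfolding \<Lambda>_def by blast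
      then show ?thesis unfolding \<Lambda>_def
        by (intro image_eqI[of _ _ "a * b"]) (auto simp: \<alpha>_mult A_mult mult.assoc)
    qed
    show "(\<lambda>x. f x - g x) \<in> \<Lambda>" if "f \<in> \<Lambda>" "g \<in> \<Lambda>" for f g
    proof -
      obtain a b where "f = (\<lambda>x. \<alpha> a * x)" "g = (\<lambda>x. \<alpha> b * x)" "a \<in> A" "b \<in> A" using \<open>f \<in> \<Lambda>\<close> \<open>g \<in> \<Lambda>\<close> unfolding \<Lambda>_def by blast
      then show ?thesis unfolding \<Lambda>_def
        by (intro image_eqI[of _ _ "a - b"]) (auto simp: \<alpha>_diff A_diff left_diff_distrib)
    qed
    show "(\<forall>x. f x \<in> N) \<or> (\<exists>g\<in>\<Lambda>. \<forall>x. g (f x) - x \<in> N)" if f: "f \<in> \<Lambda>" for f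
    proof -
      obtain a where a: "f = (\<lambda>x. \<alpha> a * x)" "a \<in> A" using f unfolding \<Lambda>_def by blast
      show ?thesis
      proof (cases "nrm a < 1")
        case True
        then have "a / pi \<in> A" by (rule divisible_by_pi)
        then have "\<alpha> a = \<alpha> pi * \<alpha> (a / pi)" using \<alpha>_mult[OF pi_A, of "a / pi"] pi_nz by simp
        then show ?thesis using a(1) NI by (metis mult.assoc)
      next
        case False
        then have n: "nrm a = 1" using a(2) by (simp add: A_def)
        then have i: "inverse a \<in> A" "a \<noteq> 0" using nrm_0 by (auto simp: A_def nrm_inverse)
        then have "\<alpha> (inverse a) * (\<alpha> a * x) = x" for x
          using \<alpha>_mult[OF i(1) a(2)] by (simp add: mult.assoc[symmetric] \<alpha>_1)
        then have "\<alpha> (inverse a) * f x - x \<in> N" for x using additively_closedD(1)[OF N] by (simp add: a(1))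
        moreover have "(\<lambda>x. \<alpha> (inverse a) * x) \<in> \<Lambda>" using i(1) unfolding \<Lambda>_def by blast
        ultimately show ?thesis by (intro disjI2 bexI[of _ "\<lambda>x. \<alpha> (inverse a) * x"]) auto
      qed
    qed
    show "(*) (\<alpha> a) \<in> \<Lambda>" if "a \<in> A" for a using that unfolding \<Lambda>_def by blast
    show "f (r * x) = r * f x" if "f \<in> \<Lambda>" for f r x using that unfolding \<Lambda>_def by (auto simp: mult.left_commute)
  qed (auto simp: distrib_left distrib_right mult.assoc Nm Wm)
  note Nc = additively_closedD[OF N]
  have zW: "z \<in> W" by (rule WI[of _ 1 0]) simp
  obtain r s where rs: "\<Xi> 1 = z * r + \<alpha> pi * s" using WE[OF \<Xi>(1)] by blast
  have "z * \<Xi> 1 = (z * z) * r + \<alpha> pi * (z * s)"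
    unfolding rs by (simp add: distrib_left mult.assoc mult.left_commute)
  also have "\<dots> = \<alpha> pi * (y * r + z * s)" by (simp add: zz distrib_left mult.assoc)
  finally have "z * \<Xi> 1 \<in> N" by (rule NI)
  then have "(\<Xi> (z * 1) - z * \<Xi> 1) + z * \<Xi> 1 \<in> N" by (rule Nc(4)[OF \<Xi>(3)])
  then have "\<Xi> z - (\<Xi> z - z) \<in> N" by (intro Nc(2)[OF _ \<Xi>(2)[OF zW]]) simp
  then have "z \<in> N" by simp
  then show ?thesis unfolding N_def by blast
qed

text \<open>In characteristic 2, apply averaging over the field \<open>F(\<surd>\<pi>)\<close> to the ring
  \<open>K\<^sub>R[\<surd>\<pi>]\<close>, whose elements are the pairs \<open>(x, y) = x + y\<surd>\<pi>\<close>.\<close>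

lemma square_zero:
  assumes two: "(2::'f) = 0" and zero: "inc r * inc r + j pi * (inc s * inc s) = 0"
  shows "r = 0 \<and> s = 0"
proof -
  obtain e where e: "eval_pure (*) e = 1" "\<And>x. e * (pure x 1 - pure 1 x) \<in> tensor_ideal A \<alpha>"
    using separability_element[of A \<alpha>] etale unfolding etale_algebra_def by blast
  have dbl: "x + x = 0" for x :: 'kr
  proof -
    have "x + x = j 2 * x" using j_hom(2)[of 1 1] by (simp add: j_hom(1) distrib_right)
    then show ?thesis by (simp add: two j_hom(4))
  qed
  \<comment> \<open>\<open>mul u v\<close> is multiplication by
    \<open>u + v \<surd>pi\<close>.\<close>
  define mul :: "'kr \<Rightarrow> 'kr \<Rightarrow> 'kr \<times> 'kr \<Rightarrow> 'kr \<times> 'kr"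
    where "mul = (\<lambda>u v (x, y). (u * x + j pi * (v * y), v * x + u * y))"
  have mul: "mul u v (x, y) = (u * x + j pi * (v * y), v * x + u * y)" for u v x y by (simp add: mul_def)
  have mul_add: "mul u v (p + q) = mul u v p + mul u v q" for u v p q
    by (cases p; cases q) (simp add: mul distrib_left)
  have mul_diff: "mul u v (p - q) = mul u v p - mul u v q" for u v p q
    by (cases p; cases q) (simp add: mul right_diff_distrib)
  have jl: "j pi * (v * x) = v * (j pi * x)" for v x using j_central by (metis mult.assoc)
  have mul_comm: "mul u v (mul u' v' p) = mul u' v' (mul u v p)"
    if "\<And>x. u * x = x * u" "\<And>x. v * x = x * v" for u v u' v' p
  proof -
    have c: "u * (u' * x) = u' * (u * x)" "v * (u' * x) = u' * (v * x)" "u * (v' * x) = v' * (u * x)"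
      "v * (v' * x) = v' * (v * x)" for x using that by (metis mult.assoc)+
    show ?thesis by (cases p) (simp add: mul distrib_left jl c add_ac)
  qed
  have mul_mul: "mul (j a) (j b) (mul (j c) (j d) p) = mul (j (a * c + pi * (b * d))) (j (b * c + a * d)) p" for a b c d p
    by (cases p) (simp add: mul distrib_left distrib_right j_hom jl mult.assoc add_ac)
  define act where "act = (\<lambda>r. mul (inc r) 0)"
  define W where "W = range (mul (inc r) (inc s))"
  define \<Lambda> where "\<Lambda> = range (\<lambda>(a, b). mul (j a) (j b))"
  have \<Lambda>E: "\<exists>a b. f = mul (j a) (j b)" if "f \<in> \<Lambda>" for f using that unfolding \<Lambda>_def by auto
  have \<Lambda>I: "f = mul (j a) (j b) \<Longrightarrow> f \<in> \<Lambda>" for f a b unfolding \<Lambda>_def by auto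
  have W: "additively_closed W"
  proof -
    have "mul (inc r) (inc s) 0 = 0" by (simp add: mul zero_prod_def)
    then have "0 \<in> W" unfolding W_def by (metis rangeI)
    moreover have "x - y \<in> W" if "x \<in> W" "y \<in> W" for x y
      using that unfolding W_def by (auto simp: mul_diff[symmetric])
    ultimately show ?thesis by (simp add: additively_closed_def)
  qed
  have W_mul: "mul u v x \<in> W" if "x \<in> W" for u v x
  proof -
    obtain p where "x = mul (inc r) (inc s) p" using \<open>x \<in> W\<close> unfolding W_def by blast
    then have "mul u v x = mul (inc r) (inc s) (mul u v p)" using mul_comm[OF inc_central inc_central] by simp
    then show ?thesis unfolding W_def by blast
  qed
  obtain \<Xi> where \<Xi>: "\<And>x. \<Xi> x \<in> W" "\<And>x. x \<in> W \<Longrightarrow> \<Xi> x = x" "\<And>x y. \<Xi> (x + y) = \<Xi> x + \<Xi> y"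
    "\<And>r x. \<Xi> (act r x) = act r (\<Xi> x)" "\<And>f x. f \<in> \<Lambda> \<Longrightarrow> \<Xi> (f x) = f (\<Xi> x)"
  proof (rule averaged_projection[OF e _ _ W, of "{0}" \<Lambda> act])
    show "additively_closed {0 :: 'kr \<times> 'kr}" by (simp add: additively_closed_def)
    have z: "mul u v 0 = 0" for u v by (simp add: mul zero_prod_def)
    show "stable \<Lambda> {0}" unfolding stable_def using \<Lambda>E z by auto
    show "stable \<Lambda> W" unfolding stable_def using \<Lambda>E W_mul by metis
    show "f (x - y) = f x - f y" if "f \<in> \<Lambda>" for f x y using \<Lambda>E[OF that] mul_diff by metis
    show "id \<in> \<Lambda>" by (rule \<Lambda>I[of _ 1 0]) (auto simp: fun_eq_iff mul j_hom)
    show "f \<circ> g \<in> \<Lambda>" if fg: "f \<in> \<Lambda>" "g \<in> \<Lambda>" for f g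
    proof -
      obtain a b c d where "f = mul (j a) (j b)" "g = mul (j c) (j d)" using \<Lambda>E fg by metis
      then have "f \<circ> g = mul (j (a * c + pi * (b * d))) (j (b * c + a * d))" by (intro ext) (simp add: mul_mul)
      then show ?thesis by (rule \<Lambda>I)
    qed
    show "(\<lambda>x. f x - g x) \<in> \<Lambda>" if fg: "f \<in> \<Lambda>" "g \<in> \<Lambda>" for f g
    proof -
      obtain a b c d where "f = mul (j a) (j b)" "g = mul (j c) (j d)" using \<Lambda>E fg by metis
      moreover have "mul (j a) (j b) x - mul (j c) (j d) x = mul (j (a - c)) (j (b - d)) x" for x
        by (cases x) (simp add: mul j_diff left_diff_distrib right_diff_distrib)
      ultimately have "(\<lambda>x. f x - g x) = mul (j (a - c)) (j (b - d))" by (intro ext) simp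
      then show ?thesis by (rule \<Lambda>I)
    qed
    show "(\<forall>x. f x \<in> {0}) \<or> (\<exists>g\<in>\<Lambda>. \<forall>x. g (f x) - x \<in> {0})" if f: "f \<in> \<Lambda>" for f
    proof -
      obtain a b where ab: "f = mul (j a) (j b)" using \<Lambda>E f by metis
      \<comment> \<open>In characteristic 2, \<open>n\<close> is the square of
        \<open>a + b \<surd>pi\<close>, and it vanishes only for \<open>a = b = 0\<close>; so the
        inverse is \<open>(a + b \<surd>pi) / n\<close>.\<close>
      define n where "n = a\<^sup>2 + pi * b\<^sup>2"
      show ?thesis
      proof (cases "n = 0")
        case True
        then have "a = 0 \<and> b = 0" using A_square_zero unfolding n_def by blast
        then have "f x = 0" for x unfolding ab by (cases x) (simp add: mul j_hom zero_prod_def)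
        then show ?thesis by simp
      next
        case False
        have "a / n * a + pi * (b / n * b) = 1"
          using False by (simp add: n_def add_divide_distrib[symmetric] power2_eq_square)
        moreover have "b / n * a + a / n * b = 0"
        proof -
          have "b / n * a + a / n * b = 2 * (a * b / n)" unfolding mult_2 by (simp add: mult.commute)
          then show ?thesis by (simp add: two)
        qed
        ultimately have "mul (j (a / n)) (j (b / n)) (f x) = x" for x
          unfolding ab mul_mul by (cases x) (simp add: mul j_hom)
        then show ?thesis using \<Lambda>I by (metis cancel_comm_monoid_add_class.diff_cancel singletonI)
      qed
    qed
    show "act r (x + y) = act r x + act r y" for r x y by (simp add: act_def mul_add)
    show "act (r + s) x = act r x + act s x" for r s x
      by (cases x) (simp add: act_def mul inc_hom distrib_right)
    show "act (r * s) x = act r (act s x)" for r s x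
      by (cases x) (simp add: act_def mul inc_hom mult.assoc)
    show "act 1 x = x" for x by (cases x) (simp add: act_def mul inc_hom)
    show "act (\<alpha> a) \<in> \<Lambda>" if "a \<in> A" for a
      by (rule \<Lambda>I[of _ a 0]) (simp add: act_def inc_\<alpha>1[OF that] j_hom)
    show "f (act r x) = act r (f x)" if "f \<in> \<Lambda>" for f r x
    proof -
      obtain a b where "f = mul (j a) (j b)" using \<Lambda>E \<open>f \<in> \<Lambda>\<close> by metis
      then show ?thesis unfolding act_def using mul_comm[OF j_central j_central] by simp
    qed
    show "x \<in> {0} \<Longrightarrow> act r x \<in> {0}" for r x by (simp add: act_def z)
    show "x \<in> W \<Longrightarrow> act r x \<in> W" for r x by (simp add: act_def W_mul)
    fix \<Xi> assume a: "\<And>x. \<Xi> x \<in> W" "\<And>x. x \<in> W \<Longrightarrow> \<Xi> x - x \<in> {0}" "\<And>x y. \<Xi> (x + y) - \<Xi> x - \<Xi> y \<in> {0}"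
      "\<And>r x. \<Xi> (act r x) - act r (\<Xi> x) \<in> {0}" "\<And>f x. f \<in> \<Lambda> \<Longrightarrow> \<Xi> (f x) - f (\<Xi> x) \<in> {0}"
    show thesis
    proof (rule that[of \<Xi>])
      show "\<Xi> x \<in> W" for x by (rule a(1))
      show "\<Xi> x = x" if "x \<in> W" for x using a(2)[OF that] by simp
      show "\<Xi> (x + y) = \<Xi> x + \<Xi> y" for x y using a(3)[of x y] by (simp only: diff_diff_eq singleton_iff right_minus_eq)
      show "\<Xi> (act r x) = act r (\<Xi> x)" for r x using a(4)[of r x] by simp
      show "\<Xi> (f x) = f (\<Xi> x)" if "f \<in> \<Lambda>" for f x using a(5)[OF that, of x] by simp
    qed
  qed
  \<comment> \<open>Put \<open>z = r + s \<surd>pi\<close>. Then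
    \<open>z = \<Xi> z = z * \<Xi> 1\<close> lies in \<open>z^2\<close> times the ring. The
    hypothesis says \<open>z^2 = 0\<close>, the mixed term \<open>2 r s\<close> being zero.\<close>
  define I where "I = \<Xi> (1, 0)"
  \<comment> \<open>\<open>z\<close> is assembled from 1 by sums, the action of \<open>R\<close> and
    multiplication by \<open>\<surd>pi\<close>, with all of which \<open>\<Xi>\<close>
    commutes.\<close>
  have z: "(inc r, inc s) = act r (1, 0) + mul (j 0) (j 1) (act s (1, 0))"
    by (simp add: act_def mul j_hom)
  have "\<Xi> (inc r, inc s) = act r I + mul (j 0) (j 1) (act s I)"
    unfolding z I_def using \<Xi>(3,4,5) \<Lambda>I by metis
  also have "\<dots> = mul (inc r) (inc s) I"
    by (cases I) (simp add: act_def mul j_hom)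
  also have "\<dots> = 0"
  proof -
    obtain x y where "I = mul (inc r) (inc s) (x, y)" using \<Xi>(1)[of "(1, 0)"] unfolding I_def W_def by auto
    moreover have bc: "inc s * (inc r * w) = inc r * (inc s * w)" for w
      by (simp only: mult.assoc[symmetric] inc_central[of s "inc r"])
    ultimately have "mul (inc r) (inc s) I = ((inc r * inc r + j pi * (inc s * inc s)) * x + (j pi * (inc r * (inc s * y)) + j pi * (inc r * (inc s * y))),
        (inc r * (inc s * x) + inc r * (inc s * x)) + (inc r * inc r + j pi * (inc s * inc s)) * y)"
      by (simp add: mul distrib_left distrib_right mult.assoc jl bc add_ac)
    then show ?thesis by (simp add: zero dbl zero_prod_def)
  qed
  finally have "\<Xi> (inc r, inc s) = 0" .
  moreover have "(inc r, inc s) \<in> W" unfolding W_def by (rule image_eqI[of _ _ "(1, 0)"]) (auto simp: mul)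
  ultimately have "(inc r, inc s) = 0" using \<Xi>(2) by metis
  then show ?thesis using inc_inj[of r 0] inc_inj[of s 0] by (simp add: zero_prod_def inc_hom(4))
qed

end

section \<open>Quadratic conditions as linear conditions\<close>

context uniformized_field
begin

text \<open>The ambient ring may be noncommutative, as for quaternions; the expansion only moves
  central scalars \<open>j a\<close> and rests on the \<open>x i\<close> commuting with each
  other.\<close>

lemma quadratic_as_square_sum:
  fixes j :: "'f \<Rightarrow> 'a::{ring,monoid_mult}"
  assumes j: "\<And>a b. j (a + b) = j a + j b" "\<And>a b. j (a * b) = j a * j b" "\<And>a x. j a * x = x * j a"
    and x: "\<And>i k. i \<in> J \<Longrightarrow> k \<in> J \<Longrightarrow> x i * x k = x k * x i"
  shows "(\<Sum>i\<in>J. j (u i) * x i) * (\<Sum>i\<in>J. j (u i) * x i) + j pi * ((\<Sum>i\<in>J. j (v i) * x i) * (\<Sum>i\<in>J. j (v i) * x i))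
    = (\<Sum>i\<in>J. \<Sum>k\<in>J. j (u i * u k + pi * (v i * v k)) * (x i * x k))"
proof -
  have m: "(j a * y) * (j b * z) = j (a * b) * (y * z)" for a b y z
    by (metis j(2,3) mult.assoc)
  have "(\<Sum>i\<in>J. j (u i) * x i) * (\<Sum>i\<in>J. j (u i) * x i) = (\<Sum>i\<in>J. \<Sum>k\<in>J. j (u i * u k) * (x i * x k))" for u
    by (simp only: sum_product m)
  then show ?thesis
    by (simp add: sum_distrib_left sum.distrib[symmetric] j(1,2) distrib_right mult.assoc)
qed

text \<open>Modulo \<open>R\<close> the quadratic sum is \<open>r^2 + pi s^2\<close>, where
  \<open>r\<close> and \<open>s\<close> are the two linear sums: \<open>a i\<close> is
  \<open>u i^2 + pi v i^2\<close> up to \<open>A\<close>, and the integral doubled products take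
  care of the cross terms. The descent then separates \<open>r\<close> from \<open>s\<close>.
  Keeping \<open>j\<close> and \<open>R\<close> abstract lets one proof cover \<open>A\<close>
  inside \<open>F\<close> and the etale algebra inside \<open>K \<otimes> R\<close>.\<close>

lemma quadratic_integral_iff_linear_integral:
  fixes j :: "'f \<Rightarrow> 'a::{ring,monoid_mult}"
  assumes j: "j 1 = 1" "\<And>a b. j (a + b) = j a + j b" "\<And>a b. j (a * b) = j a * j b" "\<And>a x. j a * x = x * j a"
    and R: "additively_closed R" "\<And>x y. x \<in> R \<Longrightarrow> y \<in> R \<Longrightarrow> x * y \<in> R" "\<And>x y. x \<in> R \<Longrightarrow> y \<in> R \<Longrightarrow> x * y = y * x"
      "\<And>a. a \<in> A \<Longrightarrow> j a \<in> R"
    and red: "\<And>z y. z \<in> R \<Longrightarrow> y \<in> R \<Longrightarrow> z * z = j pi * y \<Longrightarrow> \<exists>w\<in>R. z = j pi * w"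
    and fin: "finite J" and x: "\<And>i. i \<in> J \<Longrightarrow> x i \<in> R"
    and uv: "\<And>i. i \<in> J \<Longrightarrow> a i - ((u i)\<^sup>2 + pi * (v i)\<^sup>2) \<in> A"
      "\<And>i k. i \<in> J \<Longrightarrow> k \<in> J \<Longrightarrow> 2 * (u i * u k) \<in> A \<and> 2 * (pi * (v i * v k)) \<in> A"
  shows "(\<Sum>i\<in>J. j (a i) * (x i * x i)) \<in> R \<longleftrightarrow> (\<Sum>i\<in>J. j (u i) * x i) \<in> R \<and> (\<Sum>i\<in>J. j (v i) * x i) \<in> R"
proof -
  note Rc = additively_closedD[OF R(1)]
  define r where "r = (\<Sum>i\<in>J. j (u i) * x i)"
  define s where "s = (\<Sum>i\<in>J. j (v i) * x i)"
  define Q where "Q = (\<lambda>i k. j (u i * u k + pi * (v i * v k)) * (x i * x k))"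
  have jd: "j (a - b) = j a - j b" for a b using j(2)[of "a - b" b] by (simp add: eq_diff_eq)
  have jR: "a \<in> A \<Longrightarrow> y \<in> R \<Longrightarrow> j a * y \<in> R" for a y using R(2,4) by blast
  have "(\<Sum>i\<in>J. \<Sum>k\<in>J. Q i k) - (\<Sum>i\<in>J. Q i i) \<in> R"
  proof (rule double_sum_minus_diagonal[OF R(1) fin])
    fix i k assume ik: "i \<in> J" "k \<in> J"
    have "Q i k + Q k i = j (2 * (u i * u k) + 2 * (pi * (v i * v k))) * (x i * x k)"
      unfolding Q_def using R(3)[OF x[OF ik(1)] x[OF ik(2)]]
      by (simp add: distrib_right[symmetric] j(2)[symmetric] mult.commute mult_2)
    moreover have "2 * (u i * u k) + 2 * (pi * (v i * v k)) \<in> A" using uv(2)[OF ik] A_add by blast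
    ultimately show "Q i k + Q k i \<in> R" using jR R(2) x ik by metis
  qed
  moreover have "r * r + j pi * (s * s) = (\<Sum>i\<in>J. \<Sum>k\<in>J. Q i k)"
    unfolding r_def s_def Q_def by (rule quadratic_as_square_sum[OF j(2-4) R(3)[OF x x]])
  ultimately have 1: "(r * r + j pi * (s * s)) - (\<Sum>i\<in>J. Q i i) \<in> R" by simp
  have 2: "(\<Sum>i\<in>J. j (a i) * (x i * x i)) - (\<Sum>i\<in>J. Q i i) \<in> R"
    unfolding sum_subtractf[symmetric]
  proof (rule additively_closed_sum[OF R(1)])
    fix i assume i: "i \<in> J"
    have "j (a i) * (x i * x i) - Q i i = j (a i - ((u i)\<^sup>2 + pi * (v i)\<^sup>2)) * (x i * x i)"
      by (simp add: Q_def power2_eq_square jd left_diff_distrib)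
    then show "j (a i) * (x i * x i) - Q i i \<in> R" using jR[OF uv(1)[OF i] R(2)[OF x[OF i] x[OF i]]] by simp
  qed
  have mem: "y \<in> R \<longleftrightarrow> z \<in> R" if "y - z \<in> R" for y z
    using Rc(4)[OF that, of z] Rc(2)[OF _ that, of y] by auto
  have 3: "(\<Sum>i\<in>J. j (a i) * (x i * x i)) \<in> R \<longleftrightarrow> r * r + j pi * (s * s) \<in> R"
    using mem[OF 1] mem[OF 2] by simp
  have "r * r + j pi * (s * s) \<in> R \<Longrightarrow> r \<in> R \<and> s \<in> R"
  proof -
    assume *: "r * r + j pi * (s * s) \<in> R"
    have jp: "j (b ^ m) = j b ^ m" for b m by (induction m) (auto simp: j)
    \<comment> \<open>A common denominator of all \<open>u i\<close> and \<open>v i\<close> provides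
      the starting exponent of the descent.\<close>
    obtain m where m: "\<forall>i\<in>J. pi ^ m * u i \<in> A" using common_denominator[OF fin] by blast
    obtain k where k: "\<forall>i\<in>J. pi ^ k * v i \<in> A" using common_denominator[OF fin] by blast
    have den: "j pi ^ max m k * (\<Sum>i\<in>J. j (w i) * x i) \<in> R" if "\<And>i. i \<in> J \<Longrightarrow> pi ^ max m k * w i \<in> A" for w
    proof -
      have "j pi ^ max m k * (\<Sum>i\<in>J. j (w i) * x i) = (\<Sum>i\<in>J. j (pi ^ max m k * w i) * x i)"
        by (simp add: sum_distrib_left j(3) jp mult.assoc)
      then show ?thesis using additively_closed_sum[OF R(1), of J] jR that x by simp
    qed
    have "pi ^ max m k * u i \<in> A" "pi ^ max m k * v i \<in> A" if "i \<in> J" for i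
      using m k that denominator_mono[of m "u i" "max m k"] denominator_mono[of k "v i" "max m k"] by auto
    then have rs: "j pi ^ max m k * r \<in> R" "j pi ^ max m k * s \<in> R" unfolding r_def s_def by (auto intro: den)
    show "r \<in> R \<and> s \<in> R"
    proof (rule square_descent[where p = "j pi" and q = "j (inverse pi)", OF _ _ R(1,2) _ red * rs])
      show "j pi * x = x * j pi" for x by (rule j(4))
      show "j pi * j (inverse pi) = 1" using j(3)[of pi "inverse pi"] j(1) pi_nz by simp
      show "j pi \<in> R" by (rule R(4)[OF pi_A])
    qed
  qed
  moreover have "r \<in> R \<and> s \<in> R \<Longrightarrow> r * r + j pi * (s * s) \<in> R"
    using Rc(4) jR[OF pi_A] R(2) by blast
  ultimately show ?thesis using 3 unfolding r_def s_def by blast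
qed

text \<open>In characteristic 2 the cross terms vanish and the identity with
  \<open>r^2 + pi s^2\<close> is exact. As \<open>zero\<close> speaks of elements of
  \<open>R\<close> only, \<open>r\<close> and \<open>s\<close> are first multiplied by a common
  denominator \<open>c\<close>.\<close>

lemma quadratic_zero_iff_linear_zero:
  fixes j :: "'f \<Rightarrow> 'a::{ring,monoid_mult}"
  assumes two: "(2::'f) = 0"
    and j: "j 1 = 1" "\<And>a b. j (a + b) = j a + j b" "\<And>a b. j (a * b) = j a * j b" "\<And>a x. j a * x = x * j a"
    and R: "additively_closed R" "\<And>x y. x \<in> R \<Longrightarrow> y \<in> R \<Longrightarrow> x * y \<in> R" "\<And>x y. x \<in> R \<Longrightarrow> y \<in> R \<Longrightarrow> x * y = y * x"
      "\<And>a. a \<in> A \<Longrightarrow> j a \<in> R"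
    and zero: "\<And>r s. r \<in> R \<Longrightarrow> s \<in> R \<Longrightarrow> r * r + j pi * (s * s) = 0 \<Longrightarrow> r = 0 \<and> s = 0"
    and fin: "finite J" and x: "\<And>i. i \<in> J \<Longrightarrow> x i \<in> R"
    and uv: "\<And>i. i \<in> J \<Longrightarrow> a i = (u i)\<^sup>2 + pi * (v i)\<^sup>2"
  shows "(\<Sum>i\<in>J. j (a i) * (x i * x i)) = 0 \<longleftrightarrow> (\<Sum>i\<in>J. j (u i) * x i) = 0 \<and> (\<Sum>i\<in>J. j (v i) * x i) = 0"
proof -
  define r where "r = (\<Sum>i\<in>J. j (u i) * x i)"
  define s where "s = (\<Sum>i\<in>J. j (v i) * x i)"
  define Q where "Q = (\<lambda>i k. j (u i * u k + pi * (v i * v k)) * (x i * x k))"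
  have jd: "j (a - b) = j a - j b" for a b using j(2)[of "a - b" b] by (simp add: eq_diff_eq)
  have j0: "j 0 = 0" using jd[of 0 0] by simp
  have jR: "a \<in> A \<Longrightarrow> y \<in> R \<Longrightarrow> j a * y \<in> R" for a y using R(2,4) by blast
  have "(\<Sum>i\<in>J. \<Sum>k\<in>J. Q i k) - (\<Sum>i\<in>J. Q i i) \<in> {0}"
  proof (rule double_sum_minus_diagonal[OF _ fin])
    fix i k assume ik: "i \<in> J" "k \<in> J"
    have "Q i k + Q k i = j (2 * (u i * u k) + 2 * (pi * (v i * v k))) * (x i * x k)"
      unfolding Q_def using R(3)[OF x[OF ik(1)] x[OF ik(2)]]
      by (simp add: distrib_right[symmetric] j(2)[symmetric] mult.commute mult_2)
    then show "Q i k + Q k i \<in> {0}" by (simp add: two j0)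
  qed (simp add: additively_closed_def)
  moreover have "(\<Sum>i\<in>J. Q i i) = (\<Sum>i\<in>J. j (a i) * (x i * x i))"
    by (rule sum.cong) (simp_all add: Q_def uv power2_eq_square)
  moreover have "r * r + j pi * (s * s) = (\<Sum>i\<in>J. \<Sum>k\<in>J. Q i k)"
    unfolding r_def s_def Q_def by (rule quadratic_as_square_sum[OF j(2-4) R(3)[OF x x]])
  ultimately have 3: "(\<Sum>i\<in>J. j (a i) * (x i * x i)) = r * r + j pi * (s * s)" by simp
  have "r * r + j pi * (s * s) = 0 \<Longrightarrow> r = 0 \<and> s = 0"
  proof -
    assume *: "r * r + j pi * (s * s) = 0"
    obtain m where m: "\<forall>i\<in>J. pi ^ m * u i \<in> A" using common_denominator[OF fin] by blast
    obtain k where k: "\<forall>i\<in>J. pi ^ k * v i \<in> A" using common_denominator[OF fin] by blast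
    define c where "c = pi ^ max m k"
    have den: "j c * (\<Sum>i\<in>J. j (w i) * x i) \<in> R" if "\<And>i. i \<in> J \<Longrightarrow> c * w i \<in> A" for w
    proof -
      have "j c * (\<Sum>i\<in>J. j (w i) * x i) = (\<Sum>i\<in>J. j (c * w i) * x i)"
        by (simp add: sum_distrib_left j(3) mult.assoc)
      then show ?thesis using additively_closed_sum[OF R(1), of J] jR that x by simp
    qed
    have "c * u i \<in> A" "c * v i \<in> A" if "i \<in> J" for i
      unfolding c_def using m k that denominator_mono[of m "u i" "max m k"] denominator_mono[of k "v i" "max m k"] by auto
    then have rs: "j c * r \<in> R" "j c * s \<in> R" unfolding r_def s_def by (auto intro: den)
    have sq: "(j c * y) * (j c * z) = j c * (j c * (y * z))" for y z by (metis j(4) mult.assoc)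
    have "(j c * r) * (j c * r) + j pi * ((j c * s) * (j c * s)) = j c * (j c * (r * r + j pi * (s * s)))"
      unfolding sq distrib_left by (metis j(4) mult.assoc)
    then have "j c * r = 0 \<and> j c * s = 0" using zero[OF rs] * by simp
    moreover have "j (inverse c) * (j c * y) = y" for y
      using j(3)[of "inverse c" c] j(1) pi_nz by (simp add: mult.assoc[symmetric] c_def)
    ultimately show "r = 0 \<and> s = 0" by (metis mult_zero_right)
  qed
  then show ?thesis using 3 unfolding r_def s_def by auto
qed

end

context etale_setting
begin

lemma inc_range: "additively_closed (range inc)" "x \<in> range inc \<Longrightarrow> y \<in> range inc \<Longrightarrow> x * y \<in> range inc"
  "x \<in> range inc \<Longrightarrow> y \<in> range inc \<Longrightarrow> x * y = y * x" "a \<in> A \<Longrightarrow> j a \<in> range inc"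
proof -
  have "0 \<in> range inc" by (rule range_eqI[of _ _ 0]) (simp add: inc_hom)
  then show "additively_closed (range inc)"
    unfolding additively_closed_def by (auto simp: inc_diff[symmetric])
  show "x \<in> range inc \<Longrightarrow> y \<in> range inc \<Longrightarrow> x * y \<in> range inc" by (auto simp: inc_hom(3)[symmetric])
  show "x \<in> range inc \<Longrightarrow> y \<in> range inc \<Longrightarrow> x * y = y * x" by (auto intro: inc_central)
  show "a \<in> A \<Longrightarrow> j a \<in> range inc" using inc_\<alpha>1[of a] by (metis rangeI)
qed

lemma inc_reduced: "z \<in> range inc \<Longrightarrow> y \<in> range inc \<Longrightarrow> z * z = j pi * y \<Longrightarrow> \<exists>w\<in>range inc. z = j pi * w"
proof -
  assume "z \<in> range inc" "y \<in> range inc" "z * z = j pi * y"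
  then obtain r s where "z = inc r" "y = inc s" "z * z = j pi * y" by blast
  then have rs: "z = inc r" "y = inc s" "inc (r * r) = inc (\<alpha> pi * s)"
    by (simp_all add: inc_hom(3) inc_\<alpha>[OF pi_A] inc_\<alpha>1[OF pi_A])
  then obtain w where "r = \<alpha> pi * w" using reduced_mod_pi[of r s] inc_inj by blast
  then show ?thesis using rs(1) inc_\<alpha>[OF pi_A] by auto
qed

text \<open>One and the same pair \<open>u\<close>, \<open>v\<close> linearises the condition over
  \<open>A\<close> and over the etale algebra; this is what carries it from one to the other. Over
  the etale algebra an implication is enough, the opposite inclusion being
  \<open>T1R_tau\<close>.\<close>

lemma integral_condition_linear:
  fixes d :: nat
  assumes a: "\<And>i. i < d \<Longrightarrow> 2 * a i \<in> A"
  shows "\<exists>u v. (\<forall>x. (\<forall>i<d. x i \<in> A) \<longrightarrow>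
      ((\<Sum>i<d. a i * (x i * x i)) \<in> A \<longleftrightarrow> (\<Sum>i<d. u i * x i) \<in> A \<and> (\<Sum>i<d. v i * x i) \<in> A)) \<and>
    (\<forall>x. (\<Sum>i<d. j (a i) * inc (x i * x i)) \<in> range inc \<longrightarrow>
      (\<Sum>i<d. j (u i) * inc (x i)) \<in> range inc \<and> (\<Sum>i<d. j (v i) * inc (x i)) \<in> range inc)"
proof -
  obtain u v where uv: "\<And>i. i \<in> {..<d::nat} \<Longrightarrow> a i - ((u i)\<^sup>2 + pi * (v i)\<^sup>2) \<in> A"
    "\<And>i k. i \<in> {..<d} \<Longrightarrow> k \<in> {..<d} \<Longrightarrow> 2 * (u i * u k) \<in> A \<and> 2 * (pi * (v i * v k)) \<in> A"
    using square_decomposition_family[of "{..<d}" a] a by auto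
  show ?thesis
  proof (intro exI conjI allI impI)
    fix x :: "nat \<Rightarrow> 'f" assume x: "\<forall>i<d. x i \<in> A"
    show "((\<Sum>i<d. a i * (x i * x i)) \<in> A) = ((\<Sum>i<d. u i * x i) \<in> A \<and> (\<Sum>i<d. v i * x i) \<in> A)"
      by (rule quadratic_integral_iff_linear_integral[of "\<lambda>x. x" A])
        (use A_closed A_mult A_reduced x uv in \<open>auto simp: mult.commute\<close>)
  next
    fix x :: "nat \<Rightarrow> 'r" assume *: "(\<Sum>i<d. j (a i) * inc (x i * x i)) \<in> range inc"
    have "(\<Sum>i<d. j (a i) * (inc (x i) * inc (x i))) \<in> range inc \<longleftrightarrow>
        (\<Sum>i<d. j (u i) * inc (x i)) \<in> range inc \<and> (\<Sum>i<d. j (v i) * inc (x i)) \<in> range inc"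
      by (rule quadratic_integral_iff_linear_integral[of j "range inc"]) (fact j_hom j_central inc_range inc_reduced uv | simp)+
    then show "(\<Sum>i<d. j (u i) * inc (x i)) \<in> range inc" "(\<Sum>i<d. j (v i) * inc (x i)) \<in> range inc"
      using * by (auto simp: inc_hom(3))
  qed
qed

text \<open>The hypothesis is what \<open>2 * a i = 0\<close> gives in a field. The first
  alternative uses the exact decomposition, hence completeness; in the second
  \<open>u = v = 0\<close> will do.\<close>

lemma vanishing_condition_linear:
  fixes d :: nat
  assumes "(2::'f) = 0 \<or> (\<forall>i<d. a i = 0)"
  shows "\<exists>u v. (\<forall>x. (\<forall>i<d. x i \<in> A) \<longrightarrow>
      ((\<Sum>i<d. a i * (x i * x i)) = 0 \<longleftrightarrow> (\<Sum>i<d. u i * x i) = 0 \<and> (\<Sum>i<d. v i * x i) = 0)) \<and>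
    (\<forall>x. (\<Sum>i<d. j (a i) * inc (x i * x i)) = 0 \<longrightarrow>
      (\<Sum>i<d. j (u i) * inc (x i)) = 0 \<and> (\<Sum>i<d. j (v i) * inc (x i)) = 0)"
proof (cases "(2::'f) = 0")
  case False
  then show ?thesis using assms by (intro exI[of _ "\<lambda>_. 0"]) (auto simp: j_hom)
next
  case True
  have "\<forall>i. \<exists>u v. a i = u\<^sup>2 + pi * v\<^sup>2" using exact_square_decomposition[OF True] by blast
  then obtain u v where uv: "\<And>i. a i = (u i)\<^sup>2 + pi * (v i)\<^sup>2" by metis
  show ?thesis
  proof (intro exI conjI allI impI)
    fix x :: "nat \<Rightarrow> 'f" assume x: "\<forall>i<d. x i \<in> A"
    show "((\<Sum>i<d. a i * (x i * x i)) = 0) = ((\<Sum>i<d. u i * x i) = 0 \<and> (\<Sum>i<d. v i * x i) = 0)"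
    proof (rule quadratic_zero_iff_linear_zero[OF True, of "\<lambda>x. x" A])
      show "r = 0 \<and> s = 0" if "r * r + pi * (s * s) = 0" for r s
        using that by (intro A_square_zero) (simp add: power2_eq_square)
    qed (fact A_closed A_mult | rule uv | simp add: mult.commute x)+
  next
    fix x :: "nat \<Rightarrow> 'r" assume *: "(\<Sum>i<d. j (a i) * inc (x i * x i)) = 0"
    have zero: "r = 0 \<and> s = 0" if rs: "r \<in> range inc" "s \<in> range inc" "r * r + j pi * (s * s) = 0" for r s
    proof -
      obtain r' where r': "r = inc r'" using rs(1) by (rule rangeE)
      obtain s' where s': "s = inc s'" using rs(2) by (rule rangeE)
      have "r' = 0 \<and> s' = 0" using rs(3) unfolding r' s' by (rule square_zero[OF True])
      then show ?thesis unfolding r' s' by (simp only: inc_hom(4))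
    qed
    have "(\<Sum>i<d. j (a i) * (inc (x i) * inc (x i))) = 0 \<longleftrightarrow>
        (\<Sum>i<d. j (u i) * inc (x i)) = 0 \<and> (\<Sum>i<d. j (v i) * inc (x i)) = 0"
      by (rule quadratic_zero_iff_linear_zero[OF True, of j "range inc"]) (fact j_hom j_central inc_range zero | rule uv | simp)+
    then show "(\<Sum>i<d. j (u i) * inc (x i)) = 0" "(\<Sum>i<d. j (v i) * inc (x i)) = 0"
      using * by (auto simp: inc_hom(3))
  qed
qed

end

text \<open>Independent generators are extended to a basis of the whole space: membership means
  integral coordinates along the generators and zero coordinates elsewhere. \<open>P\<close> is
  finite; \<open>Z\<close> may be infinite, since the space will be the type of all functions on
  \<open>V\<close>.\<close>

lemma (in local_field) finitely_generated_by_functionals: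
  fixes sc :: "'f \<Rightarrow> 'm::ab_group_add \<Rightarrow> 'm"
  assumes vs: "vector_space sc" and fin: "finite S"
  shows "\<exists>P Z. finite P \<and> (\<forall>\<nu>\<in>P \<union> Z. functional sc \<nu>) \<and>
    (\<forall>x. x \<in> {\<Sum>s\<in>S. sc (c s) s | c. \<forall>s\<in>S. c s \<in> A} \<longleftrightarrow> (\<forall>\<nu>\<in>P. \<nu> x \<in> A) \<and> (\<forall>\<nu>\<in>Z. \<nu> x = 0))"
proof -
  interpret vector_space sc by (rule vs)
  obtain G where G: "G \<subseteq> S" "independent G"
    "{\<Sum>s\<in>G. sc (c s) s | c. \<forall>s\<in>G. c s \<in> A} = {\<Sum>s\<in>S. sc (c s) s | c. \<forall>s\<in>S. c s \<in> A}"
    using independent_generators[OF vs fin] by (elim exE conjE) (rule that)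
  have finG: "finite G" using G(1) fin finite_subset by blast
  define E where "E = extend_basis G"
  define \<nu> where "\<nu> = (\<lambda>b x. representation E x b)"
  have GE: "G \<subseteq> E" unfolding E_def by (rule extend_basis_superset[OF G(2)])
  have E: "independent E" "span E = UNIV" unfolding E_def
    using independent_extend_basis[OF G(2)] span_extend_basis[OF G(2)] by auto
  have iff: "x \<in> {\<Sum>s\<in>G. sc (c s) s | c. \<forall>s\<in>G. c s \<in> A} \<longleftrightarrow> (\<forall>b\<in>G. \<nu> b x \<in> A) \<and> (\<forall>b\<in>E - G. \<nu> b x = 0)" for x
  proof
    assume "x \<in> {\<Sum>s\<in>G. sc (c s) s | c. \<forall>s\<in>G. c s \<in> A}"
    then obtain c where c: "x = (\<Sum>s\<in>G. sc (c s) s)" "\<forall>s\<in>G. c s \<in> A" by blast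
    have "\<nu> b x = (if b \<in> G then c b else 0)" for b
    proof -
      have "\<nu> b x = (\<Sum>s\<in>G. representation E (sc (c s) s) b)"
        unfolding c(1) \<nu>_def using E by (subst representation_sum) auto
      also have "\<dots> = (\<Sum>s\<in>G. if b = s then c s else 0)"
        by (rule sum.cong) (use E GE in \<open>auto simp: representation_scale representation_basis\<close>)
      finally show ?thesis using finG by simp
    qed
    then show "(\<forall>b\<in>G. \<nu> b x \<in> A) \<and> (\<forall>b\<in>E - G. \<nu> b x = 0)" using c(2) by simp
  next
    assume *: "(\<forall>b\<in>G. \<nu> b x \<in> A) \<and> (\<forall>b\<in>E - G. \<nu> b x = 0)"
    have sub: "{b. representation E x b \<noteq> 0} \<subseteq> G"
      using * representation_ne_zero unfolding \<nu>_def by blast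
    have "x = (\<Sum>b | representation E x b \<noteq> 0. sc (\<nu> b x) b)"
      using sum_nonzero_representation_eq[OF E(1), of x] E(2) unfolding \<nu>_def by simp
    also have "\<dots> = (\<Sum>b\<in>G. sc (\<nu> b x) b)"
      by (rule sum.mono_neutral_left[OF finG sub]) (simp add: \<nu>_def)
    finally have "x = (\<Sum>b\<in>G. sc (\<nu> b x) b)" .
    then show "x \<in> {\<Sum>s\<in>G. sc (c s) s | c. \<forall>s\<in>G. c s \<in> A}"
      using * by (intro CollectI exI[of _ "\<lambda>b. \<nu> b x"]) auto
  qed
  have "functional sc (\<nu> b)" for b
    unfolding \<nu>_def E_def by (rule functional_representation[OF G(2)])
  then show ?thesis using iff finG unfolding G(3)
    by (intro exI[of _ "\<nu> ` G"] exI[of _ "\<nu> ` (E - G)"]) auto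
qed

section \<open>Endomorphisms with adjoint\<close>

lemma linear_end_add: "linear_end act X \<Longrightarrow> X (v + w) = X v + X w"
  and linear_end_act: "linear_end act X \<Longrightarrow> X (act v x) = act (X v) x"
  by (auto simp: linear_end_def additive_map_def)

lemma linear_end_zero: "linear_end act X \<Longrightarrow> X 0 = 0"
  using linear_end_add[of act X 0 0] by simp

lemma linear_end_diff: "linear_end act X \<Longrightarrow> X (v - w) = X v - X w"
  using linear_end_add[of act X "v - w" w] by (simp add: eq_diff_eq)

lemma linear_end_sum: "linear_end act X \<Longrightarrow> X (\<Sum>i\<in>I. f i) = (\<Sum>i\<in>I. X (f i))"
  by (induction I rule: infinite_finite_induct) (auto simp: linear_end_zero linear_end_add)

text \<open>The calculus of adjoints, set up once for \<open>(V, h, T0(A))\<close> and for its base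
  change. \<open>T_adj\<close> asks for both adjunction identities because \<open>h\<close> carries
  no symmetry here.\<close>

locale adjoint_algebra =
  fixes act :: "'v::ab_group_add \<Rightarrow> 'k::ring \<Rightarrow> 'v" and h :: "'v \<Rightarrow> 'v \<Rightarrow> 'k" and T :: "('v \<Rightarrow> 'v) set"
  assumes h_add: "h (u + v) w = h u w + h v w" "h u (v + w) = h u v + h u w"
    and nondeg: "(\<And>v. h v w = 0) \<Longrightarrow> w = 0"
    and T_linear: "X \<in> T \<Longrightarrow> linear_end act X"
    and T_closed: "additively_closed T" "X \<in> T \<Longrightarrow> Y \<in> T \<Longrightarrow> X \<circ> Y \<in> T"
    and T_adj: "X \<in> T \<Longrightarrow> \<exists>Y\<in>T. \<forall>v w. h (X v) w = h v (Y w) \<and> h (Y v) w = h v (X w)"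
begin

abbreviation "ad \<equiv> adjoint_end act h"

lemma h_diff: "h u (v - w) = h u v - h u w"
  using h_add(2)[of u "v - w" w] by (simp add: eq_diff_eq)

lemma right_cancel: "(\<And>v. h v w = h v w') \<Longrightarrow> w = w'"
  using nondeg[of "w - w'"] by (simp add: h_diff)

lemma ad_eqI: "linear_end act Y \<Longrightarrow> (\<And>v w. h (X v) w = h v (Y w)) \<Longrightarrow> ad X = Y"
  unfolding adjoint_end_def
  by (rule the_equality) (auto intro!: ext right_cancel)

lemma ad: assumes "X \<in> T" shows "ad X \<in> T" "h (X v) w = h v (ad X w)" "h (ad X v) w = h v (X w)"
proof -
  obtain Y where Y: "Y \<in> T" "\<forall>v w. h (X v) w = h v (Y w) \<and> h (Y v) w = h v (X w)" using T_adj[OF assms] by blast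
  then have "ad X = Y" by (intro ad_eqI T_linear) auto
  then show "ad X \<in> T" "h (X v) w = h v (ad X w)" "h (ad X v) w = h v (X w)" using Y by auto
qed

lemma ad_ad: "X \<in> T \<Longrightarrow> ad (ad X) = X"
  by (rule ad_eqI) (simp_all add: T_linear ad(3))

lemma ad_comp: "X \<in> T \<Longrightarrow> Y \<in> T \<Longrightarrow> ad (X \<circ> Y) = ad Y \<circ> ad X"
  by (rule ad_eqI) (auto simp: T_linear T_closed ad)

lemma ad_diff: "X \<in> T \<Longrightarrow> Y \<in> T \<Longrightarrow> ad (X - Y) = ad X - ad Y"
proof (rule ad_eqI)
  assume X: "X \<in> T" "Y \<in> T"
  show "linear_end act (ad X - ad Y)" by (intro T_linear additively_closedD(2)[OF T_closed(1)] ad X)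
  fix v w
  have "h (X v - Y v) w = h (X v) w - h (Y v) w" using h_add(1)[of "X v - Y v" "Y v" w] by (simp add: eq_diff_eq)
  then show "h ((X - Y) v) w = h v ((ad X - ad Y) w)" using X by (simp add: h_diff ad(2)[symmetric])
qed

lemma ad_zero: "ad 0 = 0"
  using ad_diff[OF additively_closedD(1)[OF T_closed(1)] additively_closedD(1)[OF T_closed(1)]] by simp

lemma ad_add: "X \<in> T \<Longrightarrow> Y \<in> T \<Longrightarrow> ad (X + Y) = ad X + ad Y"
  using ad_diff[of "X + Y" Y] additively_closedD(4)[OF T_closed(1)] by (simp add: eq_diff_eq)

lemma ad_sum: "(\<And>i. i \<in> I \<Longrightarrow> f i \<in> T) \<Longrightarrow> ad (\<Sum>i\<in>I. f i) = (\<Sum>i\<in>I. ad (f i))"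
  by (induction I rule: infinite_finite_induct)
    (auto simp: ad_zero ad_add additively_closed_sum[OF T_closed(1)])

definition N :: "('v \<Rightarrow> 'v) set" where "N = (\<lambda>Y. Y + ad Y) ` T"

lemma N_closed: "additively_closed N"
proof -
  have "0 \<in> N" unfolding N_def
    by (rule image_eqI[of _ _ 0]) (simp_all add: ad_zero additively_closedD(1)[OF T_closed(1)])
  moreover have "x - y \<in> N" if xy: "x \<in> N" "y \<in> N" for x y
  proof -
    obtain X Y where "X \<in> T" "Y \<in> T" "x = X + ad X" "y = Y + ad Y" using xy unfolding N_def by blast
    then show ?thesis unfolding N_def
      by (intro image_eqI[of _ _ "X - Y"]) (auto simp: ad_diff additively_closedD(2)[OF T_closed(1)])
  qed
  ultimately show ?thesis by (simp add: additively_closed_def)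
qed

text \<open>\<open>phi0 h X\<close> is the form \<open>h v (X^ad X w)\<close> and
  \<open>psi0 h Y\<close> is \<open>h v ((Y + Y^ad) w)\<close>; nondegeneracy cancels
  \<open>h v\<close>.\<close>

lemma phi0_in_psi0: "X \<in> T \<Longrightarrow> phi0 h X \<in> psi0 h ` T \<longleftrightarrow> ad X \<circ> X \<in> N"
proof
  assume X: "X \<in> T"
  have psi: "psi0 h Y v w = h v ((Y + ad Y) w)" if "Y \<in> T" for Y v w
    by (simp add: psi0_def h_add ad(2)[OF that])
  have phi: "phi0 h X v w = h v ((ad X \<circ> X) w)" for v w
    by (simp add: phi0_def ad(2)[OF X])
  {
    assume "phi0 h X \<in> psi0 h ` T"
    then obtain Y where "Y \<in> T" "phi0 h X = psi0 h Y" by blast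
    then have "h v ((ad X \<circ> X) w) = h v ((Y + ad Y) w)" for v w using psi phi by metis
    then have "ad X \<circ> X = Y + ad Y" by (intro ext right_cancel)
    then show "ad X \<circ> X \<in> N" using \<open>Y \<in> T\<close> unfolding N_def by blast
  }
  {
    assume "ad X \<circ> X \<in> N"
    then obtain Y where "Y \<in> T" "ad X \<circ> X = Y + ad Y" unfolding N_def by blast
    then have "phi0 h X = psi0 h Y" by (intro ext) (simp only: psi phi)
    then show "phi0 h X \<in> psi0 h ` T" using \<open>Y \<in> T\<close> by blast
  }
qed

definition T1' :: "('v \<Rightarrow> 'v) set" where
  "T1' = {X \<in> T. phi0 h X \<in> psi0 h ` T \<and> phi0 h (ad X) \<in> psi0 h ` T}"

lemma T1'_iff: "X \<in> T1' \<longleftrightarrow> X \<in> T \<and> ad X \<circ> X \<in> N \<and> X \<circ> ad X \<in> N"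
  unfolding T1'_def using phi0_in_psi0[of X] phi0_in_psi0[of "ad X"] ad_ad[of X] ad(1)[of X] by auto

text \<open>Polarisation: \<open>Y^ad X\<close> is the adjoint of \<open>X^ad Y\<close>. Hence
  \<open>X^ad X\<close> is additive in \<open>X\<close> modulo \<open>N\<close>.\<close>

lemma cross_in_N: "X \<in> T \<Longrightarrow> Y \<in> T \<Longrightarrow> (ad X \<circ> Y) + (ad Y \<circ> X) \<in> N"
  unfolding N_def by (rule image_eqI[of _ _ "ad X \<circ> Y"]) (auto simp: ad_comp ad_ad ad T_closed)

lemma cross_in_N': "X \<in> T \<Longrightarrow> Y \<in> T \<Longrightarrow> (X \<circ> ad Y) + (Y \<circ> ad X) \<in> N"
  using cross_in_N[of "ad X" "ad Y"] by (simp add: ad ad_ad)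

lemma comp_diff_distrib:
  assumes "X \<in> T" "Y \<in> T" "X' \<in> T" "Y' \<in> T"
  shows "(X - Y) \<circ> (X' - Y') = (X \<circ> X') + (Y \<circ> Y') - ((X \<circ> Y') + (Y \<circ> X'))"
  by (rule ext) (simp add: linear_end_diff[OF T_linear[OF assms(1)]] linear_end_diff[OF T_linear[OF assms(2)]])

text \<open>Expanding the two products for \<open>X - Y\<close> leaves cross terms, which lie in
  \<open>N\<close>.\<close>

lemma T1'_closed: "additively_closed T1'"
proof -
  have "0 \<in> T1'"
    unfolding T1'_iff using additively_closedD(1)[OF T_closed(1)] additively_closedD(1)[OF N_closed]
    by (simp add: ad_zero) (simp add: comp_def zero_fun_def)
  moreover have "X - Y \<in> T1'" if XY: "X \<in> T1'" "Y \<in> T1'" for X Y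
  proof -
    note x = XY(1)[unfolded T1'_iff] XY(2)[unfolded T1'_iff]
    have "(ad X \<circ> X) + (ad Y \<circ> Y) - ((ad X \<circ> Y) + (ad Y \<circ> X)) \<in> N"
      by (rule additively_closedD(2)[OF N_closed additively_closedD(4)[OF N_closed]])
        (use x cross_in_N in auto)
    moreover have "(X \<circ> ad X) + (Y \<circ> ad Y) - ((X \<circ> ad Y) + (Y \<circ> ad X)) \<in> N"
      by (rule additively_closedD(2)[OF N_closed additively_closedD(4)[OF N_closed]])
        (use x cross_in_N' in auto)
    ultimately show ?thesis unfolding T1'_iff
      using x ad additively_closedD(2)[OF T_closed(1)] by (simp add: ad_diff comp_diff_distrib)
  qed
  ultimately show ?thesis by (simp add: additively_closed_def)
qed

text \<open>Both products get multiplied by \<open>s^2\<close>, and \<open>N\<close> is stable under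
  this because \<open>s\<close> is central and self-adjoint. It serves for scalars from
  \<open>A\<close> and from \<open>R\<close>.\<close>

lemma T1'_scale:
  assumes s: "s \<in> T" "ad s = s" "\<And>X. X \<in> T \<Longrightarrow> s \<circ> X = X \<circ> s" and X: "X \<in> T1'"
  shows "s \<circ> X \<in> T1'"
proof -
  note x = X[unfolded T1'_iff]
  have c: "s (Z v) = Z (s v)" if "Z \<in> T" for Z v
    using fun_cong[OF s(3)[OF that], of v] by (simp only: comp_apply)
  have sN: "s \<circ> s \<circ> W \<in> N" if W: "W \<in> N" for W
  proof -
    obtain Y where Y: "Y \<in> T" "W = Y + ad Y" using W unfolding N_def by blast
    have "ad (s \<circ> s \<circ> Y) = ad Y \<circ> (s \<circ> s)" by (simp add: ad_comp T_closed(2) s(1,2) Y(1))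
    also have "\<dots> = s \<circ> s \<circ> ad Y" using c[OF ad(1)[OF Y(1)]] by (simp add: fun_eq_iff)
    finally have "s \<circ> s \<circ> W = (s \<circ> s \<circ> Y) + ad (s \<circ> s \<circ> Y)" unfolding Y(2)
      by (intro ext) (simp add: linear_end_add[OF T_linear[OF s(1)]])
    then show ?thesis unfolding N_def using T_closed(2)[OF T_closed(2)[OF s(1) s(1)] Y(1)] by blast
  qed
  have sX: "s \<circ> X \<in> T" using s(1) x T_closed by blast
  have a: "ad (s \<circ> X) = ad X \<circ> s" using ad_comp[of s X] s(1,2) x by simp
  have XT: "X \<in> T" "ad X \<in> T" using x ad(1) by auto
  have "ad (s \<circ> X) \<circ> (s \<circ> X) = s \<circ> s \<circ> (ad X \<circ> X)" "(s \<circ> X) \<circ> ad (s \<circ> X) = s \<circ> s \<circ> (X \<circ> ad X)"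
    unfolding a by (simp_all add: fun_eq_iff c[OF XT(1)] c[OF XT(2)])
  then show ?thesis unfolding T1'_iff using sX sN x by simp
qed

end

section \<open>Lattices and their coordinates\<close>

text \<open>An expansion of every vector in lattice vectors \<open>w k\<close> whose coefficients
  are integral exactly on \<open>\<Lambda>\<close>; independence of the \<open>w k\<close> is not
  asserted.\<close>

definition coordinates :: "'f::field set \<Rightarrow> ('f \<Rightarrow> 'm::ab_group_add \<Rightarrow> 'm) \<Rightarrow> 'm set \<Rightarrow> nat \<Rightarrow> (nat \<Rightarrow> 'm)
    \<Rightarrow> (nat \<Rightarrow> 'm \<Rightarrow> 'f) \<Rightarrow> bool" where
  "coordinates A sc \<Lambda> d w \<omega> \<longleftrightarrow> (\<forall>k<d. w k \<in> \<Lambda>) \<and> (\<forall>k. functional sc (\<omega> k)) \<and>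
    (\<forall>x. x \<in> \<Lambda> \<longleftrightarrow> (\<forall>k<d. \<omega> k x \<in> A)) \<and> (\<forall>x. x = (\<Sum>k<d. sc (\<omega> k x) (w k)))"

lemma coordinatesD:
  assumes "coordinates A sc \<Lambda> d w \<omega>"
  shows "k < d \<Longrightarrow> w k \<in> \<Lambda>" "functional sc (\<omega> k)" "x \<in> \<Lambda> \<longleftrightarrow> (\<forall>k<d. \<omega> k x \<in> A)"
    "x = (\<Sum>k<d. sc (\<omega> k x) (w k))"
  using assms unfolding coordinates_def by blast+

lemma (in local_field) coordinates_exist:
  fixes sc :: "'f \<Rightarrow> 'm::ab_group_add \<Rightarrow> 'm" and \<phi> :: "'t \<Rightarrow> 'm \<Rightarrow> 'f"
  assumes vs: "vector_space sc" and fin: "finite J" and fct: "\<And>t. t \<in> J \<Longrightarrow> functional sc (\<phi> t)"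
    and inj: "\<And>x. (\<And>t. t \<in> J \<Longrightarrow> \<phi> t x = 0) \<Longrightarrow> x = 0"
    and \<Lambda>: "\<And>x. x \<in> \<Lambda> \<longleftrightarrow> (\<forall>t\<in>J. \<phi> t x \<in> A)"
  shows "\<exists>d w \<omega>. coordinates A sc \<Lambda> d w \<omega>"
proof -
  have "module.subspace sc UNIV"
    using vs by (simp add: module_iff_vector_space[symmetric] module.subspace_UNIV)
  then have "\<exists>(d::nat) w g. (\<forall>k<d. w k \<in> UNIV \<and> (\<forall>t\<in>J. \<phi> t (w k) \<in> A)) \<and>
      (\<forall>k<d. \<forall>t\<in>J. g k t \<in> A) \<and> (\<forall>x\<in>UNIV. x = (\<Sum>k<d. sc (\<Sum>t\<in>J. g k t * \<phi> t x) (w k)))"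
    by (intro lattice_generators[OF vs fin]) (simp_all add: fct inj)
  then obtain d w g where w: "\<forall>k<(d::nat). w k \<in> UNIV \<and> (\<forall>t\<in>J. \<phi> t (w k) \<in> A)" and
    g: "\<forall>k<d. \<forall>t\<in>J. g k t \<in> A" and
    e: "\<forall>x\<in>UNIV. x = (\<Sum>k<d. sc (\<Sum>t\<in>J. g k t * \<phi> t x) (w k))" by (elim exE conjE) (rule that)
  define \<omega> where "\<omega> = (\<lambda>k x. \<Sum>t\<in>J. g k t * \<phi> t x)"
  have e': "x = (\<Sum>k<d. sc (\<omega> k x) (w k))" for x using e unfolding \<omega>_def by blast
  have "x \<in> \<Lambda> \<longleftrightarrow> (\<forall>k<d. \<omega> k x \<in> A)" for x
  proof
    assume "x \<in> \<Lambda>"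
    then show "\<forall>k<d. \<omega> k x \<in> A" using g \<Lambda> unfolding \<omega>_def by (auto intro!: A_sum A_mult)
  next
    assume *: "\<forall>k<d. \<omega> k x \<in> A"
    have "\<phi> t x \<in> A" if t: "t \<in> J" for t
    proof -
      have "\<phi> t x = (\<Sum>k<d. \<omega> k x * \<phi> t (w k))"
        using e'[of x] functional_sum[OF fct[OF t], of "\<lambda>k. sc (\<omega> k x) (w k)" "{..<d}"]
          functional_scale[OF fct[OF t]] by simp
      then show ?thesis using * w t by (auto intro!: A_sum A_mult)
    qed
    then show "x \<in> \<Lambda>" using \<Lambda> by blast
  qed
  moreover have "functional sc (\<omega> k)" for k unfolding \<omega>_def by (rule functional_combination[OF fct])
  ultimately have "coordinates A sc \<Lambda> d w \<omega>"
    unfolding coordinates_def using w \<Lambda> e' by (intro conjI allI impI) simp_all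
  then show ?thesis by blast
qed

locale lattice_setting = etale_setting nrm A pi \<iota> \<alpha> \<tau>K
  for nrm :: "'f::field \<Rightarrow> real" and A pi and \<iota> :: "'f \<Rightarrow> 'k::ring_1"
    and \<alpha> :: "'f \<Rightarrow> 'r::{comm_ring,comm_monoid_mult}" and \<tau>K :: "'k \<Rightarrow> 'r \<Rightarrow> 'kr::{ring,monoid_mult}" +
  fixes \<sigma> :: "'k \<Rightarrow> 'k" and \<epsilon> :: int and B :: "'k set"
    and act :: "'v::ab_group_add \<Rightarrow> 'k \<Rightarrow> 'v" and n :: nat and L Ls :: "'v set" and h :: "'v \<Rightarrow> 'v \<Rightarrow> 'k"
    and \<tau>V :: "'v \<Rightarrow> 'r \<Rightarrow> 'vr::ab_group_add" and actR :: "'vr \<Rightarrow> 'kr \<Rightarrow> 'vr" and hR :: "'vr \<Rightarrow> 'vr \<Rightarrow> 'kr"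
  assumes order: "is_order A \<iota> B" and \<sigma>_\<iota>: "\<sigma> (\<iota> a) = \<iota> a"
    and rmod: "right_module act" and free: "free_lattice act B n L" and herm: "hermitian_form act \<sigma> \<epsilon> h"
    and nondeg: "nondegenerate h" and Ls_eq: "Ls = dual_lattice h B L" and dual_Ls: "dual_lattice h B Ls = L"
    and tspace: "tensor_space A \<iota> \<alpha> \<tau>K act \<tau>V actR" and tform: "tensor_form \<tau>K \<tau>V h hR"
begin

section \<open>F-linear structure of V and of its endomorphisms, and the form over F\<close>

definition scV :: "'f \<Rightarrow> 'v \<Rightarrow> 'v" where "scV a v = act v (\<iota> a)"
text \<open>Scaling is defined on all functions from \<open>V\<close> to \<open>V\<close>, so that
  the type itself is a vector space with the endomorphisms as a subspace.\<close>

definition scE :: "'f \<Rightarrow> ('v \<Rightarrow> 'v) \<Rightarrow> 'v \<Rightarrow> 'v" where "scE a X = (\<lambda>v. act (X v) (\<iota> a))"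
definition scKR :: "'f \<Rightarrow> 'kr \<Rightarrow> 'kr" where "scKR a y = j a * y"

lemma scE_apply: "scE a X v = scV a (X v)"
  by (simp add: scE_def scV_def)

lemma act_simps: "act (v + w) x = act v x + act w x" "act v (x + y) = act v x + act v y"
  "act v 1 = v" "act v (x * y) = act (act v x) y"
  using rmod by (auto simp: right_module_def biadditive_map_def additive_map_def)

lemma act_zero: "act 0 x = 0" "act v 0 = 0"
  using act_simps(1)[of 0 0 x] act_simps(2)[of v 0 0] by auto

lemma act_diff: "act (v - w) x = act v x - act w x"
  using act_simps(1)[of "v - w" w x] by (simp add: eq_diff_eq)

lemma act_sum: "act (\<Sum>i\<in>I. f i) x = (\<Sum>i\<in>I. act (f i) x)"
  by (induction I rule: infinite_finite_induct) (auto simp: act_zero act_simps)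

lemma act_\<iota>: "act (act v x) (\<iota> a) = act (act v (\<iota> a)) x"
  using \<iota>_central[of a x] act_simps(4)[of v x "\<iota> a"] act_simps(4)[of v "\<iota> a" x] by simp

lemma vector_space_V: "vector_space scV"
proof
  show "scV a (scV b x) = scV (a * b) x" for a b x
    by (simp add: scV_def \<iota>_hom act_simps(4)) (rule act_\<iota>)
qed (simp_all add: scV_def \<iota>_hom act_simps)

lemma vector_space_E: "vector_space scE"
proof
  show "scE a (scE b X) = scE (a * b) X" for a b X
    by (rule ext) (simp add: scE_def \<iota>_hom act_simps(4), rule act_\<iota>)
qed (auto simp: scE_def \<iota>_hom act_simps)

lemma vector_space_KR: "vector_space scKR"
  by standard (auto simp: scKR_def j_hom distrib_left distrib_right mult.assoc)

lemma h_simps: "h (u + v) w = h u w + h v w" "h u (v + w) = h u v + h u w"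
  "h (act v x) w = \<sigma> x * h v w" "h v (act w y) = h v w * y" "h w v = of_int \<epsilon> * \<sigma> (h v w)"
proof -
  have "biadditive_map h" using herm unfolding hermitian_form_def by blast
  then show "h (u + v) w = h u w + h v w" "h u (v + w) = h u v + h u w"
    by (auto simp: biadditive_map_def additive_map_def)
  have *: "h (act v x) (act w y) = \<sigma> x * h v w * y" for v w x y
    using herm unfolding hermitian_form_def by blast
  show "h (act v x) w = \<sigma> x * h v w" using *[of v x w 1] by (simp add: act_simps)
  show "h v (act w y) = h v w * y" using *[of v 1 w y] *[of v 1 w 1] by (simp add: act_simps)
  show "h w v = of_int \<epsilon> * \<sigma> (h v w)" using herm unfolding hermitian_form_def by blast
qed

lemma h_zero: "h 0 w = 0" "h v 0 = 0"
  using h_simps(1)[of 0 0 w] h_simps(2)[of v 0 0] by auto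

lemma h_sum: "h v (\<Sum>i\<in>I. f i) = (\<Sum>i\<in>I. h v (f i))"
  by (induction I rule: infinite_finite_induct) (auto simp: h_zero h_simps(2))

lemma h_sum_left: "h (\<Sum>i\<in>I. f i) w = (\<Sum>i\<in>I. h (f i) w)"
  by (induction I rule: infinite_finite_induct) (auto simp: h_zero h_simps(1))

lemma left_nondegenerate: "(\<And>w. h v w = 0) \<Longrightarrow> v = 0"
  using nondeg unfolding nondegenerate_def by blast

lemma right_nondegenerate:
  assumes "\<And>v. h v w = 0"
  shows "w = 0"
proof (rule left_nondegenerate)
  fix v
  have "of_int \<epsilon> * \<sigma> 0 = (0 :: 'k)" using h_simps(5)[of 0 0] by (simp add: h_zero)
  then show "h w v = 0" using h_simps(5)[of w v] assms by simp
qed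

text \<open>Independent \<open>A\<close>-generators of \<open>B\<close> also span \<open>K\<close>,
  because \<open>B\<close> does; they form an \<open>F\<close>-basis of \<open>K\<close> whose
  coordinates detect \<open>B\<close>.\<close>

lemma order_coordinates:
  obtains G \<kappa> where "finite G" "\<And>s. functional (\<lambda>a x. \<iota> a * x) (\<kappa> s)"
    "\<And>x. x \<in> B \<longleftrightarrow> (\<forall>s\<in>G. \<kappa> s x \<in> A)" "\<And>x. x = (\<Sum>s\<in>G. \<iota> (\<kappa> s x) * s)"
proof -
  interpret K: vector_space "\<lambda>a x. \<iota> a * x" by (rule vector_space_K)
  obtain S where S: "finite S" "B = {\<Sum>s\<in>S. \<iota> (c s) * s | c. \<forall>s\<in>S. c s \<in> A}" and sp: "K.span B = UNIV"
    using order unfolding is_order_def by blast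
  from independent_generators[OF vector_space_K S(1)] obtain G where
    G: "G \<subseteq> S" "K.independent G" "{\<Sum>s\<in>G. \<iota> (c s) * s | c. \<forall>s\<in>G. c s \<in> A} = B"
    unfolding S(2)[symmetric] by (elim exE conjE) (rule that)
  have fin: "finite G" using G(1) S(1) finite_subset by blast
  have "B \<subseteq> K.span G"
  proof
    fix b assume "b \<in> B"
    then have "b \<in> {\<Sum>s\<in>G. \<iota> (c s) * s | c. \<forall>s\<in>G. c s \<in> A}" by (simp only: G(3))
    then obtain c where "b = (\<Sum>s\<in>G. \<iota> (c s) * s)" by blast
    then show "b \<in> K.span G" by (simp add: K.span_sum K.span_scale K.span_base)
  qed
  then have "K.span B \<subseteq> K.span G" by (rule K.span_minimal) simp
  then have spG: "K.span G = UNIV" using sp by blast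
  define \<kappa> where "\<kappa> = (\<lambda>s x. K.representation G x s)"
  have x: "x = (\<Sum>s\<in>G. \<iota> (\<kappa> s x) * s)" for x
    unfolding \<kappa>_def by (rule K.sum_representation_eq[symmetric]) (use G(2) spG fin in auto)
  have f: "functional (\<lambda>a x. \<iota> a * x) (\<kappa> s)" for s
    unfolding functional_def \<kappa>_def using G(2) spG by (auto simp: K.representation_add K.representation_scale)
  have "x \<in> B \<longleftrightarrow> (\<forall>s\<in>G. \<kappa> s x \<in> A)" for x
  proof
    assume "\<forall>s\<in>G. \<kappa> s x \<in> A"
    then have "x \<in> {\<Sum>s\<in>G. \<iota> (c s) * s | c. \<forall>s\<in>G. c s \<in> A}"
      using x by (intro CollectI exI[of _ "\<lambda>s. \<kappa> s x"]) simp
    then show "x \<in> B" by (simp only: G(3))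
  next
    assume "x \<in> B"
    then have "x \<in> {\<Sum>s\<in>G. \<iota> (c s) * s | c. \<forall>s\<in>G. c s \<in> A}" by (simp only: G(3))
    then obtain c where c: "x = (\<Sum>s\<in>G. \<iota> (c s) * s)" "\<forall>s\<in>G. c s \<in> A" by blast
    have "\<kappa> s x = c s" if "s \<in> G" for s
    proof -
      have "\<kappa> s x = (\<Sum>t\<in>G. K.representation G (\<iota> (c t) * t) s)"
        unfolding c(1) \<kappa>_def using G(2) spG by (subst K.representation_sum) auto
      also have "\<dots> = (\<Sum>t\<in>G. if s = t then c t else 0)"
        by (rule sum.cong) (use G(2) spG in \<open>auto simp: K.representation_scale K.representation_basis\<close>)
      finally show ?thesis using fin that by simp
    qed
    then show "\<forall>s\<in>G. \<kappa> s x \<in> A" using c(2) by simp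
  qed
  then show thesis using that[of G \<kappa>] fin f x by blast
qed

lemma B_closed: "additively_closed B" "x \<in> B \<Longrightarrow> y \<in> B \<Longrightarrow> x * y \<in> B" "1 \<in> B"
proof -
  show 1: "1 \<in> B" using order by (simp add: is_order_def)
  have d: "\<forall>x\<in>B. \<forall>y\<in>B. x - y \<in> B" using order by (simp add: is_order_def)
  have "0 \<in> B" using d 1 by force
  then show "additively_closed B" using d by (simp add: additively_closed_def)
  show "x \<in> B \<Longrightarrow> y \<in> B \<Longrightarrow> x * y \<in> B" using order by (simp add: is_order_def)
qed

lemma basis_coordinates:
  obtains e :: "nat \<Rightarrow> 'v" and co :: "'v \<Rightarrow> nat \<Rightarrow> 'k"
  where "\<And>v. v = (\<Sum>i<n. act (e i) (co v i))"
    "\<And>v c i. v = (\<Sum>i<n. act (e i) (c i)) \<Longrightarrow> i < n \<Longrightarrow> co v i = c i"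
    "\<And>v. v \<in> L \<longleftrightarrow> (\<forall>i<n. co v i \<in> B)"
proof -
  obtain e :: "nat \<Rightarrow> 'v" where e: "\<forall>v. \<exists>!c :: nat \<Rightarrow> 'k. (\<forall>i\<ge>n. c i = 0) \<and> v = (\<Sum>i<n. act (e i) (c i))"
    and L: "L = {\<Sum>i<n. act (e i) (c i) | c. \<forall>i<n. c i \<in> B}"
    using free unfolding free_lattice_def by blast
  define co where "co = (\<lambda>v. THE c. (\<forall>i\<ge>n. c i = 0) \<and> v = (\<Sum>i<n. act (e i) (c i)))"
  have co: "(\<forall>i\<ge>n. co v i = 0) \<and> v = (\<Sum>i<n. act (e i) (co v i))" for v
    unfolding co_def by (rule theI'[OF e[THEN spec]])
  have uniq: "co v i = c i" if v: "v = (\<Sum>i<n. act (e i) (c i))" and i: "i < n" for v c i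
  proof -
    define c' where "c' = (\<lambda>i. if i < n then c i else 0)"
    have "(\<forall>i\<ge>n. c' i = 0) \<and> v = (\<Sum>i<n. act (e i) (c' i))" using v by (simp add: c'_def)
    then have "co v = c'" unfolding co_def by (rule the1_equality[OF e[THEN spec]])
    then show ?thesis using i by (simp add: c'_def)
  qed
  have "v \<in> L \<longleftrightarrow> (\<forall>i<n. co v i \<in> B)" for v
  proof
    assume "v \<in> L"
    then obtain c where "v = (\<Sum>i<n. act (e i) (c i))" "\<forall>i<n. c i \<in> B" unfolding L by blast
    then show "\<forall>i<n. co v i \<in> B" using uniq by simp
  next
    assume "\<forall>i<n. co v i \<in> B"
    then show "v \<in> L" unfolding L using co by (intro CollectI exI[of _ "co v"]) simp
  qed
  then show thesis using co uniq by (intro that[of e co]) simp_all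
qed

lemma lattice_coordinates: "\<exists>d w \<omega>. coordinates A scV L d w \<omega>"
  and dual_lattice_coordinates: "\<exists>d w \<omega>. coordinates A scV Ls d w \<omega>"
proof -
  obtain G \<kappa> where G: "finite G" "\<And>s. functional (\<lambda>a x. \<iota> a * x) (\<kappa> s)"
    "\<And>x. x \<in> B \<longleftrightarrow> (\<forall>s\<in>G. \<kappa> s x \<in> A)" "\<And>x. x = (\<Sum>s\<in>G. \<iota> (\<kappa> s x) * s)" by (rule order_coordinates) (rule that)
  obtain e co where e: "\<And>v. v = (\<Sum>i<n. act (e i) (co v i))"
    "\<And>v c i. v = (\<Sum>i<n. act (e i) (c i)) \<Longrightarrow> i < n \<Longrightarrow> co v i = c i"
    "\<And>v. v \<in> L \<longleftrightarrow> (\<forall>i<n. co v i \<in> B)" by (rule basis_coordinates) (rule that)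
  have \<kappa>0: "x = 0" if "\<And>s. s \<in> G \<Longrightarrow> \<kappa> s x = 0" for x
  proof -
    have "(\<Sum>s\<in>G. \<iota> (\<kappa> s x) * s) = 0" using that by (simp add: \<iota>_0)
    then show ?thesis using G(4)[of x] by simp
  qed
  let ?J = "{..<n} \<times> G"
  show "\<exists>d w \<omega>. coordinates A scV L d w \<omega>"
  proof (rule coordinates_exist[OF vector_space_V, of ?J "\<lambda>(i, s) v. \<kappa> s (co v i)"])
    show "finite ?J" using G(1) by simp
    show "functional scV ((\<lambda>(i, s) v. \<kappa> s (co v i)) t)" if t: "t \<in> ?J" for t
    proof -
      obtain i s where ts: "t = (i, s)" "i < n" "s \<in> G" using t by auto
      have "co (v + w) i = co v i + co w i" for v w
      proof (rule e(2)[OF _ ts(2)])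
        have "v + w = (\<Sum>i<n. act (e i) (co v i)) + (\<Sum>i<n. act (e i) (co w i))" using e(1) by simp
        then show "v + w = (\<Sum>i<n. act (e i) (co v i + co w i))" by (simp add: act_simps sum.distrib)
      qed
      moreover have "co (scV a v) i = \<iota> a * co v i" for a v
      proof (rule e(2)[OF _ ts(2)])
        have "scV a v = act (\<Sum>i<n. act (e i) (co v i)) (\<iota> a)" using e(1) by (simp add: scV_def)
        then show "scV a v = (\<Sum>i<n. act (e i) (\<iota> a * co v i))" by (simp add: act_sum act_simps(4) act_\<iota>)
      qed
      ultimately show ?thesis unfolding ts(1)
        using functional_add[OF G(2)] functional_scale[OF G(2)] by (simp add: functional_def)
    qed
    show "v \<in> L \<longleftrightarrow> (\<forall>t\<in>?J. (\<lambda>(i, s) v. \<kappa> s (co v i)) t v \<in> A)" for v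
      unfolding e(3) G(3) by auto
    show "v = 0" if v: "\<And>t. t \<in> ?J \<Longrightarrow> (\<lambda>(i, s) v. \<kappa> s (co v i)) t v = 0" for v
    proof -
      have "co v i = 0" if "i < n" for i using v[of "(i, _)"] that by (intro \<kappa>0) auto
      then have "(\<Sum>i<n. act (e i) (co v i)) = 0" by (simp add: act_zero)
      then show ?thesis using e(1)[of v] by simp
    qed
  qed
  have h_e: "h v w = (\<Sum>i<n. h v (e i) * co w i)" for v w
  proof -
    have "h v w = h v (\<Sum>i<n. act (e i) (co w i))" using e(1) by simp
    then show ?thesis by (simp add: h_sum h_simps(4))
  qed
  have eL: "e i \<in> L" if "i < n" for i
  proof -
    have "act (e k) (if k = i then 1 else 0) = (if k = i then e k else 0)" for k
      by (simp add: act_simps act_zero)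
    then have ei: "e i = (\<Sum>k<n. act (e k) (if k = i then 1 else 0))" using that by simp
    have "co (e i) k = (if k = i then 1 else 0)" if "k < n" for k by (rule e(2)[OF ei that])
    then show ?thesis unfolding e(3) using B_closed(3) additively_closedD(1)[OF B_closed(1)] by simp
  qed
  \<comment> \<open>Here the values \<open>h v (e i)\<close> take the place of the coordinates of
    \<open>v\<close>: integrality against the basis gives integrality against all of
    \<open>L\<close>, since \<open>B\<close> is a ring.\<close>
  show "\<exists>d w \<omega>. coordinates A scV Ls d w \<omega>"
  proof (rule coordinates_exist[OF vector_space_V, of ?J "\<lambda>(i, s) v. \<kappa> s (h v (e i))"])
    show "finite ?J" using G(1) by simp
    show "functional scV ((\<lambda>(i, s) v. \<kappa> s (h v (e i))) t)" if "t \<in> ?J" for t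
      using functional_add[OF G(2)] functional_scale[OF G(2)]
      by (auto simp: functional_def case_prod_unfold h_simps(1,3) scV_def \<sigma>_\<iota>)
    show "v \<in> Ls \<longleftrightarrow> (\<forall>t\<in>?J. (\<lambda>(i, s) v. \<kappa> s (h v (e i))) t v \<in> A)" for v
    proof -
      have "v \<in> Ls \<longleftrightarrow> (\<forall>i<n. h v (e i) \<in> B)"
      proof
        assume "v \<in> Ls"
        then show "\<forall>i<n. h v (e i) \<in> B" using eL unfolding Ls_eq dual_lattice_def by blast
      next
        assume *: "\<forall>i<n. h v (e i) \<in> B"
        have "h v w \<in> B" if "w \<in> L" for w
          unfolding h_e[of v w] using * that unfolding e(3)
          by (intro additively_closed_sum[OF B_closed(1)] B_closed(2)) auto
        then show "v \<in> Ls" unfolding Ls_eq dual_lattice_def by blast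
      qed
      then show ?thesis unfolding G(3) by auto
    qed
    show "v = 0" if v: "\<And>t. t \<in> ?J \<Longrightarrow> (\<lambda>(i, s) v. \<kappa> s (h v (e i))) t v = 0" for v
    proof (rule left_nondegenerate)
      fix w
      have "h v (e i) = 0" if "i < n" for i using v[of "(i, _)"] that by (intro \<kappa>0) auto
      then show "h v w = 0" unfolding h_e[of v w] by simp
    qed
  qed
qed

text \<open>\<open>G\<close> is the Gram matrix of \<open>h\<close> as an endomorphism of
  \<open>V\<close>. It is injective by nondegeneracy, and bijective by counting dimensions over
  \<open>F\<close>, which avoids linear algebra over a \<open>K\<close> that may be noncommutative
  or split. Being \<open>K\<close>-linear with \<open>K\<close>-linear inverse, it can be
  base-changed to \<open>R\<close>.\<close>

lemma gram_map:
  obtains e :: "nat \<Rightarrow> 'v" and G G' :: "'v \<Rightarrow> 'v"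
  where "\<And>v. \<exists>c. v = (\<Sum>i<n. act (e i) (c i))" "G = (\<lambda>w. \<Sum>i<n. act (e i) (h (e i) w))"
    "linear_end act G" "linear_end act G'" "\<And>w. G' (G w) = w"
    "\<And>w c i. G w = (\<Sum>i<n. act (e i) (c i)) \<Longrightarrow> i < n \<Longrightarrow> h (e i) w = c i" "\<And>u. \<exists>w. G w = u"
proof -
  obtain e co where e: "\<And>v. v = (\<Sum>i<n. act (e i) (co v i))"
    "\<And>v c i. v = (\<Sum>i<n. act (e i) (c i)) \<Longrightarrow> i < n \<Longrightarrow> co v i = c i" and "\<And>v. v \<in> L \<longleftrightarrow> (\<forall>i<n. co v i \<in> B)"
    by (rule basis_coordinates) (rule that)
  obtain d w \<omega> where cd: "coordinates A scV L d w \<omega>" using lattice_coordinates by blast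
  interpret V: vector_space scV by (rule vector_space_V)
  define G where "G = (\<lambda>w. \<Sum>i<n. act (e i) (h (e i) w))"
  have G_inj: "h (e i) w = c i" if "G w = (\<Sum>i<n. act (e i) (c i))" "i < n" for w c i
    using e(2)[of "G w" "\<lambda>i. h (e i) w" i] e(2)[OF that] that(2) unfolding G_def by simp
  have lin: "linear_end act G"
    unfolding linear_end_def additive_map_def G_def
    by (auto simp: h_simps(2,4) act_simps(2,4) sum.distrib act_sum)
  have zero: "w = 0" if "G w = 0" for w
  proof (rule right_nondegenerate)
    fix v
    have "G w = (\<Sum>i<n. act (e i) 0)" using that by (simp add: act_zero)
    then have "h (e i) w = 0" if "i < n" for i using G_inj[of w "\<lambda>_. 0"] that by blast
    then have "h (\<Sum>i<n. act (e i) (co v i)) w = 0" by (simp add: h_sum_left h_simps(3))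
    then show "h v w = 0" using e(1)[of v] by simp
  qed
  have inj: "inj G"
  proof (rule injI)
    fix x y assume "G x = G y"
    then show "x = y" using zero[of "x - y"] linear_end_diff[OF lin] by simp
  qed
  have span: "V.span (w ` {..<d}) = UNIV"
  proof -
    have "x \<in> V.span (w ` {..<d})" for x
      by (subst coordinatesD(4)[OF cd, of x]) (intro V.span_sum V.span_scale V.span_base, simp)
    then show ?thesis by blast
  qed
  obtain Bs where Bs: "Bs \<subseteq> w ` {..<d}" "V.independent Bs" "w ` {..<d} \<subseteq> V.span Bs"
    using V.maximal_independent_subset[of "w ` {..<d}"] by metis
  have "V.span Bs = UNIV" using V.span_minimal[OF Bs(3)] span by auto
  then interpret FV: finite_dimensional_vector_space scV Bs
    using Bs finite_subset[OF Bs(1)] by unfold_locales auto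
  have "Vector_Spaces.linear scV scV G"
    unfolding Vector_Spaces.linear_iff by (simp add: vector_space_V linear_end_add[OF lin] linear_end_act[OF lin] scV_def)
  then have surj: "surj G" using inj by (rule FV.linear_inj_imp_surj)
  define G' where "G' = inv G"
  have GG: "G' (G w) = w" "G (G' w) = w" for w using inj surj unfolding G'_def by (auto simp: surj_f_inv_f)
  have lin': "linear_end act G'"
    unfolding linear_end_def additive_map_def
    by (metis GG linear_end_add[OF lin] linear_end_act[OF lin])
  show thesis
    
  proof (rule that[of e G G'])
    show "\<exists>c. v = (\<Sum>i<n. act (e i) (c i))" for v using e(1)[of v] by blast
    show "\<exists>w. G w = u" for u using GG(2) by blast
  qed (fact G_def lin lin' GG(1) G_inj)+
qed

text \<open>Surjectivity of the Gram map represents \<open>v \<mapsto> h (X v) w\<close> by a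
  vector, which is \<open>Y w\<close>. The second identity follows from hermitian symmetry.\<close>

lemma adjoint_exists:
  assumes X: "linear_end act X"
  obtains Y where "linear_end act Y" "\<And>v w. h (X v) w = h v (Y w)" "\<And>v w. h (Y v) w = h v (X w)"
proof -
  obtain e G G' where G: "\<And>v. \<exists>c. v = (\<Sum>i<n. act (e i) (c i))" "G = (\<lambda>w. \<Sum>i<n. act (e i) (h (e i) w))"
    "linear_end act G" "linear_end act G'" "\<And>w. G' (G w) = w"
    "\<And>w c i. G w = (\<Sum>i<n. act (e i) (c i)) \<Longrightarrow> i < n \<Longrightarrow> h (e i) w = c i" "\<And>u. \<exists>w. G w = u"
    by (rule gram_map) (rule that)
  have "\<exists>u. \<forall>v. h v u = h (X v) w" for w
  proof -
    obtain u where u: "G u = (\<Sum>i<n. act (e i) (h (X (e i)) w))" using G(7) by blast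
    have "h v u = h (X v) w" for v
    proof -
      obtain c where c: "v = (\<Sum>i<n. act (e i) (c i))" using G(1) by blast
      then show ?thesis
        by (simp add: h_sum_left h_simps(3) linear_end_sum[OF X] linear_end_act[OF X] G(6)[OF u])
    qed
    then show ?thesis by blast
  qed
  then obtain Y where Y: "\<And>v w. h v (Y w) = h (X v) w" by metis
  have cancel: "u = u'" if "\<And>v. h v u = h v u'" for u u'
  proof -
    have "h v (u - u') = 0" for v using h_simps(2)[of v "u - u'" u'] that by simp
    then show ?thesis using right_nondegenerate[of "u - u'"] by simp
  qed
  have "linear_end act Y"
    unfolding linear_end_def additive_map_def
    by (auto intro!: cancel simp: Y h_simps(2,4))
  moreover have "h (Y v) w = h v (X w)" for v w
    using h_simps(5)[of "Y v" w] h_simps(5)[of v "X w"] Y[of w v] by simp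
  ultimately show thesis using that[of Y] Y by simp
qed

lemma linear_end_closed:
  assumes "linear_end act X" "linear_end act Y"
  shows "linear_end act (X + Y)" "linear_end act (X - Y)" "linear_end act (X \<circ> Y)" "linear_end act (scE a X)"
  using assms unfolding linear_end_def additive_map_def
  by (auto simp: act_simps(1) act_diff scE_def act_\<iota>)

lemma linear_end_zero_map: "linear_end act 0"
  by (simp add: linear_end_def additive_map_def act_zero)

section \<open>Base change\<close>

lemma tproduct_V: "tensor_product A scV \<alpha> UNIV \<tau>V UNIV"
  using tspace unfolding tensor_space_def scV_def[abs_def] by blast

lemma actR_simps: "actR (y + y') z = actR y z + actR y' z" "actR y (z + z') = actR y z + actR y z'"
  "actR (\<tau>V v r) (\<tau>K x s) = \<tau>V (act v x) (r * s)"
  using tspace by (auto simp: tensor_space_def biadditive_map_def additive_map_def)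

lemma actR_zero: "actR 0 z = 0" "actR y 0 = 0"
  using actR_simps(1)[of 0 0 z] actR_simps(2)[of y 0 0] by auto

lemma \<tau>V_add: "\<tau>V (v + w) r = \<tau>V v r + \<tau>V w r" "\<tau>V v (r + s) = \<tau>V v r + \<tau>V v s"
  and \<tau>V_scale: "a \<in> A \<Longrightarrow> \<tau>V (scV a v) r = \<tau>V v (\<alpha> a * r)"
  using tensor_productD[OF tproduct_V] by auto

lemma \<tau>V_zero: "\<tau>V 0 r = 0"
  using \<tau>V_add(1)[of 0 0 r] by auto

lemma \<tau>V_sum: "\<tau>V (\<Sum>i\<in>I. f i) r = (\<Sum>i\<in>I. \<tau>V (f i) r)"
  by (induction I rule: infinite_finite_induct) (auto simp: \<tau>V_zero \<tau>V_add)

lemma VR_induct [case_names zero pure add]: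
  assumes "P 0" "\<And>v r. P (\<tau>V v r)" "\<And>y z. P y \<Longrightarrow> P z \<Longrightarrow> P (y + z)"
  shows "P y"
  by (rule tensor_image_induct[of y \<tau>V UNIV P])
    (use tensor_productD(4)[OF tproduct_V] assms in auto)

lemma actR_mult: "actR (actR y z) z' = actR y (z * z')"
proof (induction y rule: VR_induct)
  case (pure v r)
  show ?case
  proof (induction z rule: KR_induct)
    case (pure x s)
    show ?case
      by (induction z' rule: KR_induct)
        (auto simp: actR_simps \<tau>K_mult act_simps mult.assoc actR_zero distrib_left)
  qed (auto simp: actR_simps actR_zero distrib_right)
qed (auto simp: actR_simps actR_zero)

lemma actR_one: "actR y 1 = y"
  by (induction y rule: VR_induct) (auto simp: \<tau>K_1[symmetric] actR_simps act_simps(3) actR_zero)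

lemma pure_eq: "\<tau>V v r = actR (\<tau>V v 1) (inc r)"
  by (simp add: inc_def actR_simps act_simps(3))

lemma linear_endR_eqI:
  assumes X: "linear_end actR X" "linear_end actR Y" and eq: "\<And>v. X (\<tau>V v 1) = Y (\<tau>V v 1)"
  shows "X = Y"
proof
  fix y show "X y = Y y"
  proof (induction y rule: VR_induct)
    case (pure v r)
    then show ?case by (simp add: pure_eq[of v r] linear_end_act[OF X(1)] linear_end_act[OF X(2)] eq)
  qed (simp_all add: linear_end_zero[OF X(1)] linear_end_zero[OF X(2)] linear_end_add[OF X(1)] linear_end_add[OF X(2)])
qed

text \<open>The base change of \<open>\<omega>\<close> to \<open>V \<otimes> R\<close>, with
  \<open>F \<otimes> R\<close> realised inside \<open>K \<otimes> R\<close>.\<close>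

definition ext_fun :: "('v \<Rightarrow> 'f) \<Rightarrow> 'vr \<Rightarrow> 'kr" where
  "ext_fun \<omega> = (SOME g. (\<forall>x y. g (x + y) = g x + g y) \<and> (\<forall>v r. g (\<tau>V v r) = j (\<omega> v) * inc r))"

lemma ext_fun:
  assumes "functional scV \<omega>"
  shows "ext_fun \<omega> (x + y) = ext_fun \<omega> x + ext_fun \<omega> y" "ext_fun \<omega> (\<tau>V v r) = j (\<omega> v) * inc r"
proof -
  have "balanced_mod A scV \<alpha> UNIV {0} (\<lambda>v r. j (\<omega> v) * inc r)"
    unfolding balanced_mod_def
    by (auto simp: functional_add[OF assms] functional_scale[OF assms] j_hom inc_hom inc_\<alpha>1
        distrib_left distrib_right mult.assoc) (metis j_central mult.assoc)
  then obtain g where "\<And>x y. g (x + y) = g x + g y" "\<And>v r. g (\<tau>V v r) = j (\<omega> v) * inc r"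
    using tensor_product_lift[OF tproduct_V] by metis
  then have "(\<forall>x y. ext_fun \<omega> (x + y) = ext_fun \<omega> x + ext_fun \<omega> y) \<and> (\<forall>v r. ext_fun \<omega> (\<tau>V v r) = j (\<omega> v) * inc r)"
    unfolding ext_fun_def by (intro someI_ex[where P = "\<lambda>g. (\<forall>x y. g (x + y) = g x + g y) \<and> (\<forall>v r. g (\<tau>V v r) = j (\<omega> v) * inc r)"]) blast
  then show "ext_fun \<omega> (x + y) = ext_fun \<omega> x + ext_fun \<omega> y" "ext_fun \<omega> (\<tau>V v r) = j (\<omega> v) * inc r" by auto
qed

lemma ext_fun_zero: "functional scV \<omega> \<Longrightarrow> ext_fun \<omega> 0 = 0"
  using ext_fun(1)[of \<omega> 0 0] by simp

text \<open>The expansion of vectors of \<open>V\<close> extends additively from pure tensors. It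
  recognises \<open>\<Lambda> \<otimes> R\<close> inside \<open>V \<otimes> R\<close> by coordinates
  in \<open>R\<close>.\<close>

lemma coordinates_R:
  assumes cd: "coordinates A scV \<Lambda> d w \<omega>"
  shows "y = (\<Sum>k<d. actR (\<tau>V (w k) 1) (ext_fun (\<omega> k) y))"
    and "y \<in> tensor_image \<tau>V \<Lambda> \<longleftrightarrow> (\<forall>k<d. ext_fun (\<omega> k) y \<in> range inc)"
proof -
  note f = coordinatesD(2)[OF cd]
  show eq: "y = (\<Sum>k<d. actR (\<tau>V (w k) 1) (ext_fun (\<omega> k) y))" for y
  proof (induction y rule: VR_induct)
    case (pure v r)
    have "\<tau>V v r = \<tau>V (\<Sum>k<d. scV (\<omega> k v) (w k)) r" using coordinatesD(4)[OF cd, of v] by simp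
    also have "\<dots> = (\<Sum>k<d. actR (\<tau>V (w k) 1) (ext_fun (\<omega> k) (\<tau>V v r)))"
      by (simp add: \<tau>V_sum ext_fun[OF f] j_inc actR_simps scV_def)
    finally show ?case .
  next
    case (add y z)
    have "(\<Sum>k<d. actR (\<tau>V (w k) 1) (ext_fun (\<omega> k) (y + z)))
      = (\<Sum>k<d. actR (\<tau>V (w k) 1) (ext_fun (\<omega> k) y)) + (\<Sum>k<d. actR (\<tau>V (w k) 1) (ext_fun (\<omega> k) z))"
      by (simp add: ext_fun[OF f] actR_simps sum.distrib)
    then show ?case using add by simp
  qed (simp add: ext_fun_zero[OF f] actR_zero)
  show "y \<in> tensor_image \<tau>V \<Lambda> \<longleftrightarrow> (\<forall>k<d. ext_fun (\<omega> k) y \<in> range inc)"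
  proof
    assume "y \<in> tensor_image \<tau>V \<Lambda>"
    then show "\<forall>k<d. ext_fun (\<omega> k) y \<in> range inc"
    proof (induction y rule: tensor_image_induct)
      case zero
      then show ?case using additively_closedD(1)[OF inc_range(1)] by (simp add: ext_fun_zero[OF f])
    next
      case (pure v r)
      then have "\<omega> k v \<in> A" if "k < d" for k using coordinatesD(3)[OF cd] that by blast
      then show ?case using inc_range(2,4) by (simp add: ext_fun[OF f])
    next
      case (add x y)
      then show ?case using additively_closedD(4)[OF inc_range(1)] by (simp add: ext_fun[OF f])
    qed
  next
    assume *: "\<forall>k<d. ext_fun (\<omega> k) y \<in> range inc"
    have sum: "(\<Sum>k\<in>I. g k) \<in> tensor_image \<tau>V \<Lambda>" if "finite I" "\<And>k. k \<in> I \<Longrightarrow> g k \<in> tensor_image \<tau>V \<Lambda>" for g and I :: "nat set"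
      using that by (induction I rule: finite_induct) (auto intro: tensor_image_zero tensor_image_add)
    have "(\<Sum>k<d. actR (\<tau>V (w k) 1) (ext_fun (\<omega> k) y)) \<in> tensor_image \<tau>V \<Lambda>"
    proof (rule sum)
      fix k assume "k \<in> {..<d}"
      then obtain r where "ext_fun (\<omega> k) y = inc r" "w k \<in> \<Lambda>" using * coordinatesD(1)[OF cd] by blast
      then show "actR (\<tau>V (w k) 1) (ext_fun (\<omega> k) y) \<in> tensor_image \<tau>V \<Lambda>"
        by (simp add: pure_eq[symmetric] tensor_image_pure)
    qed simp
    then show "y \<in> tensor_image \<tau>V \<Lambda>" using eq[of y] by simp
  qed
qed

text \<open>Along \<open>inc\<close>, an \<open>F\<close>-linear functional \<open>\<mu>\<close> on
  \<open>K \<otimes> R\<close> restricts to \<open>R\<close>; this is the induced map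
  \<open>V \<otimes> R \<rightarrow> V\<close>. Such maps trade an equation over \<open>R\<close>
  for equations over \<open>F\<close>.\<close>

definition contract :: "('kr \<Rightarrow> 'f) \<Rightarrow> 'vr \<Rightarrow> 'v" where
  "contract \<mu> = (SOME g. (\<forall>x y. g (x + y) = g x + g y) \<and> (\<forall>v r. g (\<tau>V v r) = scV (\<mu> (inc r)) v))"

lemma contract:
  assumes "functional scKR \<mu>"
  shows "contract \<mu> (x + y) = contract \<mu> x + contract \<mu> y" "contract \<mu> (\<tau>V v r) = scV (\<mu> (inc r)) v"
proof -
  interpret V: vector_space scV by (rule vector_space_V)
  have "\<mu> (inc (\<alpha> a * r)) = a * \<mu> (inc r)" if "a \<in> A" for a r
    using functional_scale[OF assms, of a "inc r"] that by (simp add: inc_\<alpha> scKR_def)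
  then have "balanced_mod A scV \<alpha> UNIV {0} (\<lambda>v r. scV (\<mu> (inc r)) v)"
    unfolding balanced_mod_def
    by (auto simp: functional_add[OF assms] inc_hom(2) V.scale_right_distrib V.scale_left_distrib mult.commute)
  then obtain g where "\<And>x y. g (x + y) = g x + g y" "\<And>v r. g (\<tau>V v r) = scV (\<mu> (inc r)) v"
    using tensor_product_lift[OF tproduct_V] by metis
  then have "(\<forall>x y. contract \<mu> (x + y) = contract \<mu> x + contract \<mu> y) \<and> (\<forall>v r. contract \<mu> (\<tau>V v r) = scV (\<mu> (inc r)) v)"
    unfolding contract_def by (intro someI_ex[where P = "\<lambda>g. (\<forall>x y. g (x + y) = g x + g y) \<and> (\<forall>v r. g (\<tau>V v r) = scV (\<mu> (inc r)) v)"]) blast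
  then show "contract \<mu> (x + y) = contract \<mu> x + contract \<mu> y" "contract \<mu> (\<tau>V v r) = scV (\<mu> (inc r)) v" by auto
qed

lemma contract_zero: "functional scKR \<mu> \<Longrightarrow> contract \<mu> 0 = 0"
  using contract(1)[of \<mu> 0 0] by simp

lemma contract_act: "functional scKR \<mu> \<Longrightarrow> contract \<mu> (actR y (\<tau>K x 1)) = act (contract \<mu> y) x"
  by (induction y rule: VR_induct)
    (simp_all add: actR_zero act_zero contract_zero actR_simps contract scV_def act_simps act_\<iota>)

lemma functional_contract:
  assumes "functional scKR \<mu>" "functional scV \<omega>"
  shows "\<omega> (contract \<mu> y) = \<mu> (ext_fun \<omega> y)"
proof (induction y rule: VR_induct)
  case (pure v r)
  show ?case using functional_scale[OF assms(1), of "\<omega> v" "inc r"]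
    by (simp add: contract[OF assms(1)] ext_fun[OF assms(2)] functional_scale[OF assms(2)] scKR_def mult.commute)
qed (simp_all add: contract_zero[OF assms(1)] ext_fun_zero[OF assms(2)] functional_zero[OF assms(1)] functional_zero[OF assms(2)]
    contract(1)[OF assms(1)] ext_fun(1)[OF assms(2)] functional_add[OF assms(1)] functional_add[OF assms(2)])

lemma KR_separated: "(\<And>\<mu>. functional scKR \<mu> \<Longrightarrow> \<mu> y = \<mu> z) \<Longrightarrow> y = z"
proof (rule ccontr)
  assume eq: "\<And>\<mu>. functional scKR \<mu> \<Longrightarrow> \<mu> y = \<mu> z" and "y \<noteq> z"
  then have "y - z \<noteq> 0" by simp
  then obtain \<mu> where "functional scKR \<mu>" "\<mu> (y - z) = 1"
    using vector_space.functional_with_value_one[OF vector_space_KR] by metis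
  then show False using eq[of \<mu>] functional_diff[of scKR \<mu> y z] by simp
qed

text \<open>A coordinate of the contraction is \<open>\<mu>\<close> of the extended coordinate, and
  functionals separate the points of the \<open>F\<close>-vector space
  \<open>K \<otimes> R\<close>.\<close>

lemma VR_separated:
  assumes eq: "\<And>\<mu>. functional scKR \<mu> \<Longrightarrow> contract \<mu> y = contract \<mu> z"
  shows "y = z"
proof -
  obtain d w \<omega> where cd: "coordinates A scV L d w \<omega>" using lattice_coordinates by blast
  have "ext_fun (\<omega> k) y = ext_fun (\<omega> k) z" for k
  proof (rule KR_separated)
    fix \<mu> :: "'kr \<Rightarrow> 'f" assume \<mu>: "functional scKR \<mu>"
    show "\<mu> (ext_fun (\<omega> k) y) = \<mu> (ext_fun (\<omega> k) z)"
      using functional_contract[OF \<mu> coordinatesD(2)[OF cd]] eq[OF \<mu>] by metis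
  qed
  then show ?thesis using coordinates_R(1)[OF cd, of y] coordinates_R(1)[OF cd, of z] by simp
qed

section \<open>Base change of endomorphisms and their slices\<close>

abbreviation "bc \<equiv> base_change_map \<tau>V"

lemma bc_eqI:
  assumes "\<And>x y. Y (x + y) = Y x + Y y" "\<And>v r. Y (\<tau>V v r) = \<tau>V (X v) r"
  shows "bc X = Y"
  unfolding base_change_map_def
proof (rule the_equality)
  show "additive_map Y \<and> (\<forall>v r. Y (\<tau>V v r) = \<tau>V (X v) r)" using assms by (simp add: additive_map_def)
  fix Z assume Z: "additive_map Z \<and> (\<forall>v r. Z (\<tau>V v r) = \<tau>V (X v) r)"
  have "Z 0 = 0" "Y 0 = 0" using Z assms(1)[of 0 0] by (auto simp: additive_map_def) (metis add_cancel_left_left)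
  then have "Z y = Y y" for y
    by (induction y rule: VR_induct) (use Z assms in \<open>auto simp: additive_map_def\<close>)
  then show "Z = Y" by blast
qed

lemma bc:
  assumes X: "linear_end act X"
  shows "bc X (\<tau>V v r) = \<tau>V (X v) r" "linear_end actR (bc X)"
proof -
  have "X (scV a v) = scV a (X v)" for a v by (simp add: scV_def linear_end_act[OF X])
  then have "balanced_mod A scV \<alpha> UNIV {0} (\<lambda>v r. \<tau>V (X v) r)"
    unfolding balanced_mod_def by (auto simp: linear_end_add[OF X] \<tau>V_add \<tau>V_scale)
  then obtain g where g: "\<And>x y. g (x + y) = g x + g y" "\<And>v r. g (\<tau>V v r) = \<tau>V (X v) r"
    using tensor_product_lift[OF tproduct_V] by metis
  then have "bc X = g" by (rule bc_eqI)
  then have 1: "bc X (x + y) = bc X x + bc X y" and 2: "bc X (\<tau>V v r) = \<tau>V (X v) r" for x y v r using g by auto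
  then show "bc X (\<tau>V v r) = \<tau>V (X v) r" by blast
  have 0: "bc X 0 = 0" using 1[of 0 0] by simp
  have "bc X (actR y z) = actR (bc X y) z" for y z
  proof (induction y rule: VR_induct)
    case (pure v r)
    show ?case
      by (induction z rule: KR_induct) (auto simp: actR_simps actR_zero 0 1 2 linear_end_act[OF X])
  qed (auto simp: actR_simps actR_zero 0 1)
  then show "linear_end actR (bc X)" using 1 by (simp add: linear_end_def additive_map_def)
qed

text \<open>The pure tensor \<open>X \<otimes> r\<close>, realised as an endomorphism of
  \<open>V \<otimes> R\<close>.\<close>

definition tau :: "('v \<Rightarrow> 'v) \<Rightarrow> 'r \<Rightarrow> 'vr \<Rightarrow> 'vr" where "tau X r = (\<lambda>y. actR (bc X y) (\<tau>K 1 r))"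

lemma tau_pure: "linear_end act X \<Longrightarrow> tau X r (\<tau>V v s) = \<tau>V (X v) (s * r)"
  by (simp add: tau_def bc actR_simps act_simps(3))

lemma linear_endR_closed:
  assumes "linear_end actR X" "linear_end actR Y"
  shows "linear_end actR (X + Y)" "linear_end actR (X - Y)" "linear_end actR (X \<circ> Y)"
    "linear_end actR (\<lambda>y. actR (X y) (inc r))"
proof -
  have d: "actR (v - w) x = actR v x - actR w x" for v w x
    using actR_simps(1)[of "v - w" w x] by (simp add: eq_diff_eq)
  have "actR (actR y z) (inc r) = actR (actR y (inc r)) z" for y z
    by (simp only: actR_mult inc_central)
  then show "linear_end actR (X + Y)" "linear_end actR (X - Y)" "linear_end actR (X \<circ> Y)"
    "linear_end actR (\<lambda>y. actR (X y) (inc r))"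
    using assms unfolding linear_end_def additive_map_def by (auto simp: actR_simps d)
qed

lemma linear_endR_zero: "linear_end actR 0"
  by (simp add: linear_end_def additive_map_def actR_zero)

lemma tau_linear: "linear_end act X \<Longrightarrow> linear_end actR (tau X r)"
  using linear_endR_closed(4)[OF bc(2) bc(2)] unfolding tau_def inc_def by blast

lemma tau_add: "linear_end act X \<Longrightarrow> linear_end act Y \<Longrightarrow> tau (X + Y) r = tau X r + tau Y r"
  "linear_end act X \<Longrightarrow> tau X (r + s) = tau X r + tau X s"
  by (rule linear_endR_eqI; simp add: tau_linear linear_endR_closed linear_end_closed tau_pure \<tau>V_add)+

lemma tau_scale: "linear_end act X \<Longrightarrow> a \<in> A \<Longrightarrow> tau (scE a X) r = tau X (\<alpha> a * r)"
proof (rule linear_endR_eqI)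
  assume X: "linear_end act X" and a: "a \<in> A"
  show "tau (scE a X) r (\<tau>V v 1) = tau X (\<alpha> a * r) (\<tau>V v 1)" for v
    using \<tau>V_scale[OF a, of "X v" r] X by (simp add: tau_pure linear_end_closed scE_apply)
qed (simp_all add: tau_linear linear_end_closed)

text \<open>Restriction to \<open>V \<otimes> 1\<close> followed by contraction: the component along
  \<open>\<mu>\<close>, which sends \<open>Y \<otimes> r\<close> to \<open>Y\<close> scaled by
  \<open>\<mu> (inc r)\<close>.\<close>

definition slice :: "('kr \<Rightarrow> 'f) \<Rightarrow> ('vr \<Rightarrow> 'vr) \<Rightarrow> 'v \<Rightarrow> 'v" where
  "slice \<mu> X = (\<lambda>v. contract \<mu> (X (\<tau>V v 1)))"

lemma slice_tau: "functional scKR \<mu> \<Longrightarrow> linear_end act X \<Longrightarrow> slice \<mu> (tau X r) = scE (\<mu> (inc r)) X"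
  by (rule ext) (simp add: slice_def tau_pure contract scE_def scV_def)

lemma slice_add: "functional scKR \<mu> \<Longrightarrow> slice \<mu> (X + Y) = slice \<mu> X + slice \<mu> Y"
  by (rule ext) (simp add: slice_def contract)

lemma slice_zero: "functional scKR \<mu> \<Longrightarrow> slice \<mu> 0 = 0"
  by (rule ext) (simp add: slice_def contract_zero)

lemma slice_sum: "functional scKR \<mu> \<Longrightarrow> slice \<mu> (\<Sum>i\<in>I. f i) = (\<Sum>i\<in>I. slice \<mu> (f i))"
  by (induction I rule: infinite_finite_induct) (auto simp: slice_zero slice_add)

lemma slice_linear:
  assumes \<mu>: "functional scKR \<mu>" and X: "linear_end actR X"
  shows "linear_end act (slice \<mu> X)"
proof -
  have "\<tau>V (act v x) 1 = actR (\<tau>V v 1) (\<tau>K x 1)" for v x by (simp add: actR_simps)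
  then show ?thesis
    unfolding linear_end_def additive_map_def slice_def
    by (simp add: \<tau>V_add linear_end_add[OF X] linear_end_act[OF X] contract[OF \<mu>] contract_act[OF \<mu>])
qed

lemma slices_eqI:
  assumes "linear_end actR X" "linear_end actR Y"
    and "\<And>\<mu>. functional scKR \<mu> \<Longrightarrow> slice \<mu> X = slice \<mu> Y"
  shows "X = Y"
proof (rule linear_endR_eqI[OF assms(1,2)])
  fix v show "X (\<tau>V v 1) = Y (\<tau>V v 1)"
    using assms(3) by (intro VR_separated) (metis slice_def)
qed

end

section \<open>Endomorphisms over A and over R\<close>

context lattice_setting
begin

lemma linear_endR_sum_closed: "(\<And>i. i \<in> I \<Longrightarrow> linear_end actR (f i)) \<Longrightarrow> linear_end actR (\<Sum>i\<in>I. f i)"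
  by (induction I rule: infinite_finite_induct) (auto simp: linear_endR_zero linear_endR_closed)

text \<open>Descent: an endomorphism over \<open>R\<close> is determined by its slices along linear functionals of
  \<open>K \<otimes> R\<close>, so an expansion valid for all slices lifts.\<close>

lemma descent:
  assumes X: "linear_end actR X" and w: "\<And>k. k < d \<Longrightarrow> linear_end act (w k)"
    and \<psi>: "\<And>t \<mu>. t \<in> J \<Longrightarrow> functional scKR \<mu> \<Longrightarrow> \<mu> (\<psi>R t) = \<psi> t (slice \<mu> X)"
    and integral: "\<And>t. t \<in> J \<Longrightarrow> \<psi>R t \<in> range inc" and g: "\<And>k t. k < d \<Longrightarrow> t \<in> J \<Longrightarrow> g k t \<in> A"
    and gen: "\<And>\<mu>. functional scKR \<mu> \<Longrightarrow> slice \<mu> X = (\<Sum>k<d. scE (\<Sum>t\<in>J. g k t * \<psi> t (slice \<mu> X)) (w k))"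
  obtains r where "\<And>k. k < d \<Longrightarrow> inc (r k) = (\<Sum>t\<in>J. j (g k t) * \<psi>R t)" "X = (\<Sum>k<d. tau (w k) (r k))"
proof -
  have "\<forall>t\<in>J. \<exists>s. \<psi>R t = inc s" using integral by blast
  then obtain s where s: "\<And>t. t \<in> J \<Longrightarrow> \<psi>R t = inc (s t)" by metis
  \<comment> \<open>The coefficients lie in \<open>R\<close> itself because \<open>g\<close> has
    entries in \<open>A\<close> and the \<open>\<psi>R t\<close> are integral.\<close>
  define r where "r = (\<lambda>k. \<Sum>t\<in>J. \<alpha> (g k t) * s t)"
  have r: "inc (r k) = (\<Sum>t\<in>J. j (g k t) * \<psi>R t)" if "k < d" for k
    unfolding r_def inc_sum by (rule sum.cong) (simp_all add: inc_\<alpha> g that s)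
  have "X = (\<Sum>k<d. tau (w k) (r k))"
  proof (rule slices_eqI)
    show "linear_end actR X" by (rule X)
    show "linear_end actR (\<Sum>k<d. tau (w k) (r k))"
      by (rule linear_endR_sum_closed) (simp add: tau_linear w)
    fix \<mu> assume \<mu>: "functional scKR \<mu>"
    have "\<mu> (inc (r k)) = (\<Sum>t\<in>J. g k t * \<psi> t (slice \<mu> X))" if "k < d" for k
      unfolding r[OF that] functional_sum[OF \<mu>]
      by (rule sum.cong) (use functional_scale[OF \<mu>] \<psi>[OF _ \<mu>] in \<open>simp_all add: scKR_def\<close>)
    then have "slice \<mu> (\<Sum>k<d. tau (w k) (r k)) = (\<Sum>k<d. scE (\<Sum>t\<in>J. g k t * \<psi> t (slice \<mu> X)) (w k))"
      unfolding slice_sum[OF \<mu>] by (intro sum.cong) (simp_all add: slice_tau[OF \<mu> w])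
    then show "slice \<mu> X = slice \<mu> (\<Sum>k<d. tau (w k) (r k))" using gen[OF \<mu>] by simp
  qed
  then show thesis using that r by blast
qed

lemma tau_comp: "linear_end act X \<Longrightarrow> linear_end act Y \<Longrightarrow> tau X r \<circ> tau Y s = tau (X \<circ> Y) (r * s)"
  by (rule linear_endR_eqI) (simp_all add: tau_linear linear_endR_closed linear_end_closed tau_pure mult.commute)

section \<open>The form over R and the two rings of endomorphisms\<close>

lemma hR_simps: "hR (y + y') z = hR y z + hR y' z" "hR y (z + z') = hR y z + hR y z'"
  "hR (\<tau>V v r) (\<tau>V w s) = \<tau>K (h v w) (r * s)"
  using tform by (auto simp: tensor_form_def biadditive_map_def additive_map_def)

lemma hR_zero: "hR 0 z = 0" "hR y 0 = 0"
  using hR_simps(1)[of 0 0 z] hR_simps(2)[of y 0 0] by auto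

lemma hR_adjoint_eqI:
  assumes X: "\<And>y z. X (y + z) = X y + X z" and Y: "\<And>y z. Y (y + z) = Y y + Y z"
    and eq: "\<And>v r w s. hR (X (\<tau>V v r)) (\<tau>V w s) = hR (\<tau>V v r) (Y (\<tau>V w s))"
  shows "hR (X y) z = hR y (Y z)"
proof -
  have 0: "X 0 = 0" "Y 0 = 0" using X[of 0 0] Y[of 0 0] by auto
  show ?thesis
  proof (induction y rule: VR_induct)
    case (pure v r)
    show ?case
      by (induction z rule: VR_induct) (simp_all add: eq 0 Y hR_simps(1,2) hR_zero)
  qed (simp_all add: 0 X hR_simps(1,2) hR_zero)
qed

text \<open>The base change of the Gram map is \<open>y \<mapsto> \<Sum> e_i hR(e_i, y)\<close>, and
  the base change of its inverse is a left inverse of it.\<close>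

lemma right_nondegenerate_R:
  assumes y: "\<And>z. hR z y = 0"
  shows "y = 0"
proof -
  obtain e G G' where G: "\<And>v. \<exists>c. v = (\<Sum>i<n. act (e i) (c i))" "G = (\<lambda>w. \<Sum>i<n. act (e i) (h (e i) w))"
    "linear_end act G" "linear_end act G'" "\<And>w. G' (G w) = w"
    "\<And>w c i. G w = (\<Sum>i<n. act (e i) (c i)) \<Longrightarrow> i < n \<Longrightarrow> h (e i) w = c i" "\<And>u. \<exists>w. G w = u"
    by (rule gram_map) (rule that)
  have "bc G = (\<lambda>y. \<Sum>i<n. actR (\<tau>V (e i) 1) (hR (\<tau>V (e i) 1) y))"
    by (rule bc_eqI) (simp_all add: hR_simps actR_simps sum.distrib G(2) \<tau>V_sum)
  then have "bc G y = 0" using y by (simp add: actR_zero)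
  moreover have "bc G' \<circ> bc G = id"
  proof (rule linear_endR_eqI)
    show "linear_end actR id" by (simp add: linear_end_def additive_map_def)
    show "linear_end actR (bc G' \<circ> bc G)" by (intro linear_endR_closed bc G)
    show "(bc G' \<circ> bc G) (\<tau>V v 1) = id (\<tau>V v 1)" for v by (simp add: bc[OF G(3)] bc[OF G(4)] G(5))
  qed
  then have "bc G' (bc G y) = y" by (metis comp_apply id_apply)
  ultimately show ?thesis using linear_end_zero[OF bc(2)[OF G(4)]] by simp
qed

abbreviation "TA \<equiv> T0 act L Ls"
abbreviation "TR \<equiv> T0 actR (tensor_image \<tau>V L) (tensor_image \<tau>V Ls)"

lemma lattice_closed: "additively_closed L" "additively_closed Ls" "a \<in> A \<Longrightarrow> v \<in> L \<Longrightarrow> scV a v \<in> L"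
  "a \<in> A \<Longrightarrow> v \<in> Ls \<Longrightarrow> scV a v \<in> Ls"
proof -
  have *: "additively_closed \<Lambda> \<and> (\<forall>a\<in>A. \<forall>v\<in>\<Lambda>. scV a v \<in> \<Lambda>)" if cd: "coordinates A scV \<Lambda> d w \<omega>" for \<Lambda> d w \<omega>
  proof -
    note f = coordinatesD(2)[OF cd]
    show ?thesis unfolding additively_closed_def coordinatesD(3)[OF cd]
      by (auto simp: functional_zero[OF f] functional_diff[OF f] functional_scale[OF f] intro: A_diff A_mult)
        (auto simp: coordinatesD(3)[OF cd] functional_diff[OF f] functional_scale[OF f] intro: A_diff A_mult)
  qed
  show "additively_closed L" "additively_closed Ls" "a \<in> A \<Longrightarrow> v \<in> L \<Longrightarrow> scV a v \<in> L"
    "a \<in> A \<Longrightarrow> v \<in> Ls \<Longrightarrow> scV a v \<in> Ls"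
    using lattice_coordinates dual_lattice_coordinates * by blast+
qed

lemma TA_linear: "X \<in> TA \<Longrightarrow> linear_end act X" and TR_linear: "Z \<in> TR \<Longrightarrow> linear_end actR Z"
  by (simp_all add: T0_def)

lemma TA_closed: "additively_closed TA" "X \<in> TA \<Longrightarrow> Y \<in> TA \<Longrightarrow> X \<circ> Y \<in> TA" "a \<in> A \<Longrightarrow> X \<in> TA \<Longrightarrow> scE a X \<in> TA"
proof -
  show "additively_closed TA"
    using additively_closedD(1,2)[OF lattice_closed(1)] additively_closedD(1,2)[OF lattice_closed(2)]
    by (auto simp: additively_closed_def T0_def linear_end_zero_map linear_end_closed image_subset_iff)
  show "X \<in> TA \<Longrightarrow> Y \<in> TA \<Longrightarrow> X \<circ> Y \<in> TA"
    by (auto simp: T0_def linear_end_closed image_subset_iff)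
  show "a \<in> A \<Longrightarrow> X \<in> TA \<Longrightarrow> scE a X \<in> TA"
    by (auto simp: T0_def linear_end_closed image_subset_iff scE_apply lattice_closed)
qed

lemma tensor_image_closed: "additively_closed (tensor_image \<tau>V \<Lambda>)"
proof -
  have neg: "- y \<in> tensor_image \<tau>V \<Lambda>" if "y \<in> tensor_image \<tau>V \<Lambda>" for y
    using that
  proof (induction y rule: tensor_image_induct)
    case zero
    then show ?case by (simp add: tensor_image_zero)
  next
    case (pure v r)
    have "\<tau>V v (- r) + \<tau>V v r = 0" using \<tau>V_add(2)[of v "- r" r] \<tau>V_add(2)[of v 0 0] by simp
    then have "- \<tau>V v r = \<tau>V v (- r)" by (simp add: eq_neg_iff_add_eq_0[symmetric])
    then show ?case using tensor_image_pure[OF pure, of \<tau>V "- r"] by simp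
  next
    case (add x y)
    then show ?case using tensor_image_add[of "- x" \<tau>V \<Lambda> "- y"] by simp
  qed
  show ?thesis unfolding additively_closed_def
    using tensor_image_zero tensor_image_add[OF _ neg] by (metis uminus_add_conv_diff add.commute)
qed

lemma TR_closed: "additively_closed TR" "X \<in> TR \<Longrightarrow> Y \<in> TR \<Longrightarrow> X \<circ> Y \<in> TR"
proof -
  show "additively_closed TR"
    using additively_closedD(1,2)[OF tensor_image_closed]
    by (auto simp: additively_closed_def T0_def linear_endR_zero linear_endR_closed image_subset_iff)
  show "X \<in> TR \<Longrightarrow> Y \<in> TR \<Longrightarrow> X \<circ> Y \<in> TR"
    by (auto simp: T0_def linear_endR_closed image_subset_iff)
qed

lemma tau_TR:
  assumes X: "X \<in> TA"
  shows "tau X r \<in> TR"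
proof -
  have lin: "linear_end act X" using X by (rule TA_linear)
  have "tau X r y \<in> tensor_image \<tau>V \<Lambda>" if "X ` \<Lambda> \<subseteq> \<Lambda>" "y \<in> tensor_image \<tau>V \<Lambda>" for y \<Lambda>
    using that(2)
  proof (induction y rule: tensor_image_induct)
    case zero
    then show ?case using linear_end_zero[OF tau_linear[OF lin]] tensor_image_zero by simp
  next
    case (pure v s)
    then show ?case using that(1) tensor_image_pure[of "X v" \<Lambda> \<tau>V "s * r"] by (auto simp: tau_pure[OF lin])
  next
    case (add y z)
    then show ?case using tensor_image_add linear_end_add[OF tau_linear[OF lin]] by simp
  qed
  then show ?thesis using X tau_linear[OF lin] by (auto simp: T0_def)
qed

section \<open>Coordinates of the lattice of endomorphisms\<close>

definition matrix_entry :: "('v \<Rightarrow> 'f) \<times> 'v \<Rightarrow> ('v \<Rightarrow> 'v) \<Rightarrow> 'f" where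
  "matrix_entry p X = fst p (X (snd p))"

definition matrix_entryR :: "('v \<Rightarrow> 'f) \<times> 'v \<Rightarrow> ('vr \<Rightarrow> 'vr) \<Rightarrow> 'kr" where
  "matrix_entryR p X = ext_fun (fst p) (X (\<tau>V (snd p) 1))"

text \<open>Entries are taken with respect to generators of \<open>L\<close> and, separately, of
  \<open>Ls\<close>: integrality of the first family says that \<open>X\<close> preserves
  \<open>L\<close>, of the second that it preserves \<open>Ls\<close>. Vanishing of the first
  already forces \<open>X = 0\<close>.\<close>

lemma matrix_entries_exist:
  obtains J where "finite J" "\<And>p. p \<in> J \<Longrightarrow> functional scV (fst p)"
    "\<And>X. linear_end act X \<Longrightarrow> X \<in> TA \<longleftrightarrow> (\<forall>p\<in>J. matrix_entry p X \<in> A)"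
    "\<And>X. linear_end act X \<Longrightarrow> \<forall>p\<in>J. matrix_entry p X = 0 \<Longrightarrow> X = 0"
    "\<And>X p. X \<in> TR \<Longrightarrow> p \<in> J \<Longrightarrow> matrix_entryR p X \<in> range inc"
proof -
  obtain d w \<omega> where cL: "coordinates A scV L d w \<omega>" using lattice_coordinates by blast
  obtain d' w' \<omega>' where cM: "coordinates A scV Ls d' w' \<omega>'" using dual_lattice_coordinates by blast
  define J1 where "J1 = (\<lambda>(k, i). (\<omega> k, w i)) ` ({..<d} \<times> {..<d})"
  define J2 where "J2 = (\<lambda>(k, i). (\<omega>' k, w' i)) ` ({..<d'} \<times> {..<d'})"
  have preserve: "X ` \<Lambda> \<subseteq> \<Lambda> \<longleftrightarrow> (\<forall>k<d. \<forall>i<d. \<omega> k (X (w i)) \<in> A)"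
    if X: "linear_end act X" and cd: "coordinates A scV \<Lambda> d w \<omega>" for X \<Lambda> d w \<omega>
  proof
    assume "X ` \<Lambda> \<subseteq> \<Lambda>"
    then have "X (w i) \<in> \<Lambda>" if "i < d" for i using coordinatesD(1)[OF cd that] by blast
    then show "\<forall>k<d. \<forall>i<d. \<omega> k (X (w i)) \<in> A" using coordinatesD(3)[OF cd] by blast
  next
    assume *: "\<forall>k<d. \<forall>i<d. \<omega> k (X (w i)) \<in> A"
    show "X ` \<Lambda> \<subseteq> \<Lambda>"
    proof (rule image_subsetI)
      fix x assume "x \<in> \<Lambda>"
      then have x: "\<omega> i x \<in> A" if "i < d" for i using coordinatesD(3)[OF cd] that by blast
      have "\<omega> k (X x) \<in> A" if k: "k < d" for k
      proof -
        have "X x = X (\<Sum>i<d. scV (\<omega> i x) (w i))" using coordinatesD(4)[OF cd, of x] by simp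
        also have "\<dots> = (\<Sum>i<d. scV (\<omega> i x) (X (w i)))"
          by (simp add: linear_end_sum[OF X] scV_def linear_end_act[OF X])
        finally have "\<omega> k (X x) = (\<Sum>i<d. \<omega> i x * \<omega> k (X (w i)))"
          by (simp add: functional_sum[OF coordinatesD(2)[OF cd]] functional_scale[OF coordinatesD(2)[OF cd]])
        moreover have "(\<Sum>i<d. \<omega> i x * \<omega> k (X (w i))) \<in> A" by (rule A_sum) (use * x k in \<open>simp add: A_mult\<close>)
        ultimately show ?thesis by simp
      qed
      then show "X x \<in> \<Lambda>" using coordinatesD(3)[OF cd] by blast
    qed
  qed
  have pairs: "(\<forall>p\<in>(\<lambda>(k, i). f k i) ` ({..<m} \<times> {..<m}). Q p) \<longleftrightarrow> (\<forall>k<m. \<forall>i<m. Q (f k i))"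
    for f :: "nat \<Rightarrow> nat \<Rightarrow> ('v \<Rightarrow> 'f) \<times> 'v" and Q and m :: nat by auto
  show thesis
  proof (rule that[of "J1 \<union> J2"])
    show "finite (J1 \<union> J2)" unfolding J1_def J2_def by simp
    show "functional scV (fst p)" if "p \<in> J1 \<union> J2" for p
      using that coordinatesD(2)[OF cL] coordinatesD(2)[OF cM] unfolding J1_def J2_def by auto
    show "X \<in> TA \<longleftrightarrow> (\<forall>p\<in>J1 \<union> J2. matrix_entry p X \<in> A)" if X: "linear_end act X" for X
    proof -
      have "X \<in> TA \<longleftrightarrow> (\<forall>k<d. \<forall>i<d. \<omega> k (X (w i)) \<in> A) \<and> (\<forall>k<d'. \<forall>i<d'. \<omega>' k (X (w' i)) \<in> A)"
        using X preserve[OF X cL] preserve[OF X cM] by (simp add: T0_def)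
      then show ?thesis unfolding J1_def J2_def ball_Un pairs by (simp add: matrix_entry_def)
    qed
    show "X = 0" if X: "linear_end act X" and z: "\<forall>p\<in>J1 \<union> J2. matrix_entry p X = 0" for X
    proof
      fix v
      have "X (w i) = 0" if i: "i < d" for i
      proof -
        have "\<omega> k (X (w i)) = 0" if k: "k < d" for k
          using z i k unfolding J1_def ball_Un pairs matrix_entry_def by simp
        then have "(\<Sum>k<d. scV (\<omega> k (X (w i))) (w k)) = 0" by (simp add: scV_def \<iota>_0 act_zero)
        then show ?thesis using coordinatesD(4)[OF cL, of "X (w i)"] by simp
      qed
      then have "X (\<Sum>i<d. scV (\<omega> i v) (w i)) = 0"
        by (simp add: linear_end_sum[OF X] scV_def linear_end_act[OF X] act_zero)
      then show "X v = 0 v" using coordinatesD(4)[OF cL, of v] by simp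
    qed
    show "matrix_entryR p X \<in> range inc" if X: "X \<in> TR" and p: "p \<in> J1 \<union> J2" for X p
    proof -
      have *: "ext_fun (\<omega> k) (X (\<tau>V (w i) 1)) \<in> range inc"
        if "coordinates A scV \<Lambda> d w \<omega>" "X ` tensor_image \<tau>V \<Lambda> \<subseteq> tensor_image \<tau>V \<Lambda>" "k < d" "i < d" for \<Lambda> d w \<omega> k i
      proof -
        have "\<tau>V (w i) 1 \<in> tensor_image \<tau>V \<Lambda>" by (rule tensor_image_pure) (rule coordinatesD(1)[OF that(1,4)])
        then have "X (\<tau>V (w i) 1) \<in> tensor_image \<tau>V \<Lambda>" using that(2) by blast
        then show ?thesis using coordinates_R(2)[OF that(1)] that(3) by blast
      qed
      have "X ` tensor_image \<tau>V L \<subseteq> tensor_image \<tau>V L" "X ` tensor_image \<tau>V Ls \<subseteq> tensor_image \<tau>V Ls"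
        using X by (simp_all add: T0_def)
      then show ?thesis using p *[OF cL] *[OF cM] unfolding J1_def J2_def matrix_entryR_def by auto
    qed
  qed
qed

lemma functional_matrix_entry: "functional scV (fst p) \<Longrightarrow> functional scE (matrix_entry p)"
  by (simp add: functional_def matrix_entry_def scE_apply)

lemma slice_matrix_entry:
  "functional scV (fst p) \<Longrightarrow> functional scKR \<mu> \<Longrightarrow> \<mu> (matrix_entryR p X) = matrix_entry p (slice \<mu> X)"
  by (simp add: matrix_entry_def matrix_entryR_def slice_def functional_contract)

lemma subspace_linear_end: "module.subspace scE {X. linear_end act X}"
proof -
  interpret vector_space scE by (rule vector_space_E)
  show ?thesis by (simp add: subspace_def linear_end_zero_map linear_end_closed)
qed

text \<open>With the matrix entries as functionals, the lattice lemma gives generators of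
  \<open>T0(A)\<close>. Its integral matrix \<open>g\<close> also defines coordinates
  \<open>tR\<close> over \<open>R\<close>, and descent turns them into an expansion of every element
  of \<open>T0(R)\<close>.\<close>

lemma endomorphism_coordinates:
  obtains d :: nat and T :: "nat \<Rightarrow> 'v \<Rightarrow> 'v" and t :: "nat \<Rightarrow> ('v \<Rightarrow> 'v) \<Rightarrow> 'f" and tR :: "nat \<Rightarrow> ('vr \<Rightarrow> 'vr) \<Rightarrow> 'kr"
  where "\<And>k. k < d \<Longrightarrow> T k \<in> TA" "\<And>k. functional scE (t k)" "\<And>k X. k < d \<Longrightarrow> X \<in> TA \<Longrightarrow> t k X \<in> A"
    "\<And>X. linear_end act X \<Longrightarrow> X = (\<Sum>k<d. scE (t k X) (T k))"
    "\<And>k \<mu> X. functional scKR \<mu> \<Longrightarrow> \<mu> (tR k X) = t k (slice \<mu> X)"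
    "\<And>X. X \<in> TR \<Longrightarrow> \<exists>x. (\<forall>k<d. inc (x k) = tR k X) \<and> X = (\<Sum>k<d. tau (T k) (x k))"
proof -
  obtain J where J: "finite J" "\<And>p. p \<in> J \<Longrightarrow> functional scV (fst p)"
    "\<And>X. linear_end act X \<Longrightarrow> X \<in> TA \<longleftrightarrow> (\<forall>p\<in>J. matrix_entry p X \<in> A)"
    "\<And>X. linear_end act X \<Longrightarrow> \<forall>p\<in>J. matrix_entry p X = 0 \<Longrightarrow> X = 0"
    "\<And>X p. X \<in> TR \<Longrightarrow> p \<in> J \<Longrightarrow> matrix_entryR p X \<in> range inc" by (rule matrix_entries_exist) (rule that)
  have "\<exists>(d::nat) w g. (\<forall>k<d. w k \<in> {X. linear_end act X} \<and> (\<forall>p\<in>J. matrix_entry p (w k) \<in> A)) \<and>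
      (\<forall>k<d. \<forall>p\<in>J. g k p \<in> A) \<and>
      (\<forall>X\<in>{X. linear_end act X}. X = (\<Sum>k<d. scE (\<Sum>p\<in>J. g k p * matrix_entry p X) (w k)))"
    by (rule lattice_generators[OF vector_space_E J(1) _ subspace_linear_end])
      (simp_all add: functional_matrix_entry J(2,4))
  then obtain d T g where T: "\<forall>k<(d::nat). T k \<in> {X. linear_end act X} \<and> (\<forall>p\<in>J. matrix_entry p (T k) \<in> A)"
    and g: "\<forall>k<d. \<forall>p\<in>J. g k p \<in> A"
    and e: "\<forall>X\<in>{X. linear_end act X}. X = (\<Sum>k<d. scE (\<Sum>p\<in>J. g k p * matrix_entry p X) (T k))"
    by (elim exE conjE) (rule that)
  define t where "t = (\<lambda>k X. \<Sum>p\<in>J. g k p * matrix_entry p X)"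
  define tR where "tR = (\<lambda>k X. \<Sum>p\<in>J. j (g k p) * matrix_entryR p X)"
  have e': "X = (\<Sum>k<d. scE (t k X) (T k))" if "linear_end act X" for X
    unfolding t_def using e that by simp
  show thesis
  proof (rule that[of d T t tR])
    show "T k \<in> TA" if "k < d" for k using T that J(3) by simp
    show "functional scE (t k)" for k
      unfolding t_def by (rule functional_combination) (simp add: functional_matrix_entry J(2))
    show "t k X \<in> A" if "k < d" "X \<in> TA" for k X
      unfolding t_def by (rule A_sum) (use that g J(3)[OF TA_linear[OF that(2)]] in \<open>simp add: A_mult\<close>)
    show "X = (\<Sum>k<d. scE (t k X) (T k))" if "linear_end act X" for X by (rule e'[OF that])
    show "\<mu> (tR k X) = t k (slice \<mu> X)" if \<mu>: "functional scKR \<mu>" for k \<mu> X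
      unfolding t_def tR_def functional_sum[OF \<mu>]
      by (rule sum.cong) (use functional_scale[OF \<mu>] slice_matrix_entry[OF J(2) \<mu>] in \<open>simp_all add: scKR_def\<close>)
    show "\<exists>x. (\<forall>k<d. inc (x k) = tR k X) \<and> X = (\<Sum>k<d. tau (T k) (x k))" if X: "X \<in> TR" for X
    proof -
      obtain x where "\<And>k. k < d \<Longrightarrow> inc (x k) = (\<Sum>p\<in>J. j (g k p) * matrix_entryR p X)" "X = (\<Sum>k<d. tau (T k) (x k))"
      proof (rule descent[where X = X and w = T and d = d and J = J and g = g and \<psi> = matrix_entry and \<psi>R = "\<lambda>p. matrix_entryR p X"])
        show "linear_end actR X" by (rule TR_linear[OF X])
        show "linear_end act (T k)" if "k < d" for k using T that by simp
        show "\<mu> (matrix_entryR p X) = matrix_entry p (slice \<mu> X)" if "p \<in> J" "functional scKR \<mu>" for p \<mu>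
          by (rule slice_matrix_entry[OF J(2)[OF that(1)] that(2)])
        show "matrix_entryR p X \<in> range inc" if "p \<in> J" for p by (rule J(5)[OF X that])
        show "g k p \<in> A" if "k < d" "p \<in> J" for k p using g that by blast
        show "slice \<mu> X = (\<Sum>k<d. scE (\<Sum>p\<in>J. g k p * matrix_entry p (slice \<mu> X)) (T k))" if "functional scKR \<mu>" for \<mu>
          using e'[OF slice_linear[OF that TR_linear[OF X]]] unfolding t_def .
      qed (rule that)
      then show ?thesis unfolding tR_def by blast
    qed
  qed
qed

lemma tau_sum_in: "(\<And>k. k < d \<Longrightarrow> T k \<in> \<Lambda>) \<Longrightarrow> (\<Sum>k<d. tau (T k) (x k)) \<in> tensor_image tau \<Lambda>" for d :: nat
  by (induction d) (auto intro: tensor_image_zero tensor_image_add tensor_image_pure)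

lemma TR_eq: "TR = tensor_image tau TA"
proof
  obtain d :: nat and T t tR where T: "\<And>k. k < d \<Longrightarrow> T k \<in> TA" "\<And>k. functional scE (t k)" "\<And>k X. k < d \<Longrightarrow> X \<in> TA \<Longrightarrow> t k X \<in> A"
    "\<And>X. linear_end act X \<Longrightarrow> X = (\<Sum>k<d. scE (t k X) (T k))"
    "\<And>k \<mu> X. functional scKR \<mu> \<Longrightarrow> \<mu> (tR k X) = t k (slice \<mu> X)"
    "\<And>X. X \<in> TR \<Longrightarrow> \<exists>x. (\<forall>k<d. inc (x k) = tR k X) \<and> X = (\<Sum>k<d. tau (T k) (x k))"
    by (rule endomorphism_coordinates) (rule that)
  show "TR \<subseteq> tensor_image tau TA"
  proof
    fix X assume "X \<in> TR"
    then obtain x where "X = (\<Sum>k<d. tau (T k) (x k))" using T(6) by blast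
    then show "X \<in> tensor_image tau TA" using tau_sum_in[of d T TA x] T(1) by simp
  qed
  show "tensor_image tau TA \<subseteq> TR"
  proof
    fix X assume "X \<in> tensor_image tau TA"
    then show "X \<in> TR"
    proof (induction X rule: tensor_image_induct)
      case zero
      show ?case by (rule additively_closedD(1)[OF TR_closed(1)])
    next
      case (pure X r)
      then show ?case by (rule tau_TR)
    next
      case (add X Y)
      then show ?case by (intro additively_closedD(4)[OF TR_closed(1)])
    qed
  qed
qed

end

text \<open>The adjoint of \<open>X\<close> preserves \<open>L\<close> because \<open>X\<close>
  preserves \<open>Ls\<close> and \<open>L\<close> is the dual of \<open>Ls\<close>; symmetrically
  for \<open>Ls\<close>.\<close>

sublocale lattice_setting \<subseteq> AA: adjoint_algebra act h "T0 act L Ls"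
proof
  fix X assume X: "X \<in> TA"
  obtain Y where Y: "linear_end act Y" "\<And>v w. h (X v) w = h v (Y w)" "\<And>v w. h (Y v) w = h v (X w)"
    by (rule adjoint_exists[OF TA_linear[OF X]]) (rule that)
  have XL: "v \<in> L \<Longrightarrow> X v \<in> L" "v \<in> Ls \<Longrightarrow> X v \<in> Ls" for v using X by (auto simp: T0_def)
  have "Y v \<in> L" if v: "v \<in> L" for v
  proof -
    have "v \<in> dual_lattice h B Ls" using v dual_Ls by simp
    then have "\<forall>y\<in>Ls. h (Y v) y \<in> B" using XL(2) unfolding Y(3) dual_lattice_def by blast
    then have "Y v \<in> dual_lattice h B Ls" unfolding dual_lattice_def by blast
    then show ?thesis using dual_Ls by simp
  qed
  moreover have "Y v \<in> Ls" if v: "v \<in> Ls" for v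
  proof -
    have "\<forall>y\<in>L. h (Y v) y \<in> B" using v XL(1) unfolding Y(3) Ls_eq dual_lattice_def by blast
    then show ?thesis unfolding Ls_eq dual_lattice_def by blast
  qed
  ultimately have "Y \<in> TA" using Y(1) by (auto simp: T0_def)
  then show "\<exists>Y\<in>TA. \<forall>v w. h (X v) w = h v (Y w) \<and> h (Y v) w = h v (X w)" using Y by blast
qed (simp_all add: h_simps(1,2) right_nondegenerate TA_linear TA_closed)

context lattice_setting
begin

lemma tau_adjoint:
  assumes X: "X \<in> TA"
  shows "hR (tau X r y) z = hR y (tau (AA.ad X) r z)" "hR (tau (AA.ad X) r y) z = hR y (tau X r z)"
proof -
  note lin = TA_linear[OF X] TA_linear[OF AA.ad(1)[OF X]]
  show "hR (tau X r y) z = hR y (tau (AA.ad X) r z)" "hR (tau (AA.ad X) r y) z = hR y (tau X r z)"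
    by (rule hR_adjoint_eqI; simp add: linear_end_add[OF tau_linear] lin tau_pure hR_simps AA.ad[OF X] mult.assoc mult.commute mult.left_commute)+
qed

end

text \<open>Over \<open>R\<close>, adjoints come from the expansion in pure tensors: that of
  \<open>X \<otimes> r\<close> is \<open>X^ad \<otimes> r\<close>.\<close>

sublocale lattice_setting \<subseteq> RR: adjoint_algebra actR hR "T0 actR (tensor_image \<tau>V L) (tensor_image \<tau>V Ls)"
proof
  fix X assume "X \<in> TR"
  then have "X \<in> tensor_image tau TA" by (simp only: TR_eq)
  then show "\<exists>Y\<in>TR. \<forall>v w. hR (X v) w = hR v (Y w) \<and> hR (Y v) w = hR v (X w)"
  proof (induction X rule: tensor_image_induct)
    case zero
    then show ?case using additively_closedD(1)[OF TR_closed(1)] by (intro bexI[of _ 0]) (simp_all add: hR_zero)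
  next
    case (pure X r)
    then show ?case using tau_adjoint[OF pure] tau_TR[OF AA.ad(1)[OF pure]] by blast
  next
    case (add X Y)
    then obtain X' Y' where X': "X' \<in> TR" "\<forall>v w. hR (X v) w = hR v (X' w) \<and> hR (X' v) w = hR v (X w)"
      and Y': "Y' \<in> TR" "\<forall>v w. hR (Y v) w = hR v (Y' w) \<and> hR (Y' v) w = hR v (Y w)" by blast
    have "X' + Y' \<in> TR" by (rule additively_closedD(4)[OF TR_closed(1) X'(1) Y'(1)])
    then show ?case using X'(2) Y'(2) by (intro bexI[of _ "X' + Y'"]) (simp_all add: hR_simps)
  qed
qed (simp_all add: hR_simps(1,2) right_nondegenerate_R TR_linear TR_closed)

section \<open>The submodule T1\<close>

context lattice_setting
begin

lemma ad_scE:
  assumes X: "X \<in> TA"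
  shows "AA.ad (scE a X) = scE a (AA.ad X)"
proof (rule AA.ad_eqI)
  show "linear_end act (scE a (AA.ad X))" using TA_linear[OF AA.ad(1)[OF X]] linear_end_closed by blast
  show "h (scE a X v) w = h v (scE a (AA.ad X) w)" for v w
    by (simp add: scE_def h_simps(3,4) \<sigma>_\<iota> AA.ad(2)[OF X] \<iota>_central[of a "h v (AA.ad X w)"])
qed

lemma ad_tau: "X \<in> TA \<Longrightarrow> RR.ad (tau X r) = tau (AA.ad X) r"
  by (rule RR.ad_eqI) (simp_all add: tau_linear TA_linear AA.ad(1) tau_adjoint(1))

lemma tau_in_N: "W \<in> AA.N \<Longrightarrow> tau W r \<in> RR.N"
proof -
  assume "W \<in> AA.N"
  then obtain Y where Y: "Y \<in> TA" "W = Y + AA.ad Y" unfolding AA.N_def by blast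
  have "tau W r = tau Y r + RR.ad (tau Y r)"
    unfolding Y(2) ad_tau[OF Y(1)] by (rule tau_add(1)) (use Y(1) AA.ad(1) TA_linear in blast)+
  then show "tau W r \<in> RR.N" unfolding RR.N_def using tau_TR[OF Y(1)] by blast
qed

text \<open>\<open>N\<close> is the \<open>A\<close>-span of the finitely many
  \<open>T k + (T k)^ad\<close>, because taking adjoints is \<open>A\<close>-linear,
  \<open>\<sigma>\<close> being the identity on \<open>F\<close>. The functionals in
  \<open>Z\<close> cut out the \<open>F\<close>-span of \<open>N\<close>.\<close>

lemma N_functionals:
  obtains P Z where "finite P" "\<And>\<nu>. \<nu> \<in> P \<union> Z \<Longrightarrow> functional scE \<nu>"
    "\<And>W. W \<in> AA.N \<longleftrightarrow> (\<forall>\<nu>\<in>P. \<nu> W \<in> A) \<and> (\<forall>\<nu>\<in>Z. \<nu> W = 0)"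
proof -
  interpret E: vector_space scE by (rule vector_space_E)
  obtain d :: nat and T t tR where T: "\<And>k. k < d \<Longrightarrow> T k \<in> TA" "\<And>k. functional scE (t k)" "\<And>k X. k < d \<Longrightarrow> X \<in> TA \<Longrightarrow> t k X \<in> A"
    "\<And>X. linear_end act X \<Longrightarrow> X = (\<Sum>k<d. scE (t k X) (T k))"
    "\<And>k \<mu> X. functional scKR \<mu> \<Longrightarrow> \<mu> (tR k X) = t k (slice \<mu> X)"
    "\<And>X. X \<in> TR \<Longrightarrow> \<exists>x. (\<forall>k<d. inc (x k) = tR k X) \<and> X = (\<Sum>k<d. tau (T k) (x k))"
    by (rule endomorphism_coordinates) (rule that)
  define S where "S = (\<lambda>k. T k + AA.ad (T k)) ` {..<d}"
  define M where "M = {\<Sum>s\<in>S. scE (c s) s | c. \<forall>s\<in>S. c s \<in> A}"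
  have fin: "finite S" unfolding S_def by simp
  have scN: "scE a (T k + AA.ad (T k)) = scE a (T k) + AA.ad (scE a (T k))" if "k < d" for a k
    by (simp add: ad_scE[OF T(1)[OF that]] E.scale_right_distrib)
  have gen: "scE a s \<in> AA.N" if a: "a \<in> A" and s: "s \<in> S" for a s
  proof -
    obtain k where "k < d" "s = T k + AA.ad (T k)" using s unfolding S_def by blast
    then show ?thesis using scN[of k a] TA_closed(3)[OF a T(1)] unfolding AA.N_def by auto
  qed
  have M: "additively_closed M"
    unfolding additively_closed_def
  proof (intro conjI ballI)
    show "0 \<in> M" unfolding M_def by (intro CollectI exI[of _ "\<lambda>_. 0"]) simp
    fix x y assume "x \<in> M" "y \<in> M"
    then obtain c c' where "x = (\<Sum>s\<in>S. scE (c s) s)" "y = (\<Sum>s\<in>S. scE (c' s) s)" "\<forall>s\<in>S. c s \<in> A" "\<forall>s\<in>S. c' s \<in> A"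
      unfolding M_def by blast
    then show "x - y \<in> M" unfolding M_def
      by (intro CollectI exI[of _ "\<lambda>s. c s - c' s"]) (simp add: A_diff sum_subtractf E.scale_left_diff_distrib)
  qed
  have M_gen: "scE a s \<in> M" if a: "a \<in> A" and s: "s \<in> S" for a s
  proof -
    have "scE a s = (\<Sum>t\<in>S. if t = s then scE a t else 0)" using fin s by simp
    also have "\<dots> = (\<Sum>t\<in>S. scE (if t = s then a else 0) t)" by (rule sum.cong) auto
    finally show ?thesis unfolding M_def using a by (intro CollectI exI[of _ "\<lambda>t. if t = s then a else 0"]) simp
  qed
  have "AA.N = M"
  proof
    show "AA.N \<subseteq> M"
    proof
      fix W assume "W \<in> AA.N"
      then obtain Y where Y: "Y \<in> TA" "W = Y + AA.ad Y" unfolding AA.N_def by blast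
      define y where "y = (\<lambda>k. t k Y)"
      have y: "y k \<in> A" if "k < d" for k unfolding y_def by (rule T(3)[OF that Y(1)])
      have Ye: "Y = (\<Sum>k<d. scE (y k) (T k))" unfolding y_def by (rule T(4)[OF TA_linear[OF Y(1)]])
      have "AA.ad Y = (\<Sum>k<d. AA.ad (scE (y k) (T k)))"
        unfolding Ye by (rule AA.ad_sum) (simp add: TA_closed(3) y T(1))
      then have "W = (\<Sum>k<d. scE (y k) (T k) + AA.ad (scE (y k) (T k)))"
        unfolding Y(2) by (subst Ye) (simp add: sum.distrib)
      also have "\<dots> = (\<Sum>k<d. scE (y k) (T k + AA.ad (T k)))" by (rule sum.cong) (simp_all add: scN)
      also have "\<dots> \<in> M"
        by (rule additively_closed_sum[OF M]) (rule M_gen, simp_all add: y S_def)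
      finally show "W \<in> M" .
    qed
    show "M \<subseteq> AA.N"
    proof
      fix W assume "W \<in> M"
      then obtain c where "W = (\<Sum>s\<in>S. scE (c s) s)" "\<forall>s\<in>S. c s \<in> A" unfolding M_def by blast
      then show "W \<in> AA.N" using gen by (auto intro!: additively_closed_sum[OF AA.N_closed])
    qed
  qed
  moreover obtain P Z where "finite P" "\<forall>\<nu>\<in>P \<union> Z. functional scE \<nu>"
    "\<forall>W. W \<in> M \<longleftrightarrow> (\<forall>\<nu>\<in>P. \<nu> W \<in> A) \<and> (\<forall>\<nu>\<in>Z. \<nu> W = 0)"
    using finitely_generated_by_functionals[OF vector_space_E fin, folded M_def] by (elim exE conjE) (rule that)
  ultimately show thesis by (intro that[of P Z]) simp_all
qed

lemma functional_slice_tau: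
  assumes "functional scE \<nu>" "functional scKR \<mu>" "linear_end act X"
  shows "\<nu> (slice \<mu> (tau X r)) = \<mu> (j (\<nu> X) * inc r)"
  using functional_scale[OF assms(2), of "\<nu> X" "inc r"]
  by (simp add: slice_tau assms functional_scale[OF assms(1)] scKR_def mult.commute)

text \<open>The quadratic form \<open>x \<mapsto> \<Sum> x\<^sub>i x\<^sub>k D\<^sub>i\<^sub>k\<close> is additive modulo \<open>N\<close>, so the condition that its value lies in
  \<open>N\<close> is governed by the diagonal \<open>D\<^sub>k\<^sub>k\<close>; by taking square roots of the coefficients it becomes
  a system of linear conditions, with the same coefficients over \<open>A\<close> and over \<open>R\<close>.\<close>

lemma quadratic_conditions_linear:
  fixes D :: "nat \<Rightarrow> nat \<Rightarrow> 'v \<Rightarrow> 'v" and d :: nat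
  assumes D: "\<And>i k. i < d \<Longrightarrow> k < d \<Longrightarrow> D i k \<in> TA" "\<And>i k. i < d \<Longrightarrow> k < d \<Longrightarrow> D i k + D k i \<in> AA.N"
  obtains CP CZ :: "(nat \<Rightarrow> 'f) set" where "finite CP"
    "\<And>y. (\<And>k. k < d \<Longrightarrow> y k \<in> A) \<Longrightarrow> (\<Sum>i<d. \<Sum>k<d. scE (y i * y k) (D i k)) \<in> AA.N \<longleftrightarrow>
      (\<forall>m\<in>CP. (\<Sum>k<d. m k * y k) \<in> A) \<and> (\<forall>m\<in>CZ. (\<Sum>k<d. m k * y k) = 0)"
    "\<And>x. (\<Sum>i<d. \<Sum>k<d. tau (D i k) (x i * x k)) \<in> RR.N \<Longrightarrow>
      (\<forall>m\<in>CP. (\<Sum>k<d. j (m k) * inc (x k)) \<in> range inc) \<and> (\<forall>m\<in>CZ. (\<Sum>k<d. j (m k) * inc (x k)) = 0)"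
proof -
  interpret E: vector_space scE by (rule vector_space_E)
  obtain P Z where PZ: "finite P" "\<And>\<nu>. \<nu> \<in> P \<union> Z \<Longrightarrow> functional scE \<nu>"
    "\<And>W. W \<in> AA.N \<longleftrightarrow> (\<forall>\<nu>\<in>P. \<nu> W \<in> A) \<and> (\<forall>\<nu>\<in>Z. \<nu> W = 0)" by (rule N_functionals) (rule that)
  have P: "\<nu> W \<in> A" if "\<nu> \<in> P" "W \<in> AA.N" for \<nu> W using that PZ(3) by blast
  have Z: "\<nu> W = 0" if "\<nu> \<in> Z" "W \<in> AA.N" for \<nu> W using that PZ(3) by blast
  have fP: "functional scE \<nu>" if "\<nu> \<in> P" for \<nu> using PZ(2) that by blast
  have fZ: "functional scE \<nu>" if "\<nu> \<in> Z" for \<nu> using PZ(2) that by blast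
  have scN: "scE a W \<in> AA.N" if "a \<in> A" "W \<in> AA.N" for a W
    unfolding PZ(3)
  proof (intro conjI ballI)
    show "\<nu> (scE a W) \<in> A" if \<nu>: "\<nu> \<in> P" for \<nu>
      unfolding functional_scale[OF fP[OF \<nu>]] by (rule A_mult[OF \<open>a \<in> A\<close> P[OF \<nu> \<open>W \<in> AA.N\<close>]])
    show "\<nu> (scE a W) = 0" if \<nu>: "\<nu> \<in> Z" for \<nu>
      unfolding functional_scale[OF fZ[OF \<nu>]] Z[OF \<nu> \<open>W \<in> AA.N\<close>] by simp
  qed
  \<comment> \<open>\<open>D k k + D k k\<close> lies in \<open>N\<close>, so twice the diagonal
    coefficient \<open>\<nu> (D k k)\<close> is integral for \<open>\<nu>\<close> in
    \<open>P\<close> and zero for \<open>\<nu>\<close> in \<open>Z\<close>. These are the hypotheses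
    of the two linearisation lemmas.\<close>
  have dbl: "\<nu> (D k k + D k k) = 2 * \<nu> (D k k)" if "functional scE \<nu>" for \<nu> k
    unfolding functional_add[OF that] mult_2 ..
  have "\<forall>\<nu>\<in>P. \<exists>u v. (\<forall>x. (\<forall>i<d. x i \<in> A) \<longrightarrow>
      ((\<Sum>i<d. \<nu> (D i i) * (x i * x i)) \<in> A \<longleftrightarrow> (\<Sum>i<d. u i * x i) \<in> A \<and> (\<Sum>i<d. v i * x i) \<in> A)) \<and>
    (\<forall>x. (\<Sum>i<d. j (\<nu> (D i i)) * inc (x i * x i)) \<in> range inc \<longrightarrow>
      (\<Sum>i<d. j (u i) * inc (x i)) \<in> range inc \<and> (\<Sum>i<d. j (v i) * inc (x i)) \<in> range inc)"
  proof
    fix \<nu> assume \<nu>: "\<nu> \<in> P"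
    show "\<exists>u v. (\<forall>x. (\<forall>i<d. x i \<in> A) \<longrightarrow>
      ((\<Sum>i<d. \<nu> (D i i) * (x i * x i)) \<in> A \<longleftrightarrow> (\<Sum>i<d. u i * x i) \<in> A \<and> (\<Sum>i<d. v i * x i) \<in> A)) \<and>
    (\<forall>x. (\<Sum>i<d. j (\<nu> (D i i)) * inc (x i * x i)) \<in> range inc \<longrightarrow>
      (\<Sum>i<d. j (u i) * inc (x i)) \<in> range inc \<and> (\<Sum>i<d. j (v i) * inc (x i)) \<in> range inc)"
    proof (rule integral_condition_linear)
      fix i assume "i < d"
      then show "2 * \<nu> (D i i) \<in> A" using P[OF \<nu> D(2)] dbl[OF fP[OF \<nu>]] by metis
    qed
  qed
  then obtain u v where uv: "\<And>\<nu> x. \<nu> \<in> P \<Longrightarrow> (\<forall>i<d. x i \<in> A) \<Longrightarrow>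
      ((\<Sum>i<d. \<nu> (D i i) * (x i * x i)) \<in> A \<longleftrightarrow> (\<Sum>i<d. u \<nu> i * x i) \<in> A \<and> (\<Sum>i<d. v \<nu> i * x i) \<in> A)"
    "\<And>\<nu> x. \<nu> \<in> P \<Longrightarrow> (\<Sum>i<d. j (\<nu> (D i i)) * inc (x i * x i)) \<in> range inc \<Longrightarrow>
      (\<Sum>i<d. j (u \<nu> i) * inc (x i)) \<in> range inc \<and> (\<Sum>i<d. j (v \<nu> i) * inc (x i)) \<in> range inc"
    unfolding bchoice_iff by blast
  have "\<forall>\<nu>\<in>Z. \<exists>u v. (\<forall>x. (\<forall>i<d. x i \<in> A) \<longrightarrow>
      ((\<Sum>i<d. \<nu> (D i i) * (x i * x i)) = 0 \<longleftrightarrow> (\<Sum>i<d. u i * x i) = 0 \<and> (\<Sum>i<d. v i * x i) = 0)) \<and>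
    (\<forall>x. (\<Sum>i<d. j (\<nu> (D i i)) * inc (x i * x i)) = 0 \<longrightarrow>
      (\<Sum>i<d. j (u i) * inc (x i)) = 0 \<and> (\<Sum>i<d. j (v i) * inc (x i)) = 0)"
  proof
    fix \<nu> assume \<nu>: "\<nu> \<in> Z"
    show "\<exists>u v. (\<forall>x. (\<forall>i<d. x i \<in> A) \<longrightarrow>
      ((\<Sum>i<d. \<nu> (D i i) * (x i * x i)) = 0 \<longleftrightarrow> (\<Sum>i<d. u i * x i) = 0 \<and> (\<Sum>i<d. v i * x i) = 0)) \<and>
    (\<forall>x. (\<Sum>i<d. j (\<nu> (D i i)) * inc (x i * x i)) = 0 \<longrightarrow>
      (\<Sum>i<d. j (u i) * inc (x i)) = 0 \<and> (\<Sum>i<d. j (v i) * inc (x i)) = 0)"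
    proof (rule vanishing_condition_linear)
      have "2 * \<nu> (D i i) = 0" if "i < d" for i using Z[OF \<nu> D(2)] dbl[OF fZ[OF \<nu>]] that by metis
      then show "(2::'f) = 0 \<or> (\<forall>i<d. \<nu> (D i i) = 0)" by auto
    qed
  qed
  then obtain u' v' where uv': "\<And>\<nu> x. \<nu> \<in> Z \<Longrightarrow> (\<forall>i<d. x i \<in> A) \<Longrightarrow>
      ((\<Sum>i<d. \<nu> (D i i) * (x i * x i)) = 0 \<longleftrightarrow> (\<Sum>i<d. u' \<nu> i * x i) = 0 \<and> (\<Sum>i<d. v' \<nu> i * x i) = 0)"
    "\<And>\<nu> x. \<nu> \<in> Z \<Longrightarrow> (\<Sum>i<d. j (\<nu> (D i i)) * inc (x i * x i)) = 0 \<Longrightarrow>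
      (\<Sum>i<d. j (u' \<nu> i) * inc (x i)) = 0 \<and> (\<Sum>i<d. j (v' \<nu> i) * inc (x i)) = 0"
    unfolding bchoice_iff by blast
  show thesis
  proof (rule that[of "u ` P \<union> v ` P" "u' ` Z \<union> v' ` Z"])
    show "finite (u ` P \<union> v ` P)" using PZ(1) by simp
  next
    fix y :: "nat \<Rightarrow> 'f" assume y: "\<And>k. k < d \<Longrightarrow> y k \<in> A"
    define W where "W = (\<Sum>i<d. \<Sum>k<d. scE (y i * y k) (D i k))"
    define V where "V = (\<Sum>k<d. scE (y k * y k) (D k k))"
    have "W - V \<in> AA.N"
      unfolding W_def V_def
    proof (rule double_sum_minus_diagonal[OF AA.N_closed])
      fix i k assume ik: "i \<in> {..<d}" "k \<in> {..<d}"
      have "scE (y i * y k) (D i k) + scE (y k * y i) (D k i) = scE (y i * y k) (D i k + D k i)"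
        by (simp add: E.scale_right_distrib mult.commute)
      then show "scE (y i * y k) (D i k) + scE (y k * y i) (D k i) \<in> AA.N"
        using scN[of "y i * y k" "D i k + D k i"] ik y A_mult D(2) by simp
    qed simp
    then have "W \<in> AA.N \<longleftrightarrow> V \<in> AA.N"
      using additively_closedD(2)[OF AA.N_closed, of W "W - V"] additively_closedD(4)[OF AA.N_closed, of "W - V" V] by auto
    also have "\<dots> \<longleftrightarrow> (\<forall>\<nu>\<in>P. (\<Sum>i<d. \<nu> (D i i) * (y i * y i)) \<in> A) \<and> (\<forall>\<nu>\<in>Z. (\<Sum>i<d. \<nu> (D i i) * (y i * y i)) = 0)"
      unfolding PZ(3) V_def
      by (simp add: functional_sum[OF fP] functional_scale[OF fP] functional_sum[OF fZ] functional_scale[OF fZ] mult.commute)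
    also have "\<dots> \<longleftrightarrow> (\<forall>\<nu>\<in>P. (\<Sum>i<d. u \<nu> i * y i) \<in> A \<and> (\<Sum>i<d. v \<nu> i * y i) \<in> A) \<and>
        (\<forall>\<nu>\<in>Z. (\<Sum>i<d. u' \<nu> i * y i) = 0 \<and> (\<Sum>i<d. v' \<nu> i * y i) = 0)"
      using uv(1)[of _ y] uv'(1)[of _ y] y by simp
    also have "\<dots> \<longleftrightarrow> (\<forall>m\<in>u ` P \<union> v ` P. (\<Sum>k<d. m k * y k) \<in> A) \<and> (\<forall>m\<in>u' ` Z \<union> v' ` Z. (\<Sum>k<d. m k * y k) = 0)"
      by (simp only: ball_Un ball_simps(9) ball_conj_distrib)
    finally show "(\<Sum>i<d. \<Sum>k<d. scE (y i * y k) (D i k)) \<in> AA.N \<longleftrightarrow>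
      (\<forall>m\<in>u ` P \<union> v ` P. (\<Sum>k<d. m k * y k) \<in> A) \<and> (\<forall>m\<in>u' ` Z \<union> v' ` Z. (\<Sum>k<d. m k * y k) = 0)"
      unfolding W_def .
  next
    fix x :: "nat \<Rightarrow> 'r" assume x: "(\<Sum>i<d. \<Sum>k<d. tau (D i k) (x i * x k)) \<in> RR.N"
    then obtain Y where Y: "Y \<in> TR" "(\<Sum>i<d. \<Sum>k<d. tau (D i k) (x i * x k)) = Y + RR.ad Y" unfolding RR.N_def by blast
    obtain d' :: nat and T t tR where T: "\<And>k. k < d' \<Longrightarrow> T k \<in> TA" "\<And>k. functional scE (t k)" "\<And>k X. k < d' \<Longrightarrow> X \<in> TA \<Longrightarrow> t k X \<in> A"
      "\<And>X. linear_end act X \<Longrightarrow> X = (\<Sum>k<d'. scE (t k X) (T k))"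
      "\<And>k \<mu> X. functional scKR \<mu> \<Longrightarrow> \<mu> (tR k X) = t k (slice \<mu> X)"
      "\<And>X. X \<in> TR \<Longrightarrow> \<exists>x. (\<forall>k<d'. inc (x k) = tR k X) \<and> X = (\<Sum>k<d'. tau (T k) (x k))"
      by (rule endomorphism_coordinates) (rule that)
    obtain z where z: "Y = (\<Sum>k<d'. tau (T k) (z k))" using T(6)[OF Y(1)] by blast
    define M where "M = (\<lambda>k. T k + AA.ad (T k))"
    have MN: "M k \<in> AA.N" if "k < d'" for k unfolding M_def AA.N_def using T(1)[OF that] by blast
    have Mlin: "linear_end act (M k)" if "k < d'" for k
      unfolding M_def using T(1)[OF that] AA.ad(1) TA_linear linear_end_closed(1) by blast
    have "RR.ad Y = (\<Sum>k<d'. tau (AA.ad (T k)) (z k))"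
      unfolding z by (subst RR.ad_sum) (simp_all add: tau_TR T(1) ad_tau)
    then have YM: "Y + RR.ad Y = (\<Sum>k<d'. tau (M k) (z k))"
      unfolding z M_def using T(1) AA.ad(1) by (simp add: tau_add(1) TA_linear sum.distrib)
    \<comment> \<open>An element of \<open>RR.N\<close> is a sum of tensors
      \<open>M k \<otimes> z k\<close> with \<open>M k\<close> in \<open>AA.N\<close>. A functional
      \<open>\<nu>\<close> on endomorphisms of \<open>V\<close> is applied to both expressions
      through slices, which is enough for an equation in \<open>K \<otimes> R\<close>.\<close>
    have key: "(\<Sum>i<d. \<Sum>k<d. j (\<nu> (D i k)) * inc (x i * x k)) = (\<Sum>k<d'. j (\<nu> (M k)) * inc (z k))"
      if \<nu>: "functional scE \<nu>" for \<nu>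
    proof (rule KR_separated)
      fix \<mu> assume \<mu>: "functional scKR \<mu>"
      have "\<nu> (slice \<mu> (\<Sum>i<d. \<Sum>k<d. tau (D i k) (x i * x k))) = \<mu> (\<Sum>i<d. \<Sum>k<d. j (\<nu> (D i k)) * inc (x i * x k))"
        unfolding slice_sum[OF \<mu>] functional_sum[OF \<mu>] functional_sum[OF \<nu>]
        by (intro sum.cong refl) (simp add: functional_slice_tau[OF \<nu> \<mu>] TA_linear D(1))
      moreover have "\<nu> (slice \<mu> (\<Sum>k<d'. tau (M k) (z k))) = \<mu> (\<Sum>k<d'. j (\<nu> (M k)) * inc (z k))"
        unfolding slice_sum[OF \<mu>] functional_sum[OF \<mu>] functional_sum[OF \<nu>]
        by (intro sum.cong refl) (simp add: functional_slice_tau[OF \<nu> \<mu>] Mlin)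
      ultimately show "\<mu> (\<Sum>i<d. \<Sum>k<d. j (\<nu> (D i k)) * inc (x i * x k)) = \<mu> (\<Sum>k<d'. j (\<nu> (M k)) * inc (z k))"
        using Y(2) YM by simp
    qed
    \<comment> \<open>\<open>S\<close> will be the image of \<open>R\<close> for the integrality
      conditions and \<open>{0}\<close> for the vanishing ones.\<close>
    have diag: "(\<Sum>i<d. j (\<nu> (D i i)) * inc (x i * x i)) \<in> S"
      if \<nu>: "functional scE \<nu>" and S: "additively_closed S" "\<And>W r. W \<in> AA.N \<Longrightarrow> j (\<nu> W) * inc r \<in> S" for \<nu> S
    proof -
      have diff: "(\<Sum>i<d. \<Sum>k<d. j (\<nu> (D i k)) * inc (x i * x k)) - (\<Sum>i<d. j (\<nu> (D i i)) * inc (x i * x i)) \<in> S"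
      proof (rule double_sum_minus_diagonal[OF S(1)])
        fix i k assume ik: "i \<in> {..<d}" "k \<in> {..<d}"
        have "j (\<nu> (D i k)) * inc (x i * x k) + j (\<nu> (D k i)) * inc (x k * x i) = j (\<nu> (D i k + D k i)) * inc (x i * x k)"
          by (simp add: functional_add[OF \<nu>] j_hom distrib_right mult.commute[of "x k" "x i"])
        then show "j (\<nu> (D i k)) * inc (x i * x k) + j (\<nu> (D k i)) * inc (x k * x i) \<in> S"
          using S(2) D(2) ik by simp
      qed simp
      have total: "(\<Sum>i<d. \<Sum>k<d. j (\<nu> (D i k)) * inc (x i * x k)) \<in> S"
        unfolding key[OF \<nu>] by (rule additively_closed_sum[OF S(1)]) (simp add: S(2) MN)
      show ?thesis using additively_closedD(2)[OF S(1) total diff] by (simp only: diff_diff_eq2 add_diff_cancel_left')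
    qed
    have "(\<Sum>i<d. j (\<nu> (D i i)) * inc (x i * x i)) \<in> range inc" if "\<nu> \<in> P" for \<nu>
    proof (rule diag[OF fP[OF that] inc_range(1)])
      show "j (\<nu> W) * inc r \<in> range inc" if "W \<in> AA.N" for W r
        by (rule inc_range(2)[OF inc_range(4)[OF P[OF \<open>\<nu> \<in> P\<close> that]]]) simp
    qed
    moreover have "(\<Sum>i<d. j (\<nu> (D i i)) * inc (x i * x i)) = 0" if "\<nu> \<in> Z" for \<nu>
    proof -
      have "(\<Sum>i<d. j (\<nu> (D i i)) * inc (x i * x i)) \<in> {0}"
        by (rule diag[OF fZ[OF that]]) (simp_all add: additively_closed_def Z[OF that] j_hom)
      then show ?thesis by simp
    qed
    ultimately show "(\<forall>m\<in>u ` P \<union> v ` P. (\<Sum>k<d. j (m k) * inc (x k)) \<in> range inc) \<and>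
        (\<forall>m\<in>u' ` Z \<union> v' ` Z. (\<Sum>k<d. j (m k) * inc (x k)) = 0)"
      using uv(2) uv'(2) unfolding ball_Un ball_simps(9) by simp
  qed
qed

text \<open>Modulo tensor relations every formal sum is the sum of the
  \<open>U k \<otimes> c k\<close>, where \<open>c k\<close> arises by applying
  \<open>\<omega> k\<close> to the first components. If the resulting endomorphism vanishes, so do
  its slices and with them all \<open>\<mu> (inc (c k))\<close>; hence
  \<open>c k = 0\<close>.\<close>

lemma tensor_product_of_span:
  fixes d :: nat
  assumes \<Lambda>: "additively_closed \<Lambda>" "\<And>a X. a \<in> A \<Longrightarrow> X \<in> \<Lambda> \<Longrightarrow> scE a X \<in> \<Lambda>" "\<And>X. X \<in> \<Lambda> \<Longrightarrow> linear_end act X"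
    and U: "\<And>k. k < d \<Longrightarrow> U k \<in> \<Lambda>" and \<omega>: "\<And>k. functional scE (\<omega> k)"
      "\<And>k X. k < d \<Longrightarrow> X \<in> \<Lambda> \<Longrightarrow> \<omega> k X \<in> A" "\<And>X. X \<in> \<Lambda> \<Longrightarrow> X = (\<Sum>k<d. scE (\<omega> k X) (U k))"
  shows "tensor_product A scE \<alpha> \<Lambda> tau (tensor_image tau \<Lambda>)"
proof -
  define Rl where "Rl = tensor_relations A scE \<alpha> \<Lambda>"
  have Rl: "additively_closed Rl"
    by (auto simp: additively_closed_def Rl_def tensor_relations_def group_closure.diff)
  note Rc = additively_closedD[OF Rl]
  have r1: "frag_of (X + Y, r) - frag_of (X, r) - frag_of (Y, r) \<in> Rl" if "X \<in> \<Lambda>" "Y \<in> \<Lambda>" for X Y r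
    unfolding Rl_def tensor_relations_def by (rule group_closure.base) (use that in blast)
  have r2: "frag_of (X, r + s) - frag_of (X, r) - frag_of (X, s) \<in> Rl" if "X \<in> \<Lambda>" for X r s
    unfolding Rl_def tensor_relations_def by (rule group_closure.base) (use that in blast)
  have r3: "frag_of (scE a X, r) - frag_of (X, \<alpha> a * r) \<in> Rl" if "a \<in> A" "X \<in> \<Lambda>" for X r a
    unfolding Rl_def tensor_relations_def by (rule group_closure.base) (use that in blast)
  have z1: "frag_of (0, r) \<in> Rl" for r
    using r1[of 0 0 r] Rc(1) additively_closedD(1)[OF \<Lambda>(1)] Rc(3)[of "- frag_of (0, r)"] by simp
  have z2: "frag_of (X, 0) \<in> Rl" if "X \<in> \<Lambda>" for X
    using r2[OF that, of 0 0] Rc(3)[of "- frag_of (X, 0)"] by simp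
  have sum1: "(\<Sum>k\<in>I. f k) \<in> \<Lambda> \<and> frag_of (\<Sum>k\<in>I. f k, r) - (\<Sum>k\<in>I. frag_of (f k, r)) \<in> Rl"
    if "finite I" "\<And>k. k \<in> I \<Longrightarrow> f k \<in> \<Lambda>" for I :: "nat set" and f r
    using that
  proof (induction I rule: finite_induct)
    case empty
    show ?case unfolding sum.empty diff_zero using additively_closedD(1)[OF \<Lambda>(1)] z1 by blast
  next
    case (insert i I)
    then have IH: "(\<Sum>k\<in>I. f k) \<in> \<Lambda>" "frag_of (\<Sum>k\<in>I. f k, r) - (\<Sum>k\<in>I. frag_of (f k, r)) \<in> Rl" by simp_all
    have fi: "f i \<in> \<Lambda>" using insert.prems by simp
    have "(frag_of (f i + (\<Sum>k\<in>I. f k), r) - frag_of (f i, r) - frag_of (\<Sum>k\<in>I. f k, r))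
      + (frag_of (\<Sum>k\<in>I. f k, r) - (\<Sum>k\<in>I. frag_of (f k, r))) \<in> Rl"
      by (rule Rc(4)[OF r1[OF fi IH(1)] IH(2)])
    then have "frag_of (f i + (\<Sum>k\<in>I. f k), r) - (frag_of (f i, r) + (\<Sum>k\<in>I. frag_of (f k, r))) \<in> Rl"
      by (simp only: diff_diff_eq[symmetric] diff_add_cancel add_diff_eq)
    then show ?case unfolding sum.insert[OF insert.hyps] using additively_closedD(4)[OF \<Lambda>(1) fi IH(1)] by blast
  qed
  define c where "c = (\<lambda>xs k. \<Sum>(X, r)\<leftarrow>xs. \<alpha> (\<omega> k X) * r)"
  have c_Cons: "c ((X, r) # xs) k = \<alpha> (\<omega> k X) * r + c xs k" for X r xs k by (simp add: c_def)
  have red: "(\<Sum>z\<leftarrow>xs. frag_of z) - (\<Sum>k<d. frag_of (U k, c xs k)) \<in> Rl" if "fst ` set xs \<subseteq> \<Lambda>" for xs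
    using that
  proof (induction xs)
    case Nil
    have "- (\<Sum>k<d. frag_of (U k, 0 :: 'r)) \<in> Rl"
      by (intro Rc(3) additively_closed_sum[OF Rl] z2 U) simp
    then show ?case by (simp add: c_def)
  next
    case (Cons p xs)
    obtain X r where p: "p = (X, r)" by (cases p)
    have X: "X \<in> \<Lambda>" and IH: "(\<Sum>z\<leftarrow>xs. frag_of z) - (\<Sum>k<d. frag_of (U k, c xs k)) \<in> Rl"
      using Cons p by auto
    have 1: "frag_of (X, r) - (\<Sum>k<d. frag_of (scE (\<omega> k X) (U k), r)) \<in> Rl"
      using sum1[of "{..<d}" "\<lambda>k. scE (\<omega> k X) (U k)" r] \<omega>(3)[OF X, symmetric] \<Lambda>(2) \<omega>(2)[OF _ X] U by simp
    have 2: "(\<Sum>k<d. frag_of (scE (\<omega> k X) (U k), r)) - (\<Sum>k<d. frag_of (U k, \<alpha> (\<omega> k X) * r)) \<in> Rl"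
      unfolding sum_subtractf[symmetric] by (rule additively_closed_sum[OF Rl]) (simp add: r3 \<omega>(2)[OF _ X] U)
    have 3: "(\<Sum>k<d. frag_of (U k, c (p # xs) k)) - (\<Sum>k<d. frag_of (U k, \<alpha> (\<omega> k X) * r)) - (\<Sum>k<d. frag_of (U k, c xs k)) \<in> Rl"
      unfolding sum_subtractf[symmetric] p c_Cons by (rule additively_closed_sum[OF Rl]) (simp add: r2 U)
    show ?case using Rc(2)[OF Rc(4)[OF Rc(4)[OF 1 2] IH] 3] by (simp add: p add_diff_eq)
  qed
  have "tensor_injective A scE \<alpha> \<Lambda> tau"
    unfolding tensor_injective_def
  proof (intro allI impI)
    fix xs assume xs: "fst ` set xs \<subseteq> \<Lambda> \<and> tensor_sum tau xs = 0"
    have slice: "\<omega> k (slice \<mu> (tensor_sum tau ys)) = \<mu> (inc (c ys k))"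
      if "fst ` set ys \<subseteq> \<Lambda>" "functional scKR \<mu>" "k < d" for ys k \<mu>
      using that(1)
    proof (induction ys)
      case Nil
      have 0: "tensor_sum tau [] = 0" by (simp add: tensor_sum_def)
      show ?case unfolding 0 slice_zero[OF that(2)] functional_zero[OF \<omega>(1)]
        by (simp add: c_def inc_hom functional_zero[OF that(2)])
    next
      case (Cons p ys)
      obtain X r where p: "p = (X, r)" by (cases p)
      have X: "X \<in> \<Lambda>" using Cons.prems p by auto
      have "\<omega> k (slice \<mu> (tau X r)) = \<mu> (inc (\<alpha> (\<omega> k X) * r))"
        using functional_slice_tau[OF \<omega>(1) that(2) \<Lambda>(3)[OF X]] inc_\<alpha>[OF \<omega>(2)[OF that(3) X]] by simp
      moreover have "\<omega> k (slice \<mu> (tensor_sum tau ys)) = \<mu> (inc (c ys k))" using Cons p by simp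
      moreover have e: "tensor_sum tau (p # ys) = tau X r + tensor_sum tau ys" by (simp add: tensor_sum_def p)
      ultimately show ?case
        unfolding e slice_add[OF that(2)] functional_add[OF \<omega>(1)] by (simp add: p c_Cons inc_hom functional_add[OF that(2)])
    qed
    have "c xs k = 0" if k: "k < d" for k
    proof -
      have "inc (c xs k) = 0"
      proof (rule KR_separated)
        fix \<mu> :: "'kr \<Rightarrow> 'f" assume \<mu>: "functional scKR \<mu>"
        have 0: "tensor_sum tau xs = 0" using xs by blast
        have "\<omega> k (slice \<mu> (tensor_sum tau xs)) = 0"
          unfolding 0 slice_zero[OF \<mu>] functional_zero[OF \<omega>(1)] ..
        moreover have "\<omega> k (slice \<mu> (tensor_sum tau xs)) = \<mu> (inc (c xs k))" using slice[OF _ \<mu> k] xs by blast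
        ultimately show "\<mu> (inc (c xs k)) = \<mu> 0" by (simp add: functional_zero[OF \<mu>])
      qed
      then show ?thesis using inc_inj[of "c xs k" 0] by (simp add: inc_hom)
    qed
    then have "(\<Sum>k<d. frag_of (U k, c xs k)) \<in> Rl"
      by (intro additively_closed_sum[OF Rl]) (simp add: z2 U)
    then have "((\<Sum>z\<leftarrow>xs. frag_of z) - (\<Sum>k<d. frag_of (U k, c xs k))) + (\<Sum>k<d. frag_of (U k, c xs k)) \<in> Rl"
      using red xs by (intro Rc(4)) auto
    then show "(\<Sum>z\<leftarrow>xs. frag_of z) \<in> tensor_relations A scE \<alpha> \<Lambda>" by (simp add: Rl_def)
  qed
  moreover have "submodule_of A scE UNIV \<Lambda>"
    using \<Lambda> additively_closedD(1,2)[OF \<Lambda>(1)] by (simp add: submodule_of_def)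
  ultimately show ?thesis unfolding tensor_product_def
    by (simp add: tau_add tau_scale \<Lambda>(3))
qed

section \<open>The base change of T1\<close>

definition scalarR :: "'r \<Rightarrow> 'vr \<Rightarrow> 'vr" where "scalarR r = (\<lambda>y. actR y (\<tau>K 1 r))"

lemma id_TA: "id \<in> TA"
  by (simp add: T0_def linear_end_def additive_map_def)

lemma scalarR_eq: "scalarR r = tau id r"
proof -
  have "bc id = id" by (rule bc_eqI) simp_all
  then show ?thesis by (simp add: scalarR_def tau_def)
qed

lemma scalarR: "scalarR r \<in> TR" "RR.ad (scalarR r) = scalarR r" "X \<in> TR \<Longrightarrow> scalarR r \<circ> X = X \<circ> scalarR r"
proof -
  show "scalarR r \<in> TR" unfolding scalarR_eq by (rule tau_TR[OF id_TA])
  have "AA.ad id = id" by (rule AA.ad_eqI) (simp_all add: TA_linear id_TA)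
  then show "RR.ad (scalarR r) = scalarR r" unfolding scalarR_eq ad_tau[OF id_TA] by simp
  show "scalarR r \<circ> X = X \<circ> scalarR r" if "X \<in> TR"
    by (rule ext) (simp add: scalarR_def linear_end_act[OF TR_linear[OF that]])
qed

lemma T1_eq: "T1 act h L Ls = AA.T1'"
  by (simp add: T1_def AA.T1'_def)

text \<open>For \<open>r = 1\<close> the two conditions are the images of those over
  \<open>A\<close>; the general case multiplies by the central self-adjoint scalar
  \<open>r\<close>.\<close>

lemma T1R_tau: "X \<in> AA.T1' \<Longrightarrow> tau X r \<in> RR.T1'"
proof -
  assume X: "X \<in> AA.T1'"
  note x = X[unfolded AA.T1'_iff]
  have XT: "X \<in> TA" "AA.ad X \<in> TA" using x AA.ad(1) by auto
  have "RR.ad (tau X 1) \<circ> tau X 1 \<in> RR.N" "tau X 1 \<circ> RR.ad (tau X 1) \<in> RR.N"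
    using x tau_in_N by (simp_all add: ad_tau[OF XT(1)] tau_comp TA_linear[OF XT(1)] TA_linear[OF XT(2)])
  then have "tau X 1 \<in> RR.T1'" unfolding RR.T1'_iff using tau_TR[OF XT(1)] by blast
  then have "scalarR r \<circ> tau X 1 \<in> RR.T1'" by (intro RR.T1'_scale scalarR)
  moreover have "scalarR r \<circ> tau X 1 = tau X r"
    by (rule ext) (simp add: scalarR_def tau_def \<tau>K_1 actR_one)
  ultimately show "tau X r \<in> RR.T1'" by simp
qed

text \<open>Once the quadratic conditions are linear, \<open>T1(A)\<close> is cut out of a subspace
  by finitely many functionals required to be integral, so the lattice lemma applies a second time.
  An element of \<open>T1(R)\<close> satisfies the linear conditions with the same coefficients, and
  descent expresses it through the generators of \<open>T1(A)\<close>.\<close>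

lemma T1_linear_description:
  obtains d :: nat and U \<omega> where "\<And>k. k < d \<Longrightarrow> U k \<in> AA.T1'" "\<And>k. functional scE (\<omega> k)"
    "\<And>k X. k < d \<Longrightarrow> X \<in> AA.T1' \<Longrightarrow> \<omega> k X \<in> A" "\<And>X. X \<in> AA.T1' \<Longrightarrow> X = (\<Sum>k<d. scE (\<omega> k X) (U k))"
    "RR.T1' \<subseteq> tensor_image tau AA.T1'"
proof -
  interpret E: vector_space scE by (rule vector_space_E)
  obtain d :: nat and T t tR where T: "\<And>k. k < d \<Longrightarrow> T k \<in> TA" "\<And>k. functional scE (t k)" "\<And>k X. k < d \<Longrightarrow> X \<in> TA \<Longrightarrow> t k X \<in> A"
    "\<And>X. linear_end act X \<Longrightarrow> X = (\<Sum>k<d. scE (t k X) (T k))"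
    "\<And>k \<mu> X. functional scKR \<mu> \<Longrightarrow> \<mu> (tR k X) = t k (slice \<mu> X)"
    "\<And>X. X \<in> TR \<Longrightarrow> \<exists>x. (\<forall>k<d. inc (x k) = tR k X) \<and> X = (\<Sum>k<d. tau (T k) (x k))"
    by (rule endomorphism_coordinates) (rule that)
  obtain J where J: "finite J" "\<And>p. p \<in> J \<Longrightarrow> functional scV (fst p)"
    "\<And>X. linear_end act X \<Longrightarrow> X \<in> TA \<longleftrightarrow> (\<forall>p\<in>J. matrix_entry p X \<in> A)"
    "\<And>X. linear_end act X \<Longrightarrow> \<forall>p\<in>J. matrix_entry p X = 0 \<Longrightarrow> X = 0"
    "\<And>X p. X \<in> TR \<Longrightarrow> p \<in> J \<Longrightarrow> matrix_entryR p X \<in> range inc" by (rule matrix_entries_exist) (rule that)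
  note adT = AA.ad(1)[OF T(1)]
  have D1: "AA.ad (T i) \<circ> T k \<in> TA" "T i \<circ> AA.ad (T k) \<in> TA" if "i < d" "k < d" for i k
    using that by (simp_all add: TA_closed(2) adT T(1))
  obtain CP CZ where C: "finite CP"
    "\<And>y. (\<And>k. k < d \<Longrightarrow> y k \<in> A) \<Longrightarrow> (\<Sum>i<d. \<Sum>k<d. scE (y i * y k) (AA.ad (T i) \<circ> T k)) \<in> AA.N \<longleftrightarrow>
      (\<forall>m\<in>CP. (\<Sum>k<d. m k * y k) \<in> A) \<and> (\<forall>m\<in>CZ. (\<Sum>k<d. m k * y k) = 0)"
    "\<And>x. (\<Sum>i<d. \<Sum>k<d. tau (AA.ad (T i) \<circ> T k) (x i * x k)) \<in> RR.N \<Longrightarrow>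
      (\<forall>m\<in>CP. (\<Sum>k<d. j (m k) * inc (x k)) \<in> range inc) \<and> (\<forall>m\<in>CZ. (\<Sum>k<d. j (m k) * inc (x k)) = 0)"
    by (rule quadratic_conditions_linear[of d "\<lambda>i k. AA.ad (T i) \<circ> T k"])
      (simp_all add: D1 AA.cross_in_N T(1))
  obtain CP' CZ' where C': "finite CP'"
    "\<And>y. (\<And>k. k < d \<Longrightarrow> y k \<in> A) \<Longrightarrow> (\<Sum>i<d. \<Sum>k<d. scE (y i * y k) (T i \<circ> AA.ad (T k))) \<in> AA.N \<longleftrightarrow>
      (\<forall>m\<in>CP'. (\<Sum>k<d. m k * y k) \<in> A) \<and> (\<forall>m\<in>CZ'. (\<Sum>k<d. m k * y k) = 0)"
    "\<And>x. (\<Sum>i<d. \<Sum>k<d. tau (T i \<circ> AA.ad (T k)) (x i * x k)) \<in> RR.N \<Longrightarrow>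
      (\<forall>m\<in>CP'. (\<Sum>k<d. j (m k) * inc (x k)) \<in> range inc) \<and> (\<forall>m\<in>CZ'. (\<Sum>k<d. j (m k) * inc (x k)) = 0)"
    by (rule quadratic_conditions_linear[of d "\<lambda>i k. T i \<circ> AA.ad (T k)"])
      (simp_all add: D1 AA.cross_in_N' T(1))
  define E' where "E' = {X. linear_end act X \<and> (\<forall>m\<in>CZ \<union> CZ'. (\<Sum>k<d. m k * t k X) = 0)}"
  \<comment> \<open>Left summands test membership in \<open>T0(A)\<close>; right summands are the
    integrality conditions coming from \<open>X^ad X\<close> and from \<open>X X^ad\<close>. The
    vanishing conditions are built into \<open>E'\<close>.\<close>
  define I where "I = (Inl ` J \<union> Inr ` (CP \<union> CP') :: (('v \<Rightarrow> 'f) \<times> 'v + (nat \<Rightarrow> 'f)) set)"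
  define \<psi> where "\<psi> = case_sum matrix_entry (\<lambda>m X. \<Sum>k<d. m k * t k X)"
  have \<psi>_simps: "\<psi> (Inl p) = matrix_entry p" "\<psi> (Inr m) = (\<lambda>X. \<Sum>k<d. m k * t k X)" for p m by (simp_all add: \<psi>_def)
  have lin_t: "functional scE (\<lambda>X. \<Sum>k<d. m k * t k X)" for m by (rule functional_combination[OF T(2)])
  have \<psi>_fun: "functional scE (\<psi> i)" if "i \<in> I" for i
    using that unfolding I_def by (elim UnE imageE) (simp_all add: \<psi>_simps functional_matrix_entry J(2) lin_t)
  have subE': "module.subspace scE E'"
    unfolding E'_def E.subspace_def
    by (simp add: linear_end_zero_map linear_end_closed(1) linear_end_closed(4)[OF _ linear_end_zero_map] functional_zero[OF lin_t] functional_add[OF lin_t] functional_scale[OF lin_t])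
  have "\<exists>(e::nat) w g. (\<forall>k<e. w k \<in> E' \<and> (\<forall>i\<in>I. \<psi> i (w k) \<in> A)) \<and> (\<forall>k<e. \<forall>i\<in>I. g k i \<in> A) \<and>
      (\<forall>X\<in>E'. X = (\<Sum>k<e. scE (\<Sum>i\<in>I. g k i * \<psi> i X) (w k)))"
  proof (rule lattice_generators[OF vector_space_E _ \<psi>_fun subE'])
    show "finite I" using J(1) C(1) C'(1) by (simp add: I_def)
    fix X assume X: "X \<in> E'" and z: "\<And>i. i \<in> I \<Longrightarrow> \<psi> i X = 0"
    have "\<forall>p\<in>J. matrix_entry p X = 0" using z[of "Inl _"] by (simp add: I_def \<psi>_simps)
    then show "X = 0" using X J(4) by (simp add: E'_def)
  qed
  then obtain e U g where U: "\<forall>k<(e::nat). U k \<in> E' \<and> (\<forall>i\<in>I. \<psi> i (U k) \<in> A)" and g: "\<forall>k<e. \<forall>i\<in>I. g k i \<in> A"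
    and ex: "\<forall>X\<in>E'. X = (\<Sum>k<e. scE (\<Sum>i\<in>I. g k i * \<psi> i X) (U k))" by (elim exE conjE) (rule that)
  define \<omega> where "\<omega> = (\<lambda>k X. \<Sum>i\<in>I. g k i * \<psi> i X)"
  have I_ball: "(\<forall>i\<in>I. \<psi> i X \<in> A) \<longleftrightarrow> (\<forall>p\<in>J. matrix_entry p X \<in> A) \<and> (\<forall>m\<in>CP \<union> CP'. (\<Sum>k<d. m k * t k X) \<in> A)" for X
    by (simp add: I_def ball_Un \<psi>_simps)
  have T1_iff: "X \<in> AA.T1' \<longleftrightarrow> X \<in> E' \<and> (\<forall>i\<in>I. \<psi> i X \<in> A)" for X
  proof (cases "X \<in> TA")
    case True
    define y where "y = (\<lambda>k. t k X)"
    have y: "y k \<in> A" if "k < d" for k unfolding y_def by (rule T(3)[OF that True])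
    have Xe: "X = (\<Sum>k<d. scE (y k) (T k))" unfolding y_def by (rule T(4)[OF TA_linear[OF True]])
    have adX: "AA.ad X = (\<Sum>k<d. scE (y k) (AA.ad (T k)))"
    proof -
      have "AA.ad X = (\<Sum>k<d. AA.ad (scE (y k) (T k)))"
        unfolding Xe by (rule AA.ad_sum) (simp add: TA_closed(3) y T(1))
      then show ?thesis by (simp add: ad_scE T(1))
    qed
    have comp: "(\<Sum>i<d. scE (y i) (F i)) \<circ> (\<Sum>k<d. scE (y k) (G k)) = (\<Sum>i<d. \<Sum>k<d. scE (y i * y k) (F i \<circ> G k))"
      if F: "\<And>i. i < d \<Longrightarrow> linear_end act (F i)" for F G
    proof
      fix v
      have a: "F i (\<Sum>k<d. scV (y k) (G k v)) = (\<Sum>k<d. scV (y k) (F i (G k v)))" if "i < d" for i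
        by (simp add: linear_end_sum[OF F[OF that]] scV_def linear_end_act[OF F[OF that]])
      have s: "(\<Sum>i<d. f i) v = (\<Sum>i<d. f i v)" for f :: "nat \<Rightarrow> 'v \<Rightarrow> 'v" and v
        by (induction d) simp_all
      interpret V: vector_space scV by (rule vector_space_V)
      show "((\<Sum>i<d. scE (y i) (F i)) \<circ> (\<Sum>k<d. scE (y k) (G k))) v = (\<Sum>i<d. \<Sum>k<d. scE (y i * y k) (F i \<circ> G k)) v"
        by (simp add: s scE_apply a V.scale_sum_right)
    qed
    have "AA.ad X \<circ> X = (\<Sum>i<d. \<Sum>k<d. scE (y i * y k) (AA.ad (T i) \<circ> T k))"
      unfolding adX by (subst Xe) (rule comp, rule TA_linear[OF adT])
    then have 1: "AA.ad X \<circ> X \<in> AA.N \<longleftrightarrow> (\<forall>m\<in>CP. (\<Sum>k<d. m k * y k) \<in> A) \<and> (\<forall>m\<in>CZ. (\<Sum>k<d. m k * y k) = 0)"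
      using C(2)[of y] y by simp
    have "X \<circ> AA.ad X = (\<Sum>i<d. \<Sum>k<d. scE (y i * y k) (T i \<circ> AA.ad (T k)))"
      unfolding adX by (subst Xe) (rule comp, rule TA_linear[OF T(1)])
    then have 2: "X \<circ> AA.ad X \<in> AA.N \<longleftrightarrow> (\<forall>m\<in>CP'. (\<Sum>k<d. m k * y k) \<in> A) \<and> (\<forall>m\<in>CZ'. (\<Sum>k<d. m k * y k) = 0)"
      using C'(2)[of y] y by simp
    have 3: "\<forall>p\<in>J. matrix_entry p X \<in> A" using True J(3)[OF TA_linear[OF True]] by blast
    show ?thesis unfolding AA.T1'_iff 1 2 using True TA_linear[OF True] 3
      by (auto simp: E'_def I_ball y_def)
  next
    case False
    then have "\<not> (X \<in> E' \<and> (\<forall>i\<in>I. \<psi> i X \<in> A))"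
      using J(3)[of X] by (auto simp: E'_def I_ball)
    then show ?thesis using False by (simp add: AA.T1'_iff)
  qed
  show thesis
  proof (rule that[of e U \<omega>])
    show "U k \<in> AA.T1'" if "k < e" for k using U that T1_iff by blast
    show "functional scE (\<omega> k)" for k unfolding \<omega>_def by (rule functional_combination[OF \<psi>_fun])
    show "\<omega> k X \<in> A" if "k < e" "X \<in> AA.T1'" for k X
    proof -
      have "\<forall>i\<in>I. \<psi> i X \<in> A" using that(2) T1_iff by blast
      then show ?thesis unfolding \<omega>_def using g that(1) by (intro A_sum A_mult) auto
    qed
    show "X = (\<Sum>k<e. scE (\<omega> k X) (U k))" if "X \<in> AA.T1'" for X
      unfolding \<omega>_def using ex that T1_iff by blast
    show "RR.T1' \<subseteq> tensor_image tau AA.T1'"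
    proof
      fix X assume "X \<in> RR.T1'"
      then have X: "X \<in> TR" "RR.ad X \<circ> X \<in> RR.N" "X \<circ> RR.ad X \<in> RR.N" by (simp_all add: RR.T1'_iff)
      obtain x where x: "\<And>k. k < d \<Longrightarrow> inc (x k) = tR k X" and Xe: "X = (\<Sum>k<d. tau (T k) (x k))"
        using T(6)[OF X(1)] by blast
      have adX: "RR.ad X = (\<Sum>k<d. tau (AA.ad (T k)) (x k))"
        unfolding Xe by (subst RR.ad_sum) (simp_all add: tau_TR T(1) ad_tau)
      have comp: "(\<Sum>i<d. tau (F i) (x i)) \<circ> (\<Sum>k<d. tau (G k) (x k)) = (\<Sum>i<d. \<Sum>k<d. tau (F i \<circ> G k) (x i * x k))"
        if F: "\<And>i. i < d \<Longrightarrow> linear_end act (F i)" "\<And>i. i < d \<Longrightarrow> linear_end act (G i)" for F G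
      proof
        fix v
        have a: "tau (F i) (x i) (\<Sum>k<d. tau (G k) (x k) v) = (\<Sum>k<d. tau (F i \<circ> G k) (x i * x k) v)" if i: "i < d" for i
        proof -
          have "tau (F i) (x i) (tau (G k) (x k) v) = tau (F i \<circ> G k) (x i * x k) v" if "k < d" for k
            using fun_cong[OF tau_comp[OF F(1)[OF i] F(2)[OF that]], of "x i" "x k" v] by simp
          then show ?thesis by (simp add: linear_end_sum[OF tau_linear[OF F(1)[OF i]]])
        qed
        have s: "(\<Sum>i<d. f i) v = (\<Sum>i<d. f i v)" for f :: "nat \<Rightarrow> 'vr \<Rightarrow> 'vr" and v
          by (induction d) simp_all
        show "((\<Sum>i<d. tau (F i) (x i)) \<circ> (\<Sum>k<d. tau (G k) (x k))) v = (\<Sum>i<d. \<Sum>k<d. tau (F i \<circ> G k) (x i * x k)) v"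
          by (simp add: s a)
      qed
      have "RR.ad X \<circ> X = (\<Sum>i<d. \<Sum>k<d. tau (AA.ad (T i) \<circ> T k) (x i * x k))"
        unfolding adX by (subst Xe) (rule comp, rule TA_linear[OF adT], assumption, rule TA_linear[OF T(1)])
      then have 1: "(\<forall>m\<in>CP. (\<Sum>k<d. j (m k) * inc (x k)) \<in> range inc) \<and> (\<forall>m\<in>CZ. (\<Sum>k<d. j (m k) * inc (x k)) = 0)"
        using X(2) by (intro C(3)) simp
      have "X \<circ> RR.ad X = (\<Sum>i<d. \<Sum>k<d. tau (T i \<circ> AA.ad (T k)) (x i * x k))"
        unfolding adX by (subst Xe) (rule comp, rule TA_linear[OF T(1)], assumption, rule TA_linear[OF adT])
      then have 2: "(\<forall>m\<in>CP'. (\<Sum>k<d. j (m k) * inc (x k)) \<in> range inc) \<and> (\<forall>m\<in>CZ'. (\<Sum>k<d. j (m k) * inc (x k)) = 0)"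
        using X(3) by (intro C'(3)) simp
      define \<psi>R where "\<psi>R = case_sum (\<lambda>p. matrix_entryR p X) (\<lambda>m. \<Sum>k<d. j (m k) * inc (x k))"
      have \<psi>R_simps: "\<psi>R (Inl p) = matrix_entryR p X" "\<psi>R (Inr m) = (\<Sum>k<d. j (m k) * inc (x k))" for p m
        by (simp_all add: \<psi>R_def)
      \<comment> \<open>A linear condition with coefficients in \<open>F\<close> commutes with
        \<open>\<mu>\<close>. So the slices of \<open>X\<close> satisfy the vanishing conditions and
        lie in \<open>E'\<close>, although they need not be integral.\<close>
      have lin_slice: "\<mu> (\<Sum>k<d. j (m k) * inc (x k)) = (\<Sum>k<d. m k * t k (slice \<mu> X))" if \<mu>: "functional scKR \<mu>" for \<mu> m
        unfolding functional_sum[OF \<mu>]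
        by (rule sum.cong) (use functional_scale[OF \<mu>] T(5)[OF \<mu>] x in \<open>simp_all add: scKR_def\<close>)
      have sE': "slice \<mu> X \<in> E'" if \<mu>: "functional scKR \<mu>" for \<mu>
      proof -
        have "(\<Sum>k<d. m k * t k (slice \<mu> X)) = 0" if "m \<in> CZ \<union> CZ'" for m
          using lin_slice[OF \<mu>, of m] 1 2 that functional_zero[OF \<mu>] by auto
        then show ?thesis using slice_linear[OF \<mu> TR_linear[OF X(1)]] by (simp add: E'_def)
      qed
      obtain r where "\<And>k. k < e \<Longrightarrow> inc (r k) = (\<Sum>i\<in>I. j (g k i) * \<psi>R i)" "X = (\<Sum>k<e. tau (U k) (r k))"
      proof (rule descent[where X = X and w = U and d = e and J = I and g = g and \<psi> = \<psi> and \<psi>R = \<psi>R])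
        show "linear_end actR X" by (rule TR_linear[OF X(1)])
        show "linear_end act (U k)" if "k < e" for k using U that by (simp add: E'_def)
        show "\<mu> (\<psi>R i) = \<psi> i (slice \<mu> X)" if i: "i \<in> I" and \<mu>: "functional scKR \<mu>" for i \<mu>
          using i unfolding I_def by (elim UnE imageE) (simp_all add: \<psi>R_simps \<psi>_simps slice_matrix_entry[OF J(2) \<mu>] lin_slice[OF \<mu>])
        show "\<psi>R i \<in> range inc" if "i \<in> I" for i
          using that 1 2 J(5)[OF X(1)] unfolding I_def by (elim UnE imageE) (simp_all add: \<psi>R_simps)
        show "g k i \<in> A" if "k < e" "i \<in> I" for k i using g that by blast
        show "slice \<mu> X = (\<Sum>k<e. scE (\<Sum>i\<in>I. g k i * \<psi> i (slice \<mu> X)) (U k))" if "functional scKR \<mu>" for \<mu>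
          using ex sE'[OF that] by blast
      qed (rule that)
      moreover have "(\<Sum>k<e. tau (U k) (r k)) \<in> tensor_image tau AA.T1'"
        by (rule tau_sum_in) (use U T1_iff in blast)
      ultimately show "X \<in> tensor_image tau AA.T1'" by simp
    qed
  qed
qed

lemma T1_base_change:
  "tensor_product A scE \<alpha> AA.T1' tau (tensor_image tau AA.T1')" "tensor_image tau AA.T1' = RR.T1'"
proof -
  obtain d :: nat and U \<omega> where U: "\<And>k. k < d \<Longrightarrow> U k \<in> AA.T1'" "\<And>k. functional scE (\<omega> k)"
    "\<And>k X. k < d \<Longrightarrow> X \<in> AA.T1' \<Longrightarrow> \<omega> k X \<in> A" "\<And>X. X \<in> AA.T1' \<Longrightarrow> X = (\<Sum>k<d. scE (\<omega> k X) (U k))"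
    "RR.T1' \<subseteq> tensor_image tau AA.T1'" by (rule T1_linear_description) (rule that)
  have "scE a X \<in> AA.T1'" if a: "a \<in> A" and X: "X \<in> AA.T1'" for a X
  proof -
    define s where "s = scE a id"
    have s: "s \<in> TA" unfolding s_def by (rule TA_closed(3)[OF a id_TA])
    have "AA.ad id = id" by (rule AA.ad_eqI) (simp_all add: TA_linear id_TA)
    then have "AA.ad s = s" unfolding s_def by (simp add: ad_scE id_TA)
    moreover have "s \<circ> Y = Y \<circ> s" if "Y \<in> TA" for Y
      by (rule ext) (simp add: s_def scE_def linear_end_act[OF TA_linear[OF that]])
    ultimately have "s \<circ> X \<in> AA.T1'" using AA.T1'_scale[OF s _ _ X] by blast
    moreover have "s \<circ> X = scE a X" by (rule ext) (simp add: s_def scE_def)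
    ultimately show ?thesis by simp
  qed
  then show "tensor_product A scE \<alpha> AA.T1' tau (tensor_image tau AA.T1')"
    by (intro tensor_product_of_span[OF AA.T1'_closed _ _ U(1-4)]) (simp_all add: AA.T1'_iff TA_linear)
  have "tensor_image tau AA.T1' \<subseteq> RR.T1'"
  proof
    fix X assume "X \<in> tensor_image tau AA.T1'"
    then show "X \<in> RR.T1'"
    proof (induction X rule: tensor_image_induct)
      case zero
      show ?case by (rule additively_closedD(1)[OF RR.T1'_closed])
    next
      case (pure X r)
      then show ?case by (rule T1R_tau)
    next
      case (add X Y)
      then show ?case by (intro additively_closedD(4)[OF RR.T1'_closed])
    qed
  qed
  then show "tensor_image tau AA.T1' = RR.T1'" using U(5) by blast
qed

lemma T1R_submodule: "submodule_of UNIV (\<lambda>r X v. actR (X v) (\<tau>K 1 r)) TR RR.T1'"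
  unfolding submodule_of_def
proof (intro conjI ballI)
  show "RR.T1' \<subseteq> TR" by (auto simp: RR.T1'_iff)
  show "0 \<in> RR.T1'" by (rule additively_closedD(1)[OF RR.T1'_closed])
  show "X - Y \<in> RR.T1'" if "X \<in> RR.T1'" "Y \<in> RR.T1'" for X Y
    by (rule additively_closedD(2)[OF RR.T1'_closed that])
  show "(\<lambda>v. actR (X v) (\<tau>K 1 r)) \<in> RR.T1'" if "X \<in> RR.T1'" for r X
  proof -
    have "scalarR r \<circ> X \<in> RR.T1'" by (rule RR.T1'_scale) (use scalarR that in auto)
    then show ?thesis by (simp add: scalarR_def comp_def)
  qed
qed

end

lemma involution_fixes_base:
  fixes \<iota> :: "'f::field \<Rightarrow> 'k::ring_1"
  assumes cases: "K_base_field \<iota> \<sigma> \<or> K_quadratic_extension \<iota> \<sigma> \<or> K_split \<iota> \<sigma> \<or> K_quaternion \<iota> \<sigma>"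
  shows "\<sigma> (\<iota> a) = \<iota> a"
  using cases
proof (elim disjE)
  assume "K_split \<iota> \<sigma>"
  then obtain \<theta> :: "'k \<Rightarrow> 'f \<times> 'f" where "bij \<theta>" "\<forall>a. \<theta> (\<iota> a) = (a, a)" "\<forall>x. \<theta> (\<sigma> x) = (snd (\<theta> x), fst (\<theta> x))"
    unfolding K_split_def by blast
  then have "\<theta> (\<sigma> (\<iota> a)) = \<theta> (\<iota> a)" by simp
  then show ?thesis using \<open>bij \<theta>\<close> by (simp add: bij_is_inj inj_eq)
qed (simp_all add: K_base_field_def K_quadratic_extension_def K_quaternion_def)

theorem theorem3p6:
  fixes nrm :: "'f::field \<Rightarrow> real" and p :: nat and A :: "'f set"
    and \<iota> :: "'f \<Rightarrow> 'k::ring_1" and \<sigma> :: "'k \<Rightarrow> 'k" and B :: "'k set" and \<epsilon> :: int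
    and act :: "'v::ab_group_add \<Rightarrow> 'k \<Rightarrow> 'v" and n :: nat and L Ls :: "'v set"
    and h :: "'v \<Rightarrow> 'v \<Rightarrow> 'k"
    and \<alpha> :: "'f \<Rightarrow> 'r::{comm_ring,comm_monoid_mult}"
    and \<tau>K :: "'k \<Rightarrow> 'r \<Rightarrow> 'kr::{ring,monoid_mult}"
    and \<tau>V :: "'v \<Rightarrow> 'r \<Rightarrow> 'vr::ab_group_add"
    and actR :: "'vr \<Rightarrow> 'kr \<Rightarrow> 'vr" and hR :: "'vr \<Rightarrow> 'vr \<Rightarrow> 'kr"
    and T1A_R T0R :: "('vr \<Rightarrow> 'vr) set"
    and smulA :: "'f \<Rightarrow> ('v \<Rightarrow> 'v) \<Rightarrow> 'v \<Rightarrow> 'v"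
    and smulR :: "'r \<Rightarrow> ('vr \<Rightarrow> 'vr) \<Rightarrow> 'vr \<Rightarrow> 'vr"
    and \<tau>T :: "('v \<Rightarrow> 'v) \<Rightarrow> 'r \<Rightarrow> 'vr \<Rightarrow> 'vr"
  assumes "nonarch_local_field nrm" and "A = ring_of_integers nrm"
    and "residue_characteristic nrm p"
    and "central_embedding \<iota>"
    and "K_base_field \<iota> \<sigma> \<or> K_quadratic_extension \<iota> \<sigma> \<or> K_split \<iota> \<sigma> \<or> K_quaternion \<iota> \<sigma>"
    and "is_maximal_order A \<iota> B"
    and "\<epsilon> \<in> {1, -1}"
    and "right_module act" and "free_lattice act B n L"
    and "hermitian_form act \<sigma> \<epsilon> h"
    and "integral_on_lattice act B L (K_base_field \<iota> \<sigma> \<and> \<epsilon> = 1 \<and> p = 2) h"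
    and "nondegenerate h"
    and "Ls = dual_lattice h B L" and "dual_lattice h B Ls = L"
    and "etale_algebra A \<alpha>"
    and "tensor_ring A \<iota> \<alpha> \<tau>K" and "tensor_space A \<iota> \<alpha> \<tau>K act \<tau>V actR" and "tensor_form \<tau>K \<tau>V h hR"
    and "T0R = T0 actR (tensor_image \<tau>V L) (tensor_image \<tau>V Ls)"
    and "smulA = (\<lambda>a X v. act (X v) (\<iota> a))"
    and "smulR = (\<lambda>r X v. actR (X v) (\<tau>K 1 r))"
    and "\<tau>T = (\<lambda>X r. smulR r (base_change_map \<tau>V X))"
    and "T1A_R = tensor_image \<tau>T (T1 act h L Ls)"
  shows "tensor_product A smulA \<alpha> (T1 act h L Ls) \<tau>T T1A_R \<and>
    submodule_of UNIV smulR T0R T1A_R \<and>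
    submodule_of UNIV smulR T0R
      {X \<in> T0R. phi0 hR X \<in> psi0 hR ` T0R \<and> phi0 hR (adjoint_end actR hR X) \<in> psi0 hR ` T0R} \<and>
    T1A_R \<subseteq> {X \<in> T0R. phi0 hR X \<in> psi0 hR ` T0R \<and> phi0 hR (adjoint_end actR hR X) \<in> psi0 hR ` T0R} \<and>
    T1A_R = {X \<in> T0R. phi0 hR X \<in> psi0 hR ` T0R \<and> phi0 hR (adjoint_end actR hR X) \<in> psi0 hR ` T0R}"
proof -
  obtain \<pi> where \<pi>: "0 < nrm \<pi>" "nrm \<pi> < 1" "\<forall>x. nrm x < 1 \<longrightarrow> nrm x \<le> nrm \<pi>"
    using assms(1) unfolding nonarch_local_field_def by blast
  interpret lattice_setting nrm A \<pi> \<iota> \<alpha> \<tau>K \<sigma> \<epsilon> B act n L Ls h \<tau>V actR hR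
  proof
    show "is_order A \<iota> B" using assms(6) by (simp add: is_maximal_order_def)
    show "\<sigma> (\<iota> a) = \<iota> a" for a by (rule involution_fixes_base[OF assms(5)])
    show "nrm x \<le> nrm \<pi>" if "nrm x < 1" for x using \<pi>(3) that by blast
  qed (fact assms \<pi>)+
  have smulA: "smulA = scE" unfolding assms(20) scE_def[abs_def] ..
  have \<tau>T: "\<tau>T = tau" unfolding assms(21,22) tau_def[abs_def] ..
  have R: "{X \<in> T0R. phi0 hR X \<in> psi0 hR ` T0R \<and> phi0 hR (adjoint_end actR hR X) \<in> psi0 hR ` T0R} = RR.T1'"
    unfolding assms(19) RR.T1'_def ..
  have T1A_R: "T1A_R = RR.T1'" unfolding assms(23) \<tau>T T1_eq by (rule T1_base_change(2))
  have "tensor_product A smulA \<alpha> (T1 act h L Ls) \<tau>T T1A_R"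
    unfolding assms(23) smulA \<tau>T T1_eq by (rule T1_base_change(1))
  moreover have "submodule_of UNIV smulR T0R RR.T1'" unfolding assms(19,21) by (rule T1R_submodule)
  ultimately show ?thesis unfolding R T1A_R by simp
qed

end
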